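(* Let $(X_i,Y_i)$, $i\ge 1$, be i.i.d. copies of $(X,Y)$ with $Y=\beta_0^TX+\epsilon$, and suppose that assumptions (A1)-(A11) listed in the context hold. Let $\widehat\theta_n=(\widehat\beta_n,\widehat s_n)$ be a maximum likelihood estimator of $\theta_0=(\beta_0,s_0)$ based on $(X_1,Y_1),\dots,(X_n,Y_n)$, that is, any maximizer over $\mathbb R^d\times(0,\infty)$ of $$\ell_n(\beta,s)=-n\log s+\sum_{i=1}^n\log f\left(\frac{Y_i-\beta^TX_i}{s}\right).$$ Then $\widehat\theta_n$ is asymptotically normal; more specifically, as $n\to\infty$, $$\sqrt n\,(\widehat\theta_n-\theta_0)\to_d\mathcal N(\mathbf 0_{d+1},I_0^{-1}),\qquad I_0=\begin{pmatrix}c_1\,\mathbb E[XX^T]&\mathbf 0_d\\ \mathbf 0_d^T&c_2\end{pmatrix},$$ where $\mathbf 0_k=(0,\dots,0)^T\in\mathbb R^k$ and $$c_1=\frac1{s_0^2}\int_{\mathbb R}\frac{(f'(t))^2}{f(t)}\,dt,\qquad c_2=\frac1{s_0^2}\left(\int_{\mathbb R}\frac{(f'(t))^2}{f(t)}\,t^2\,dt-1\right).$$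
   Context: Setting: $d\ge1$ is an integer, $\beta_0\in\mathbb R^d$ and $s_0\in(0,\infty)$ are the true (unknown) regression vector and scale, and $\mathbb E_{(\beta_0,s_0)}$ denotes expectation under the true distribution of $(X,Y)$. Write $f_s(t)=s^{-1}f(t/s)$ for $s>0$. Convention: $\log 0=-\infty$. $\|\cdot\|$ is the Euclidean norm and $\to_d$ denotes convergence in distribution. Assumptions: (A1) $X$ and $\epsilon$ are independent. (A2) The distribution of $X$ admits a density $f^X$ with respect to Lebesgue measure on $\mathbb R^d$. (A3) The distribution of $\epsilon$ admits the density $f^\epsilon(t)=s_0^{-1}f(t/s_0)$, where $f$ is a known even, bounded and continuous probability density on $\mathbb R$ with $\int_{\mathbb R}t^2f(t)\,dt<\infty$. (A4) There exist $\alpha>0$ and $C>0$ such that $f(t)\le C\exp(-|t|^\alpha)$ for all $t$. (A5) $\mathbb E_{(\beta_0,s_0)}\left|\log f\left(\frac{Y-\beta_0^TX}{s_0}\right)\right|<\infty$. (A6) $\mathbb E[\|X\|^{\max(2\alpha,2)}]<\infty$, with $\alpha$ as in (A4). (A7) $f$ is non-increasing on $[0,\infty)$. (A8) $\mathbb E_{(\beta_0,s_0)}\left[\left(\log f\left(\frac{|Y|+R\|X\|}{a}\right)\right)^2\right]<\infty$ for any $R>0$, $a>0$. (A9) $f$ is twice continuously differentiable on the interior of its support. (A10) For all $\delta>0$ there exists $\eta>0$ such that whenever $\|\beta^*-\beta_0\|+|s^*-s_0|\le\eta$, it holds for all $1\le i,j\le d$ that $$\sup_{(x,y)}\left|\frac{\partial^2\log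 f_s(y-\beta^Tx)}{\partial\beta_i\,\partial\beta_j}\Big|_{(\beta,s)=(\beta_0,s_0)}-\frac{\partial^2\log f_s(y-\beta^Tx)}{\partial\beta_i\,\partial\beta_j}\Big|_{(\beta,s)=(\beta^*,s^* )}\right|<\delta,$$ where the supremum is over $(x,y)$ in the support of the distribution of $(X,Y)$. (A11) The matrix $\mathbb E[XX^T]$ is positive definite, and $\int t^2\frac{(f'(t))^2}{f(t)}\,dt\in(0,\infty)$. (Under these assumptions a maximizer of $\ell_n$ exists almost surely for all $n$ large enough; it need not be unique.) *)

theory Defs
  imports "HOL-Probability.Probability"
begin

text \<open>Logarithm on the nonnegative reals with the convention \<open>log 0 = -\<infinity>\<close>
  (whereas \<open>ln 0 = 0\<close> in the library).\<close>

definition elog :: "real \<Rightarrow> ereal" where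
  "elog x = (if 0 < x then ereal (ln x) else -\<infinity>)"

definition scaled :: "(real \<Rightarrow> real) \<Rightarrow> real \<Rightarrow> real \<Rightarrow> real" where
  "scaled f s t = f (t / s) / s"

definition loglik ::
  "(real \<Rightarrow> real) \<Rightarrow> nat \<Rightarrow> (nat \<Rightarrow> real ^ 'd) \<Rightarrow> (nat \<Rightarrow> real) \<Rightarrow> real ^ 'd \<Rightarrow> real \<Rightarrow> ereal" where
  "loglik f n x y \<beta> s =
     ereal (- real n * ln s) + (\<Sum>i=1..n. elog (f ((y i - \<beta> \<bullet> x i) / s)))"

definition is_mle ::
  "(real \<Rightarrow> real) \<Rightarrow> nat \<Rightarrow> (nat \<Rightarrow> real ^ 'd) \<Rightarrow> (nat \<Rightarrow> real) \<Rightarrow> real ^ 'd \<Rightarrow> real \<Rightarrow> bool" where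
  "is_mle f n x y \<beta> s \<longleftrightarrow>
     0 < s \<and> (\<forall>\<beta>' s'. 0 < s' \<longrightarrow> loglik f n x y \<beta>' s' \<le> loglik f n x y \<beta> s)"

definition C2_on :: "real set \<Rightarrow> (real \<Rightarrow> real) \<Rightarrow> bool" where
  "C2_on S f \<longleftrightarrow> f C1_differentiable_on S \<and> deriv f C1_differentiable_on S"

definition partial_deriv :: "'d \<Rightarrow> (real ^ 'd \<Rightarrow> real) \<Rightarrow> real ^ 'd \<Rightarrow> real" where
  "partial_deriv i g b = deriv (\<lambda>h. g (b + h *\<^sub>R axis i 1)) 0"

definition measure_support :: "'a::topological_space measure \<Rightarrow> 'a set" where
  "measure_support \<mu> = {z. \<forall>U. open U \<longrightarrow> z \<in> U \<longrightarrow> 0 < emeasure \<mu> U}"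

text \<open>The matrix \<open>E[X X\<^sup>T]\<close>.\<close>

definition second_moment :: "'a measure \<Rightarrow> ('a \<Rightarrow> real ^ 'd) \<Rightarrow> real ^ 'd ^ 'd" where
  "second_moment P X = (\<chi> i j. \<integral>\<omega>. X \<omega> $ i * X \<omega> $ j \<partial>P)"

definition pos_definite :: "real ^ 'd ^ 'd \<Rightarrow> bool" where
  "pos_definite A \<longleftrightarrow> transpose A = A \<and> (\<forall>v. v \<noteq> 0 \<longrightarrow> 0 < v \<bullet> (A *v v))"

text \<open>Vectors in dimension \<open>d + 1\<close> are indexed by the sum type \<open>'d + unit\<close>: the first \<open>d\<close>
  coordinates are \<open>Inl i\<close>, the last one is \<open>Inr ()\<close>.\<close>

definition vec_snoc :: "real ^ 'd \<Rightarrow> real \<Rightarrow> real ^ ('d + unit)" where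
  "vec_snoc v s = (\<chi> k. case k of Inl i \<Rightarrow> v $ i | Inr _ \<Rightarrow> s)"

definition block_diag :: "real ^ 'd ^ 'd \<Rightarrow> real \<Rightarrow> real ^ ('d + unit) ^ ('d + unit)" where
  "block_diag A c = (\<chi> k l. case k of
       Inl i \<Rightarrow> (case l of Inl j \<Rightarrow> A $ i $ j | Inr _ \<Rightarrow> 0)
     | Inr _ \<Rightarrow> (case l of Inl j \<Rightarrow> 0 | Inr _ \<Rightarrow> c))"

text \<open>The normal law with mean \<open>m\<close> and covariance matrix \<open>S\<close>, for positive definite \<open>S\<close>.\<close>

definition multivariate_normal :: "real ^ 'k \<Rightarrow> real ^ 'k ^ 'k \<Rightarrow> (real ^ 'k) measure" where
  "multivariate_normal m S = density lborel (\<lambda>x. ennreal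
     (exp (- ((x - m) \<bullet> (matrix_inv S *v (x - m))) / 2) / sqrt ((2 * pi) ^ CARD('k) * det S)))"

text \<open>The library's \<open>weak_conv_m\<close> is restricted to measures on the real line.\<close>

definition converges_weakly ::
  "(nat \<Rightarrow> 'a::topological_space measure) \<Rightarrow> 'a measure \<Rightarrow> bool" where
  "converges_weakly \<mu> \<nu> \<longleftrightarrow>
     (\<forall>g :: 'a \<Rightarrow> real. continuous_on UNIV g \<longrightarrow> bounded (range g) \<longrightarrow>
        (\<lambda>n. \<integral>x. g x \<partial>\<mu> n) \<longlonglongrightarrow> (\<integral>x. g x \<partial>\<nu>))"

definition converges_in_distribution ::
  "'w measure \<Rightarrow> (nat \<Rightarrow> 'w \<Rightarrow> 'a::topological_space) \<Rightarrow> 'a measure \<Rightarrow> bool" where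
  "converges_in_distribution M Z \<nu> \<longleftrightarrow>
     (\<forall>n. Z n \<in> borel_measurable M) \<and> converges_weakly (\<lambda>n. distr M borel (Z n)) \<nu>"

end

theory Submission
  imports Defs "HOL-Probability.Probability" "HOL-Real_Asymp.Real_Asymp"
begin

text \<open>In the coordinates \<open>\<eta> = (- (\<beta> - \<beta>\<^sub>0) / s, s\<^sub>0 / s)\<close> the residual of an observation is the inner product of
  \<open>\<eta>\<close> with \<open>z = (x, (y - \<beta>\<^sub>0\<^sup>T x) / s\<^sub>0)\<close>, so up to a constant the log-likelihood is
  \<open>n log \<eta>\<^sub>d\<^sub>+\<^sub>1 + \<Sum> log f (\<eta>\<^sup>T z\<^sub>i)\<close>, the truth is the last unit vector \<open>q\<close>, and the estimation error is
  \<open>s (q - \<eta>)\<close>. Assumption (A8) forces \<open>f > 0\<close> everywhere, and (A10) forces \<open>(log f)''\<close> to be bounded: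
  it compares the values of \<open>(log f)''\<close> at \<open>u\<close> and \<open>\<kappa> u\<close> up to the factor \<open>\<kappa>\<^sup>2 > 1\<close>. Hence \<open>log f\<close> grows at most
  quadratically and all uniform laws of large numbers reduce to finite nets and \<open>E\<parallel>z\<parallel>\<^sup>2 < \<infinity>\<close>.
  By (A4) the likelihood is small for large \<open>\<eta>\<close> because the sample does not concentrate near a
  hyperplane; together with strictness of the Kullback-Leibler inequality this gives consistency. A
  first-order expansion of the score then makes the error asymptotically linear, and its limit
  follows from the one-dimensional central limit theorem: by the Stone-Weierstrass theorem on a
  torus, tight laws on \<open>\<real>\<^sup>k\<close> converge weakly as soon as the integrals of all \<open>cos (t\<^sup>T x + a)\<close> converge.\<close>

section \<open>Linear changes of variables\<close>

text \<open>The estimator need not be unique and is characterised only almost surely for large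
  \<open>n\<close>, so no formula for it exists. Consistency uses only that it does at least as well
  as the truth, the limit only that the score vanishes at it. Since residuals are linear in \<eta>,
  each derivative of the criterion is a value of \<open>g'\<close> or \<open>g''\<close> times
  components of \<open>z\<close>; with \<open>g''\<close> bounded, second moments of
  \<open>z\<close> control everything. One matrix J is both minus the expected Hessian and the
  covariance of the score. For the present density both are computed separately, by integrating
  derivatives of functions such as \<open>t * f t\<close> that vanish at infinity because of (A4).
  The mixed blocks are integrals of odd functions, so they vanish although X is not centred. The
  expansion determines J \<delta> rather than \<delta> = q - \<eta>, so every test direction is
  written as J v. The error is s \<delta> with s tending to \<open>s0\<close>, hence the limit
  covariance is \<open>s0\<^sup>2\<close> times the inverse of J, that is the inverse of
  \<open>I0 = J / s0\<^sup>2\<close>. Identifiability has two sources: the maximum of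
  \<open>f\<close> at 0 fixes the scale, and its decay at infinity excludes a shift.\<close>

lemma gram_schmidt_form:
  fixes S :: "real ^ 'k ^ 'k"
  assumes "pos_definite S"
  shows "\<exists>B :: real ^ 'k ^ 'k. transpose B ** S ** B = mat 1"
proof -
  have sym: "x \<bullet> (S *v y) = y \<bullet> (S *v x)" for x y
    using assms by (metis pos_definite_def dot_lmul_matrix inner_commute vector_transpose_matrix)
  have pos: "x \<noteq> 0 \<Longrightarrow> 0 < x \<bullet> (S *v x)" for x
    using assms by (auto simp: pos_definite_def)
  \<comment> \<open>Gram-Schmidt for the inner product defined by \<open>S\<close>, one index at a
    time; the resulting vectors become the columns of \<open>B\<close>.\<close>
  have ex: "\<exists>b. (\<forall>i\<in>I. \<forall>j\<in>I. b i \<bullet> (S *v b j) = (if i = j then 1 else 0))"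
    if "finite I" for I :: "'k set"
    using that
  proof (induction I rule: finite_induct)
    case empty then show ?case by simp
  next
    case (insert m I)
    then obtain b where b: "\<And>i j. i \<in> I \<Longrightarrow> j \<in> I \<Longrightarrow> b i \<bullet> (S *v b j) = (if i = j then 1 else 0)"
      by blast
    \<comment> \<open>The vectors found so far are fewer than the dimension, so some
      \<open>x\<close> lies outside their span; this is what keeps the residual \<open>y\<close>
      nonzero.\<close>
    have "card (b ` I) < CARD('k)"
      using card_image_le[OF insert(1), of b] card_mono[of UNIV "insert m I"] insert(1,2) by simp
    then have "dim (b ` I) < DIM(real ^ 'k)"
      using dim_le_card'[of "b ` I"] insert(1) by simp
    then have "span (b ` I) \<noteq> UNIV"
      by (metis dim_span dim_UNIV less_irrefl)
    then obtain x where x: "x \<notin> span (b ` I)" by blast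
    define y where "y = x - (\<Sum>i\<in>I. (b i \<bullet> (S *v x)) *\<^sub>R b i)"
    have "(\<Sum>i\<in>I. (b i \<bullet> (S *v x)) *\<^sub>R b i) \<in> span (b ` I)"
      by (intro span_sum span_scale span_base) auto
    with x have "y \<noteq> 0" by (auto simp: y_def)
    then have py: "0 < y \<bullet> (S *v y)" by (rule pos)
    have orth: "b j \<bullet> (S *v y) = 0" if "j \<in> I" for j
    proof -
      have "b j \<bullet> (S *v y) = b j \<bullet> (S *v x) - (\<Sum>i\<in>I. (b i \<bullet> (S *v x)) * (b j \<bullet> (S *v b i)))"
        unfolding y_def
        by (simp add: matrix_vector_mult_diff_distrib linear_sum[OF matrix_vector_mul_linear] 
            linear_cmul[OF matrix_vector_mul_linear] inner_diff_right inner_sum_right)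
      also have "(\<Sum>i\<in>I. (b i \<bullet> (S *v x)) * (b j \<bullet> (S *v b i))) =
          (\<Sum>i\<in>I. if j = i then b i \<bullet> (S *v x) else 0)"
        using b that by (intro sum.cong) auto
      finally show ?thesis using that insert(1) by simp
    qed
    define w where "w = (1 / sqrt (y \<bullet> (S *v y))) *\<^sub>R y"
    have ww: "w \<bullet> (S *v w) = 1"
      using py unfolding w_def by (simp add: linear_cmul[OF matrix_vector_mul_linear] field_simps)
    have ow: "b j \<bullet> (S *v w) = 0" if "j \<in> I" for j
      using orth[OF that] unfolding w_def by (simp add: linear_cmul[OF matrix_vector_mul_linear])
    show ?case
    proof (intro exI[of _ "b(m := w)"] ballI)
      fix i j assume "i \<in> insert m I" "j \<in> insert m I"
      then show "(b(m := w)) i \<bullet> (S *v (b(m := w)) j) = (if i = j then 1 else 0)"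
        using b ww ow insert(2) sym[of w "b j"] by (cases "i = m"; cases "j = m") auto
    qed
  qed
  obtain b :: "'k \<Rightarrow> real ^ 'k" where b: "\<And>i j. b i \<bullet> (S *v b j) = (if i = j then 1 else 0)"
    using ex[OF finite[of UNIV]] by blast
  define B :: "real ^ 'k ^ 'k" where "B = (\<chi> i j. b j $ i)"
  have "(transpose B ** S ** B) $ i $ j = b i \<bullet> (S *v b j)" for i j
    unfolding B_def matrix_matrix_mult_def matrix_vector_mult_def transpose_def inner_vec_def
    by (simp add: sum_distrib_left sum_distrib_right mult.assoc) (rule sum.swap)
  then show ?thesis
    by (intro exI[of _ B]) (simp add: vec_eq_iff b mat_def)
qed


text \<open>Fubini with the coordinate \<open>b\<close> innermost: for fixed remaining coordinates
  the shear is a translation along \<open>b\<close>, because \<open>b \<noteq> b'\<close> makes the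
  displacement \<open>c * f b'\<close> constant there.\<close>

lemma nn_integral_lborel_shear:
  fixes h :: "'a::euclidean_space \<Rightarrow> ennreal"
  assumes [measurable]: "h \<in> borel_measurable borel"
    and b: "b \<in> Basis" "b' \<in> Basis" "b \<noteq> b'"
  shows "(\<integral>\<^sup>+x. h (x + (c * (x \<bullet> b')) *\<^sub>R b) \<partial>lborel) = (\<integral>\<^sup>+x. h x \<partial>lborel)"
proof -
  interpret product_sigma_finite "\<lambda>_::'a. lborel :: real measure" ..
  let ?I = "Basis - {b}"
  define F where "F f = (\<Sum>b\<in>Basis. f b *\<^sub>R b)" for f :: "'a \<Rightarrow> real"
  have ins: "insert b ?I = Basis" using b by auto
  have F_upd: "F (f(b := y)) = (\<Sum>c\<in>?I. f c *\<^sub>R c) + y *\<^sub>R b" for f y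
  proof -
    have "F (f(b := y)) = (\<Sum>c\<in>insert b ?I. (f(b := y)) c *\<^sub>R c)"
      unfolding F_def ins ..
    also have "\<dots> = y *\<^sub>R b + (\<Sum>c\<in>?I. (f(b := y)) c *\<^sub>R c)"
      by (subst sum.insert) auto
    also have "(\<Sum>c\<in>?I. (f(b := y)) c *\<^sub>R c) = (\<Sum>c\<in>?I. f c *\<^sub>R c)"
      by (intro sum.cong) auto
    finally show ?thesis by (simp only: add.commute)
  qed
  have F_inner: "F f \<bullet> b' = f b'" for f
    unfolding F_def using b by (simp add: inner_sum_left inner_Basis if_distrib cong: if_cong)
  have [measurable]: "F \<in> borel_measurable (Pi\<^sub>M Basis (\<lambda>_. lborel))"
    unfolding F_def by measurable
  have eq: "(\<integral>\<^sup>+x. k x \<partial>lborel) =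
      (\<integral>\<^sup>+f. (\<integral>\<^sup>+y. k ((\<Sum>c\<in>?I. f c *\<^sub>R c) + y *\<^sub>R b) \<partial>lborel) \<partial>Pi\<^sub>M ?I (\<lambda>_. lborel))"
    if [measurable]: "k \<in> borel_measurable borel" for k :: "'a \<Rightarrow> ennreal"
  proof -
    have "(\<integral>\<^sup>+x. k x \<partial>lborel) = (\<integral>\<^sup>+f. k (F f) \<partial>Pi\<^sub>M Basis (\<lambda>_. lborel))"
      by (subst lborel_eq) (subst nn_integral_distr, auto simp: F_def)
    also have "\<dots> = (\<integral>\<^sup>+f. (\<integral>\<^sup>+y. k (F (f(b := y))) \<partial>lborel) \<partial>Pi\<^sub>M ?I (\<lambda>_. lborel))"
      using product_nn_integral_insert[of ?I b "\<lambda>f. k (F f)"] ins by simp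
    finally show ?thesis by (simp only: F_upd)
  qed
  have "(\<integral>\<^sup>+x. h (x + (c * (x \<bullet> b')) *\<^sub>R b) \<partial>lborel) =
      (\<integral>\<^sup>+f. (\<integral>\<^sup>+y. h ((\<Sum>c\<in>?I. f c *\<^sub>R c) + (y + c * f b') *\<^sub>R b) \<partial>lborel) \<partial>Pi\<^sub>M ?I (\<lambda>_. lborel))"
  proof (subst eq)
    have "((\<Sum>c\<in>?I. f c *\<^sub>R c) + y *\<^sub>R b) \<bullet> b' = f b'" for f y
      using F_inner[of "f(b := y)"] b(3) unfolding F_upd by (simp add: fun_upd_def)
    then show "(\<integral>\<^sup>+f. (\<integral>\<^sup>+y. h ((\<Sum>c\<in>?I. f c *\<^sub>R c) + y *\<^sub>R b +
          (c * (((\<Sum>c\<in>?I. f c *\<^sub>R c) + y *\<^sub>R b) \<bullet> b')) *\<^sub>R b) \<partial>lborel) \<partial>Pi\<^sub>M ?I (\<lambda>_. lborel)) =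
       (\<integral>\<^sup>+f. (\<integral>\<^sup>+y. h ((\<Sum>c\<in>?I. f c *\<^sub>R c) + (y + c * f b') *\<^sub>R b) \<partial>lborel) \<partial>Pi\<^sub>M ?I (\<lambda>_. lborel))"
      by (simp add: algebra_simps)
  qed measurable
  also have "\<dots> = (\<integral>\<^sup>+x. h x \<partial>lborel)"
  proof (subst eq)
    show "(\<integral>\<^sup>+f. (\<integral>\<^sup>+y. h ((\<Sum>c\<in>?I. f c *\<^sub>R c) + (y + c * f b') *\<^sub>R b) \<partial>lborel) \<partial>Pi\<^sub>M ?I (\<lambda>_. lborel)) =
       (\<integral>\<^sup>+f. (\<integral>\<^sup>+y. h ((\<Sum>c\<in>?I. f c *\<^sub>R c) + y *\<^sub>R b) \<partial>lborel) \<partial>Pi\<^sub>M ?I (\<lambda>_. lborel))"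
    proof (rule nn_integral_cong)
      fix f :: "'a \<Rightarrow> real"
      show "(\<integral>\<^sup>+y. h ((\<Sum>c\<in>?I. f c *\<^sub>R c) + (y + c * f b') *\<^sub>R b) \<partial>lborel) =
       (\<integral>\<^sup>+y. h ((\<Sum>c\<in>?I. f c *\<^sub>R c) + y *\<^sub>R b) \<partial>lborel)"
        by (subst nn_integral_real_affine[of "\<lambda>y. h ((\<Sum>c\<in>?I. f c *\<^sub>R c) + y *\<^sub>R b)" 1 "c * f b'"])
           (simp_all add: add.commute)
    qed
  qed measurable
  finally show ?thesis .
qed

lemma emeasure_lborel_box_vec:
  fixes l u :: "real ^ 'k"
  assumes "\<And>i. l $ i \<le> u $ i"
  shows "emeasure lborel (box l u) = (\<Prod>i\<in>UNIV. ennreal (u $ i - l $ i))"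
proof -
  have "emeasure lborel (box l u) = (\<Prod>b\<in>Basis. (u - l) \<bullet> b)"
    using assms by (subst emeasure_lborel_box) (auto simp: Basis_vec_def inner_axis)
  also have "(\<Prod>b\<in>Basis. (u - l) \<bullet> b) = (\<Prod>i\<in>UNIV. u $ i - l $ i)"
  proof -
    have "Basis = (\<lambda>i. axis i 1 :: real ^ 'k) ` UNIV" by (auto simp: Basis_vec_def)
    moreover have "inj (\<lambda>i. axis i 1 :: real ^ 'k)" by (auto simp: inj_on_def axis_eq_axis)
    ultimately show ?thesis
      using prod.reindex[of "\<lambda>i. axis i 1 :: real ^ 'k" UNIV "\<lambda>b. (u - l) \<bullet> b"]
      by (simp add: inner_axis)
  qed
  finally show ?thesis using assms by (simp add: prod_ennreal)
qed

text \<open>Lebesgue measure is determined by its values on boxes, and exchanging two coordinates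
  only permutes the side lengths of a box.\<close>

lemma nn_integral_lborel_swap:
  fixes h :: "real ^ 'k \<Rightarrow> ennreal"
  assumes h: "h \<in> borel_measurable borel"
  shows "(\<integral>\<^sup>+x. h (\<chi> i. x $ Transposition.transpose m n i) \<partial>lborel) = (\<integral>\<^sup>+x. h x \<partial>lborel)"
proof -
  let ?T = "\<lambda>x :: real ^ 'k. \<chi> i. x $ Transposition.transpose m n i"
  have meas: "?T \<in> borel_measurable borel"
    by (intro borel_measurable_continuous_onI continuous_intros)
  have "lborel = distr lborel borel ?T"
  proof (rule lborel_eqI)
    fix l u :: "real ^ 'k" assume le: "\<And>b. b \<in> Basis \<Longrightarrow> l \<bullet> b \<le> u \<bullet> b"
    then have le': "l $ i \<le> u $ i" for i
      by (metis axis_in_Basis_iff inner_axis inner_real_def mult.right_neutral Basis_real_def insertI1)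
    have surj: "(\<forall>i. P (Transposition.transpose m n i)) \<longleftrightarrow> (\<forall>i. P i)" for P
    proof
      assume "\<forall>i. P (Transposition.transpose m n i)"
      then have "P (Transposition.transpose m n (Transposition.transpose m n i))" for i by blast
      then show "\<forall>i. P i" by simp
    qed simp
    have "?T -` box l u = box (?T l) (?T u)"
    proof -
      have "(l $ i < x $ Transposition.transpose m n i \<and> x $ Transposition.transpose m n i < u $ i) \<longleftrightarrow>
        (l $ Transposition.transpose m n (Transposition.transpose m n i) < x $ Transposition.transpose m n i \<and>
         x $ Transposition.transpose m n i < u $ Transposition.transpose m n (Transposition.transpose m n i))" for x i
        by simp
      then show ?thesis
        using surj[of "\<lambda>i. l $ Transposition.transpose m n i < x $ i \<and> x $ i < u $ Transposition.transpose m n i" for x]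
        by (simp add: mem_box_cart set_eq_iff)
    qed
    then have "emeasure (distr lborel borel ?T) (box l u) = emeasure lborel (box (?T l) (?T u))"
      using meas by (subst emeasure_distr) auto
    also have "\<dots> = (\<Prod>i\<in>UNIV. ennreal (u $ i - l $ i))"
      using le' by (subst emeasure_lborel_box_vec)
        (auto intro!: prod.reindex_bij_betw[of "Transposition.transpose m n" UNIV UNIV "\<lambda>i. ennreal (u $ i - l $ i)"] bij_swap)
    also have "\<dots> = emeasure lborel (box l u)"
      using le' by (simp add: emeasure_lborel_box_vec)
    finally show "emeasure (distr lborel borel ?T) (box l u) = (\<Prod>b\<in>Basis. (u - l) \<bullet> b)"
      using le by (simp add: emeasure_lborel_box)
  qed simp
  then have "(\<integral>\<^sup>+x. h x \<partial>lborel) = (\<integral>\<^sup>+x. h x \<partial>distr lborel borel ?T)" by simp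
  also have "\<dots> = (\<integral>\<^sup>+x. h (?T x) \<partial>lborel)"
    using meas h by (subst nn_integral_distr) auto
  finally show ?thesis ..
qed

text \<open>The library's change of variables formula requires a well-ordered index type, which
  \<open>'d + unit\<close> is not.\<close>

lemma nn_integral_lborel_linear:
  fixes A :: "real ^ 'k ^ 'k" and h :: "real ^ 'k \<Rightarrow> ennreal"
  assumes "det A \<noteq> 0" "h \<in> borel_measurable borel"
  shows "(\<integral>\<^sup>+x. h x \<partial>lborel) = ennreal \<bar>det A\<bar> * (\<integral>\<^sup>+x. h (A *v x) \<partial>lborel)"
proof -
  have "det A \<noteq> 0 \<longrightarrow> (\<forall>h \<in> borel_measurable borel.
      (\<integral>\<^sup>+x. h x \<partial>lborel) = ennreal \<bar>det A\<bar> * (\<integral>\<^sup>+x. h (A *v x) \<partial>lborel))"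
  \<comment> \<open>Determinants are multiplicative, so generators suffice: a matrix with a zero row
    (excluded by its determinant), a diagonal matrix, a transposition of coordinates and a
    shear.\<close>
  proof (induction A rule: induct_matrix_elementary)
    case (1 A B)
    show ?case
    proof (intro impI ballI)
      fix h :: "real ^ 'k \<Rightarrow> ennreal" assume h: "h \<in> borel_measurable borel" and "det (A ** B) \<noteq> 0"
      then have nz: "det A \<noteq> 0" "det B \<noteq> 0" by (auto simp: det_mul)
      have hA: "(\<lambda>x. h (A *v x)) \<in> borel_measurable borel"
        by (rule measurable_compose[OF borel_measurable_continuous_onI h])
           (simp add: matrix_vector_mult_linear_continuous_on)
      have "(\<integral>\<^sup>+x. h x \<partial>lborel) = ennreal \<bar>det A\<bar> * (\<integral>\<^sup>+x. h (A *v x) \<partial>lborel)"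
        using 1 h nz by blast
      also have "(\<integral>\<^sup>+x. h (A *v x) \<partial>lborel) = ennreal \<bar>det B\<bar> * (\<integral>\<^sup>+x. h (A *v (B *v x)) \<partial>lborel)"
        using 1(2) nz hA by blast
      finally show "(\<integral>\<^sup>+x. h x \<partial>lborel) = ennreal \<bar>det (A ** B)\<bar> * (\<integral>\<^sup>+x. h (A ** B *v x) \<partial>lborel)"
        by (simp add: det_mul abs_mult ennreal_mult mult.assoc matrix_vector_mul_assoc)
    qed
  next
    case (2 A i)
    then show ?case using det_zero_row(1)[of i A] by simp
  next
    case (3 A)
    show ?case
    proof (intro impI ballI)
      fix h :: "real ^ 'k \<Rightarrow> ennreal" assume h[measurable]: "h \<in> borel_measurable borel" and nz: "det A \<noteq> 0"
      have det: "det A = (\<Prod>i\<in>UNIV. A $ i $ i)"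
        using 3 by (intro det_diagonal)
      \<comment> \<open>The scaling formula for Lebesgue measure takes factors indexed by basis
        vectors; at \<open>axis i 1\<close> this one is the diagonal entry.\<close>
      define c where "c b = b \<bullet> (A *v b)" for b :: "real ^ 'k"
      have c: "c (axis i 1) = A $ i $ i" for i
        by (simp add: c_def inner_axis' matrix_vector_mult_basis column_def)
      have basis: "Basis = (\<lambda>i. axis i 1 :: real ^ 'k) ` UNIV" by (auto simp: Basis_vec_def)
      have inj: "inj (\<lambda>i. axis i 1 :: real ^ 'k)" by (auto simp: inj_on_def axis_eq_axis)
      have "A $ i $ i \<noteq> 0" for i using nz unfolding det by simp
      then have cnz: "c j \<noteq> 0" if "j \<in> Basis" for j using that c unfolding basis by auto
      have T: "(\<Sum>j\<in>Basis. (c j * (x \<bullet> j)) *\<^sub>R j) = A *v x" for x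
      proof -
        have "(\<Sum>j\<in>Basis. (c j * (x \<bullet> j)) *\<^sub>R j) = (\<Sum>i\<in>UNIV. (A $ i $ i * x $ i) *\<^sub>R axis i 1)"
          unfolding basis using inj by (simp add: sum.reindex c inner_axis)
        also have "\<dots> = A *v x"
        proof -
          have "(\<Sum>j\<in>UNIV. A $ i $ j * x $ j) = A $ i $ i * x $ i" for i
            by (subst sum.remove[of _ i]) (auto simp: 3 intro!: sum.neutral)
          then show ?thesis
            by (simp add: vec_eq_iff matrix_vector_mult_def axis_def if_distrib cong: if_cong)
        qed
        finally show ?thesis .
      qed
      have prod_c: "(\<Prod>j\<in>Basis. \<bar>c j\<bar>) = \<bar>det A\<bar>"
        unfolding basis det using inj by (simp add: prod.reindex c abs_prod)
      have m: "(\<lambda>x. A *v x) \<in> borel_measurable borel"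
        by (intro borel_measurable_continuous_onI) (simp add: matrix_vector_mult_linear_continuous_on)
      have L: "lborel = density (distr lborel borel (\<lambda>x. A *v x)) (\<lambda>_. ennreal \<bar>det A\<bar>)"
        using lborel_affine_euclidean[of c 0, OF cnz] by (simp add: T prod_c)
      show "(\<integral>\<^sup>+x. h x \<partial>lborel) = ennreal \<bar>det A\<bar> * (\<integral>\<^sup>+x. h (A *v x) \<partial>lborel)"
        by (subst L) (use m in \<open>simp add: nn_integral_density nn_integral_distr nn_integral_cmult\<close>)
    qed
  next
    case (4 m n)
    let ?A = "(\<chi> i j. mat 1 $ i $ Transposition.transpose m n j) :: real ^ 'k ^ 'k"
    have "det ?A = of_int (sign (Transposition.transpose m n))"
      using det_permute_columns[of "Transposition.transpose m n" "mat 1 :: real ^ 'k ^ 'k"]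
        permutes_swap_id[of m UNIV n] by simp
    then have "\<bar>det ?A\<bar> = 1" using 4 by (simp add: sign_swap_id)
    moreover have "?A *v x = (\<chi> i. x $ Transposition.transpose m n i)" for x
    proof -
      have "(mat 1 $ i $ Transposition.transpose m n j :: real) = (if j = Transposition.transpose m n i then 1 else 0)" for i j
        unfolding mat_def by (auto simp: transpose_eq_iff)
      then have "(\<Sum>j\<in>UNIV. mat 1 $ i $ Transposition.transpose m n j * x $ j) =
          (\<Sum>j\<in>UNIV. if j = Transposition.transpose m n i then x $ j else 0)" for i
        by (intro sum.cong) auto
      then show ?thesis
        by (simp add: vec_eq_iff matrix_vector_mult_def)
    qed
    ultimately show ?case by (auto simp: nn_integral_lborel_swap)
  next
    case (5 m n c)
    let ?A = "(\<chi> i j. if i = m \<and> j = n then c else of_bool (i = j)) :: real ^ 'k ^ 'k"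
    have A: "?A = (\<chi> k. if k = m then row m (mat 1) + c *s row n (mat 1) else row k (mat 1))"
      using 5 by (auto simp: vec_eq_iff row_def mat_def)
    have "det ?A = 1"
      unfolding A using det_row_operation[OF 5, of "mat 1 :: real ^ 'k ^ 'k" c] by simp
    moreover have "?A *v x = x + (c * (x \<bullet> axis n 1)) *\<^sub>R axis m 1" for x
    proof -
      have "(\<Sum>j\<in>UNIV. (if i = m \<and> j = n then c else of_bool (i = j)) * x $ j) =
         x $ i + (if i = m then c * x $ n else 0)" for i
      proof -
        have "(\<Sum>j\<in>UNIV. (if i = m \<and> j = n then c else of_bool (i = j)) * x $ j) =
          (\<Sum>j\<in>UNIV. (if j = i then x $ j else 0) + (if j = n then (if i = m then c * x $ j else 0) else 0))"
          using 5 by (intro sum.cong) auto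
        also have "\<dots> = x $ i + (if i = m then c * x $ n else 0)"
          by (subst sum.distrib) simp
        finally show ?thesis .
      qed
      then show ?thesis
        by (simp add: vec_eq_iff matrix_vector_mult_def inner_axis) (simp add: axis_def)
    qed
    ultimately show ?case
      using 5 nn_integral_lborel_shear[of _ "axis m 1 :: real ^ 'k" "axis n 1" c]
      by (auto simp: axis_eq_axis)
  qed
  with assms show ?thesis by blast
qed

section \<open>Multivariate normal distributions\<close>

lemma std_normal_prod_density:
  fixes u :: "real ^ 'k"
  shows "(\<Prod>b\<in>Basis. std_normal_density (u \<bullet> b)) = exp (- (u \<bullet> u) / 2) / sqrt ((2 * pi) ^ CARD('k))"
proof -
  have "(\<Prod>b\<in>Basis. std_normal_density (u \<bullet> b)) =
      (\<Prod>b\<in>(Basis :: (real ^ 'k) set). 1 / sqrt (2 * pi)) * (\<Prod>b\<in>Basis. exp (- (u \<bullet> b)\<^sup>2 / 2))"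
    unfolding std_normal_density_def by (rule prod.distrib)
  also have "(\<Prod>b\<in>(Basis :: (real ^ 'k) set). 1 / sqrt (2 * pi)) = 1 / sqrt ((2 * pi) ^ CARD('k))"
    by (simp add: real_sqrt_power power_divide power_mult_distrib real_sqrt_mult)
  also have "(\<Prod>b\<in>Basis. exp (- (u \<bullet> b)\<^sup>2 / 2)) = exp (- (u \<bullet> u) / 2)"
    by (simp add: exp_sum[symmetric] euclidean_inner[of u u] power2_eq_square sum_negf sum_divide_distrib)
  finally show ?thesis by simp
qed

lemma integrable_iexp_std_normal:
  "integrable lborel (\<lambda>x. complex_of_real (std_normal_density x) * iexp (w * x))"
proof -
  have "integrable lborel (\<lambda>x. std_normal_density x * 1)"
    using integrable_normal_moment[of 1 0 0] by simp
  then show ?thesis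
    by (rule Bochner_Integration.integrable_bound) (auto simp: norm_mult)
qed

lemma integral_iexp_std_normal:
  "(\<integral>x. complex_of_real (std_normal_density x) * iexp (w * x) \<partial>lborel) = exp (- (w\<^sup>2) / 2)"
proof -
  have "(\<integral>x. complex_of_real (std_normal_density x) * iexp (w * x) \<partial>lborel) = char std_normal_distribution w"
    unfolding char_def by (subst integral_density) (auto simp: scaleR_conv_of_real)
  then show ?thesis by (simp add: char_std_normal_distribution)
qed

lemma integral_lborel_prod_complex:
  fixes F :: "'a::euclidean_space \<Rightarrow> real \<Rightarrow> complex"
  assumes "\<And>b. b \<in> Basis \<Longrightarrow> integrable lborel (F b)"
  shows "(\<integral>u. (\<Prod>b\<in>Basis. F b (u \<bullet> b)) \<partial>lborel) = (\<Prod>b\<in>Basis. \<integral>x. F b x \<partial>lborel)"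
proof -
  interpret product_sigma_finite "\<lambda>_::'a. lborel :: real measure" ..
  have [measurable]: "b \<in> Basis \<Longrightarrow> F b \<in> borel_measurable borel" for b
    using assms[THEN borel_measurable_integrable] by simp
  have "(\<integral>u. (\<Prod>b\<in>Basis. F b (u \<bullet> b)) \<partial>lborel) =
     (\<integral>f. (\<Prod>b\<in>Basis. F b ((\<Sum>b\<in>Basis. f b *\<^sub>R b) \<bullet> b)) \<partial>Pi\<^sub>M Basis (\<lambda>_. lborel))"
    by (subst lborel_eq) (subst integral_distr, auto)
  also have "\<dots> = (\<integral>f. (\<Prod>b\<in>Basis. F b (f b)) \<partial>Pi\<^sub>M Basis (\<lambda>_. lborel))"
    by (simp add: inner_sum_left inner_Basis if_distrib cong: if_cong prod.cong)
  also have "\<dots> = (\<Prod>b\<in>Basis. \<integral>x. F b x \<partial>lborel)"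
    using assms by (subst product_integral_prod) auto
  finally show ?thesis .
qed

lemma matrix_inv_unique:
  fixes A B :: "real ^ 'k ^ 'k"
  assumes "A ** B = mat 1" "B ** A = mat 1"
  shows "matrix_inv A = B"
proof -
  have "A ** matrix_inv A = mat 1 \<and> matrix_inv A ** A = mat 1"
    unfolding matrix_inv_def by (rule someI[of _ B]) (use assms in simp)
  then show ?thesis by (metis assms(2) matrix_mul_assoc matrix_mul_lid matrix_mul_rid)
qed

text \<open>\<open>S\<close> plays the part of a precision matrix. The relation for \<open>B\<close>
  inverts to \<open>matrix_inv S = B ** transpose B\<close>, so \<open>B\<close> carries a standard
  normal vector to one with covariance \<open>matrix_inv S\<close>.\<close>

lemma pos_definite_factor:
  fixes S :: "real ^ 'k ^ 'k"
  assumes "pos_definite S"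
  obtains B :: "real ^ 'k ^ 'k" where "transpose B ** S ** B = mat 1" "det B \<noteq> 0"
    "matrix_inv S = B ** transpose B" "matrix_inv (matrix_inv S) = S"
    "det (matrix_inv S) = (det B)\<^sup>2"
proof -
  obtain B :: "real ^ 'k ^ 'k" where B: "transpose B ** S ** B = mat 1"
    using gram_schmidt_form[OF assms] by blast
  have "B ** (transpose B ** S) = mat 1"
    using B matrix_left_right_inverse by blast
  then have 1: "B ** transpose B ** S = mat 1" by (simp add: matrix_mul_assoc)
  then have 2: "S ** (B ** transpose B) = mat 1" using matrix_left_right_inverse by blast
  have "det (transpose B ** S) * det B = 1"
    using arg_cong[OF B, of det] by (simp add: det_mul)
  then have "det B \<noteq> 0" by auto
  moreover have inv: "matrix_inv S = B ** transpose B"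
    by (rule matrix_inv_unique[OF 2 1])
  moreover have "matrix_inv (matrix_inv S) = S"
    unfolding inv by (rule matrix_inv_unique[OF 1 2])
  moreover have "det (matrix_inv S) = (det B)\<^sup>2"
    unfolding inv by (simp add: det_mul power2_eq_square)
  ultimately show ?thesis using B that by blast
qed

text \<open>The substitution \<open>x = B *v u\<close> turns the quadratic form in the density into
  \<open>u \<bullet> u\<close>, and its Jacobian cancels the square root of
  \<open>det (matrix_inv S)\<close>.\<close>

lemma multivariate_normal_eq_distr:
  fixes S B :: "real ^ 'k ^ 'k"
  assumes B: "transpose B ** S ** B = mat 1" "det B \<noteq> 0" "matrix_inv (matrix_inv S) = S"
    "det (matrix_inv S) = (det B)\<^sup>2"
  shows "multivariate_normal 0 (matrix_inv S) =
    distr (density lborel (\<lambda>u. ennreal (\<Prod>b\<in>Basis. std_normal_density (u \<bullet> b)))) borel (\<lambda>u. B *v u)"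
    (is "_ = distr ?G borel ?B")
proof (rule measure_eqI)
  have [measurable]: "(\<lambda>u. B *v u) \<in> borel_measurable borel" "(\<lambda>u. S *v u) \<in> borel_measurable borel"
    by (intro borel_measurable_continuous_onI; simp add: matrix_vector_mult_linear_continuous_on)+
  show "sets (multivariate_normal 0 (matrix_inv S)) = sets (distr ?G borel ?B)"
    by (simp add: multivariate_normal_def)
  fix A assume "A \<in> sets (multivariate_normal 0 (matrix_inv S))"
  then have A[measurable]: "A \<in> sets borel" by (simp add: multivariate_normal_def)
  define p where "p x = ennreal (exp (- (x \<bullet> (S *v x)) / 2) / sqrt ((2 * pi) ^ CARD('k) * (det B)\<^sup>2))" for x
  have [measurable]: "p \<in> borel_measurable borel" unfolding p_def by measurable
  have quad: "(B *v u) \<bullet> (S *v (B *v u)) = u \<bullet> u" for u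
  proof -
    have "(B *v u) \<bullet> (S *v (B *v u)) = u \<bullet> (transpose B *v (S *v (B *v u)))"
      by (metis dot_lmul_matrix inner_commute vector_transpose_matrix transpose_transpose)
    then show ?thesis using B(1) by (simp add: matrix_vector_mul_assoc matrix_mul_assoc)
  qed
  have p: "ennreal \<bar>det B\<bar> * p (B *v u) = ennreal (\<Prod>b\<in>Basis. std_normal_density (u \<bullet> b))" for u
    unfolding std_normal_prod_density p_def quad using B(2)
    by (simp add: ennreal_mult[symmetric] real_sqrt_mult)
  have "emeasure (multivariate_normal 0 (matrix_inv S)) A = (\<integral>\<^sup>+x. p x * indicator A x \<partial>lborel)"
    unfolding multivariate_normal_def B(3,4) p_def[symmetric] diff_zero by (simp add: emeasure_density)
  also have "\<dots> = ennreal \<bar>det B\<bar> * (\<integral>\<^sup>+u. p (B *v u) * indicator A (B *v u) \<partial>lborel)"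
    by (rule nn_integral_lborel_linear[OF B(2)]) measurable
  also have "\<dots> = (\<integral>\<^sup>+u. ennreal (\<Prod>b\<in>Basis. std_normal_density (u \<bullet> b)) * indicator A (B *v u) \<partial>lborel)"
    by (subst nn_integral_cmult[symmetric]) (auto simp: p[symmetric] mult.assoc)
  also have "\<dots> = emeasure (distr ?G borel ?B) A"
  proof -
    have "(\<lambda>u. B *v u) -` A \<in> sets borel"
      using measurable_sets[of "\<lambda>u. B *v u" borel borel A] A by simp
    then show ?thesis
      by (subst emeasure_distr) (auto simp: emeasure_density intro!: nn_integral_cong split: split_indicator)
  qed
  finally show "emeasure (multivariate_normal 0 (matrix_inv S)) A = emeasure (distr ?G borel ?B) A" .
qed

lemma prob_space_std_normal_prod:
  "prob_space (density lborel (\<lambda>u :: 'a::euclidean_space. ennreal (\<Prod>b\<in>Basis. std_normal_density (u \<bullet> b))))"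
proof
  have "(\<integral>\<^sup>+u. ennreal (\<Prod>b\<in>Basis. std_normal_density (u \<bullet> b)) \<partial>(lborel :: 'a measure)) =
     (\<integral>\<^sup>+u. (\<Prod>b\<in>Basis. ennreal (std_normal_density (u \<bullet> b))) \<partial>(lborel :: 'a measure))"
    by (subst prod_ennreal) auto
  also have "\<dots> = (\<Prod>b\<in>(Basis :: 'a set). \<integral>\<^sup>+x. ennreal (std_normal_density x) \<partial>lborel)"
    by (rule nn_integral_lborel_prod) auto
  also have "\<dots> = 1"
    using prob_space.emeasure_space_1[OF prob_space_normal_density[of 1 0]] by (simp add: emeasure_density)
  finally show "emeasure (density lborel (\<lambda>u :: 'a. ennreal (\<Prod>b\<in>Basis. std_normal_density (u \<bullet> b))))
     (space (density lborel (\<lambda>u. ennreal (\<Prod>b\<in>Basis. std_normal_density (u \<bullet> b))))) = 1"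
    by (simp add: emeasure_density)
qed

lemma prob_space_multivariate_normal:
  fixes S :: "real ^ 'k ^ 'k"
  assumes "pos_definite S"
  shows "prob_space (multivariate_normal 0 (matrix_inv S))"
proof -
  obtain B :: "real ^ 'k ^ 'k" where B: "transpose B ** S ** B = mat 1" "det B \<noteq> 0"
    "matrix_inv (matrix_inv S) = S" "det (matrix_inv S) = (det B)\<^sup>2"
    using pos_definite_factor[OF assms] by metis
  have "(\<lambda>u. B *v u) \<in> borel_measurable borel"
    by (intro borel_measurable_continuous_onI) (simp add: matrix_vector_mult_linear_continuous_on)
  then show ?thesis
    unfolding multivariate_normal_eq_distr[OF B]
    by (intro prob_space.prob_space_distr[OF prob_space_std_normal_prod]) simp
qed

lemma iexp_multivariate_normal:
  fixes S :: "real ^ 'k ^ 'k"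
  assumes "pos_definite S"
  shows "(\<integral>x. iexp (t \<bullet> x) \<partial>multivariate_normal 0 (matrix_inv S)) =
    complex_of_real (exp (- (t \<bullet> (matrix_inv S *v t)) / 2))"
proof -
  obtain B :: "real ^ 'k ^ 'k" where B: "transpose B ** S ** B = mat 1" "det B \<noteq> 0"
    "matrix_inv (matrix_inv S) = S" "det (matrix_inv S) = (det B)\<^sup>2" and inv: "matrix_inv S = B ** transpose B"
    using pos_definite_factor[OF assms] by metis
  have [measurable]: "(\<lambda>u. B *v u) \<in> borel_measurable borel"
    by (intro borel_measurable_continuous_onI) (simp add: matrix_vector_mult_linear_continuous_on)
  \<comment> \<open>Under \<open>x = B *v u\<close> the phase \<open>t \<bullet> x\<close> becomes
    \<open>w \<bullet> u\<close>, which splits over the independent coordinates of \<open>u\<close>;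
    the variance in direction \<open>t\<close> is then \<open>w \<bullet> w\<close>.\<close>
  define w where "w = transpose B *v t"
  have tB: "t \<bullet> (B *v u) = w \<bullet> u" for u
    unfolding w_def by (metis dot_lmul_matrix vector_transpose_matrix transpose_transpose)
  have ww: "t \<bullet> (matrix_inv S *v t) = w \<bullet> w"
    unfolding inv matrix_vector_mul_assoc[symmetric] tB w_def ..
  have "(\<integral>x. iexp (t \<bullet> x) \<partial>multivariate_normal 0 (matrix_inv S)) =
     (\<integral>u. (\<Prod>b\<in>Basis. std_normal_density (u \<bullet> b)) *\<^sub>R iexp (w \<bullet> u) \<partial>lborel)"
    unfolding multivariate_normal_eq_distr[OF B]
    by (subst integral_distr) (auto simp: tB integral_density prod_nonneg)
  also have "\<dots> = (\<integral>u. (\<Prod>b\<in>Basis. complex_of_real (std_normal_density (u \<bullet> b)) * iexp ((w \<bullet> b) * (u \<bullet> b))) \<partial>lborel)"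
  proof (rule Bochner_Integration.integral_cong[OF refl])
    fix u :: "real ^ 'k"
    have "iexp (w \<bullet> u) = (\<Prod>b\<in>Basis. iexp ((w \<bullet> b) * (u \<bullet> b)))"
      by (subst euclidean_inner) (simp add: exp_sum[symmetric] sum_distrib_left)
    then show "(\<Prod>b\<in>Basis. std_normal_density (u \<bullet> b)) *\<^sub>R iexp (w \<bullet> u) =
       (\<Prod>b\<in>Basis. complex_of_real (std_normal_density (u \<bullet> b)) * iexp ((w \<bullet> b) * (u \<bullet> b)))"
      by (simp add: prod.distrib scaleR_conv_of_real)
  qed
  also have "\<dots> = (\<Prod>b\<in>(Basis :: (real ^ 'k) set). complex_of_real (exp (- ((w \<bullet> b)\<^sup>2) / 2)))"
    by (subst integral_lborel_prod_complex[OF integrable_iexp_std_normal])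
       (simp only: integral_iexp_std_normal of_real_exp[symmetric])
  also have "\<dots> = complex_of_real (\<Prod>b\<in>(Basis :: (real ^ 'k) set). exp (- ((w \<bullet> b)\<^sup>2) / 2))"
    by simp
  also have "(\<Prod>b\<in>(Basis :: (real ^ 'k) set). exp (- ((w \<bullet> b)\<^sup>2) / 2)) = exp (- (w \<bullet> w) / 2)"
    by (simp add: exp_sum[symmetric] euclidean_inner[of w w] power2_eq_square sum_negf sum_divide_distrib)
  finally show ?thesis unfolding ww by simp
qed

lemma sets_multivariate_normal: "sets (multivariate_normal m S) = sets borel"
  by (simp add: multivariate_normal_def)

section \<open>Weak convergence in several dimensions\<close>

text \<open>The phase \<open>a\<close> turns sines and, with \<open>t = 0\<close>, constants into
  instances of the cosine case, so sums of shifted cosines already form an algebra.\<close>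

inductive trig_polynomial :: "('a::real_inner \<Rightarrow> real) \<Rightarrow> bool" where
  cos: "trig_polynomial (\<lambda>x. c * cos (t \<bullet> x + a))"
| add: "trig_polynomial p \<Longrightarrow> trig_polynomial q \<Longrightarrow> trig_polynomial (\<lambda>x. p x + q x)"

lemma trig_polynomial_const: "trig_polynomial (\<lambda>x. c)"
  using trig_polynomial.cos[of c 0 0] by simp

lemma trig_polynomial_sum:
  "finite I \<Longrightarrow> (\<And>i. i \<in> I \<Longrightarrow> trig_polynomial (p i)) \<Longrightarrow> trig_polynomial (\<lambda>x. \<Sum>i\<in>I. p i x)"
  by (induction I rule: finite_induct) (auto intro: trig_polynomial.add trig_polynomial_const)

lemma trig_polynomial_mult_cos:
  assumes "trig_polynomial p"
  shows "trig_polynomial (\<lambda>x. p x * (d * cos (u \<bullet> x + b)))"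
  using assms
proof induction
  case (cos c t a)
  have eq: "c * cos (t \<bullet> x + a) * (d * cos (u \<bullet> x + b)) =
     c * d / 2 * cos ((t - u) \<bullet> x + (a - b)) + c * d / 2 * cos ((t + u) \<bullet> x + (a + b))" for x
  proof -
    have 1: "(t - u) \<bullet> x + (a - b) = (t \<bullet> x + a) - (u \<bullet> x + b)" "(t + u) \<bullet> x + (a + b) = (t \<bullet> x + a) + (u \<bullet> x + b)"
      by (simp_all add: inner_diff_left inner_add_left)
    have "c * cos (t \<bullet> x + a) * (d * cos (u \<bullet> x + b)) = c * d * (cos (t \<bullet> x + a) * cos (u \<bullet> x + b))"
      by (simp only: ac_simps)
    then show ?thesis unfolding cos_times_cos 1 by (simp add: field_simps)
  qed
  show ?case unfolding eq by (intro trig_polynomial.intros)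
next
  case (add p q)
  then show ?case using trig_polynomial.add by (simp add: distrib_right)
qed

lemma trig_polynomial_mult:
  assumes "trig_polynomial p" "trig_polynomial q"
  shows "trig_polynomial (\<lambda>x. p x * q x)"
  using assms(2)
proof induction
  case (cos d u b)
  then show ?case using trig_polynomial_mult_cos[OF assms(1)] .
next
  case (add q r)
  then show ?case using trig_polynomial.add by (simp add: distrib_left)
qed

text \<open>For \<open>\<rho> > 0\<close> this wraps each coordinate around a circle. The image is
  compact, so continuous functions on it have uniform polynomial approximations, and polynomials
  pull back to trigonometric polynomials.\<close>

definition torus_map :: "real \<Rightarrow> real ^ 'k \<Rightarrow> (real ^ 'k) \<times> (real ^ 'k)" where
  "torus_map \<rho> x = (\<chi> i. cos (\<rho> * x $ i), \<chi> i. sin (\<rho> * x $ i))"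

lemma trig_polynomial_torus:
  fixes p :: "(real ^ 'k) \<times> (real ^ 'k) \<Rightarrow> real"
  assumes "real_polynomial_function p"
  shows "trig_polynomial (\<lambda>x. p (torus_map \<rho> x))"
  using assms
proof induction
  case (linear f)
  interpret bounded_linear f by fact
  have c: "trig_polynomial (\<lambda>x. d * cos (\<rho> * x $ i))" for d and i :: 'k
    using trig_polynomial.cos[of d "\<rho> *\<^sub>R axis i (1 :: real)" 0] by (simp add: inner_axis' inner_real_def)
  have s: "trig_polynomial (\<lambda>x. d * sin (\<rho> * x $ i))" for d and i :: 'k
    \<comment> \<open>A sine is a cosine with its phase shifted by a quarter period.\<close>
    using trig_polynomial.cos[of d "\<rho> *\<^sub>R axis i (1 :: real)" "- pi / 2"]
    by (simp add: inner_axis' inner_real_def cos_diff)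
  have "f (torus_map \<rho> x) = (\<Sum>i\<in>UNIV. f (axis i 1, 0) * cos (\<rho> * x $ i)) +
      (\<Sum>i\<in>UNIV. f (0, axis i 1) * sin (\<rho> * x $ i))" for x
  proof -
    have 1: "(\<chi> i. h i) = (\<Sum>i\<in>UNIV. h i *\<^sub>R axis i (1 :: real))" for h :: "'k \<Rightarrow> real"
      by (simp add: vec_eq_iff axis_def if_distrib cong: if_cong)
    have "torus_map \<rho> x = (\<Sum>i\<in>UNIV. cos (\<rho> * x $ i) *\<^sub>R (axis i 1, 0)) +
      (\<Sum>i\<in>UNIV. sin (\<rho> * x $ i) *\<^sub>R (0, axis i 1))"
      unfolding torus_map_def 1 by (simp add: prod_eq_iff fst_sum snd_sum)
    then show ?thesis by (simp only: add sum scaleR) (simp add: mult.commute)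
  qed
  then show ?case
    by (simp only:) (intro trig_polynomial.add trig_polynomial_sum c s finite)
qed (auto intro: trig_polynomial_const trig_polynomial.add trig_polynomial_mult)

lemma trig_polynomial_integral_tendsto:
  fixes \<mu> :: "nat \<Rightarrow> 'a::euclidean_space measure"
  assumes prob: "\<And>n. prob_space (\<mu> n)" "\<And>n. sets (\<mu> n) = sets borel" "prob_space \<nu>" "sets \<nu> = sets borel"
    and cos: "\<And>t a. (\<lambda>n. \<integral>x. cos (t \<bullet> x + a) \<partial>\<mu> n) \<longlonglongrightarrow> (\<integral>x. cos (t \<bullet> x + a) \<partial>\<nu>)"
    and p: "trig_polynomial p"
  shows "(\<forall>n. integrable (\<mu> n) p) \<and> integrable \<nu> p \<and> (\<lambda>n. \<integral>x. p x \<partial>\<mu> n) \<longlonglongrightarrow> (\<integral>x. p x \<partial>\<nu>)"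
  using p
proof induction
  case (cos c t a)
  have int: "integrable \<mu>' (\<lambda>x. c * cos (t \<bullet> x + a))"
    if "prob_space \<mu>'" "sets \<mu>' = sets borel" for \<mu>' :: "'a measure"
  proof -
    interpret prob_space \<mu>' by fact
    show ?thesis
    proof (intro integrable_mult_right integrable_const_bound[of _ 1])
      show "(\<lambda>x. cos (t \<bullet> x + a)) \<in> borel_measurable \<mu>'"
        unfolding measurable_cong_sets[OF that(2) refl] by measurable
    qed auto
  qed
  show ?case using int prob assms(5)[of t a] by (auto intro!: tendsto_mult_left)
next
  case (add p q)
  then show ?case by (auto intro!: tendsto_add)
qed

text \<open>Inside a large ball a bounded continuous function factors through the torus and is
  uniformly close to a trigonometric polynomial. Outside, the difference is still bounded, and
  tightness makes the mass there small; the single limit measure is tight automatically.\<close>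

lemma converges_weakly_cos:
  fixes \<mu> :: "nat \<Rightarrow> (real ^ 'k) measure"
  assumes prob: "\<And>n. prob_space (\<mu> n)" "\<And>n. sets (\<mu> n) = sets borel" "prob_space \<nu>" "sets \<nu> = sets borel"
    and cos: "\<And>t a. (\<lambda>n. \<integral>x. cos (t \<bullet> x + a) \<partial>\<mu> n) \<longlonglongrightarrow> (\<integral>x. cos (t \<bullet> x + a) \<partial>\<nu>)"
    and tight: "\<And>\<epsilon>. 0 < \<epsilon> \<Longrightarrow> \<exists>L. \<forall>\<^sub>F n in sequentially. measure (\<mu> n) {x. L < norm x} \<le> \<epsilon>"
  shows "converges_weakly \<mu> \<nu>"
  unfolding converges_weakly_def
proof (intro allI impI)
  fix g :: "real ^ 'k \<Rightarrow> real" assume g: "continuous_on UNIV g" "bounded (range g)"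
  then obtain K where K: "0 < K" "\<And>x. \<bar>g x\<bar> \<le> K"
    unfolding bounded_pos by auto
  have gm[measurable]: "g \<in> borel_measurable borel" using g by (intro borel_measurable_continuous_onI)
  interpret \<nu>: prob_space \<nu> by fact
  show "(\<lambda>n. \<integral>x. g x \<partial>\<mu> n) \<longlonglongrightarrow> (\<integral>x. g x \<partial>\<nu>)"
  proof (rule tendstoI)
    fix e :: real assume e: "0 < e"
    \<comment> \<open>The total error will be below
      \<open>3 * \<epsilon> + 4 * K * \<epsilon>\<close>: one \<open>\<epsilon>\<close> for the
      integrals of the polynomial, and \<open>\<epsilon> + 2 * K * \<epsilon>\<close> for replacing
      \<open>g\<close> by it under each of the two measures.\<close>
    define \<epsilon> where "\<epsilon> = e / (8 * K + 8)"
    have \<epsilon>: "0 < \<epsilon>" "(8 * K + 8) * \<epsilon> = e" using e K by (auto simp: \<epsilon>_def)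
    obtain L1 where L1: "\<forall>\<^sub>F n in sequentially. measure (\<mu> n) {x. L1 < norm x} \<le> \<epsilon>"
      using tight[OF \<epsilon>(1)] by blast
    have lim: "(\<lambda>n. measure \<nu> {x. real n < norm x}) \<longlonglongrightarrow> measure \<nu> (\<Inter>n. {x. real n < norm x})"
    proof (rule \<nu>.finite_Lim_measure_decseq)
      show "range (\<lambda>n. {x. real n < norm x}) \<subseteq> sets \<nu>" by (auto simp: prob)
    qed (auto simp: decseq_def intro: order.strict_trans1)
    have empty: "(\<Inter>n. {x :: real ^ 'k. real n < norm x}) = {}"
    proof -
      have "\<exists>n. norm x \<le> real n" for x :: "real ^ 'k" by (rule real_arch_simple)
      then show ?thesis by (auto simp: set_eq_iff not_less)
    qed
    have "(\<lambda>n. measure \<nu> {x. real n < norm x}) \<longlonglongrightarrow> 0" using lim unfolding empty by simp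
    then have "\<forall>\<^sub>F n in sequentially. measure \<nu> {x. real n < norm x} < \<epsilon>"
      by (rule order_tendstoD) (rule \<epsilon>(1))
    then obtain m where m: "measure \<nu> {x. real m < norm x} < \<epsilon>"
      unfolding eventually_sequentially by blast
    define L where "L = max 1 (max L1 (real m))"
    \<comment> \<open>For \<open>norm x \<le> L\<close> every angle \<open>\<rho> * x $ i\<close>
      has absolute value at most \<open>pi / 3\<close>; there \<open>arcsin\<close> inverts
      \<open>sin\<close> and the cosine is at least \<open>1 / 2\<close>.\<close>
    define \<rho> where "\<rho> = pi / (3 * L)"
    have L: "1 \<le> L" and \<rho>: "0 < \<rho>" by (auto simp: L_def \<rho>_def)
    have small: "\<bar>\<rho> * x $ i\<bar> \<le> pi / 3" if "norm x \<le> L" for x :: "real ^ 'k" and i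
    proof -
      have "\<bar>\<rho> * x $ i\<bar> \<le> \<rho> * L"
        using \<rho> component_le_norm_cart[of x i] that by (auto simp: abs_mult)
      then show ?thesis using L by (simp add: \<rho>_def)
    qed
    \<comment> \<open>The sine coordinates recover \<open>x\<close> on the ball of radius
      \<open>L\<close>; the product of clipped cosines is a cut-off with values in
      \<open>[0, 1]\<close> that equals 1 over this ball.\<close>
    define G where "G z = g (\<chi> i. arcsin (snd z $ i) / \<rho>) * (\<Prod>i\<in>UNIV. max 0 (min 1 (2 * fst z $ i)))"
      for z :: "(real ^ 'k) \<times> (real ^ 'k)"
    define T where "T = cbox (- 1, - 1) (1 :: real ^ 'k, 1 :: real ^ 'k)"
    have in_T: "torus_map \<rho> x \<in> T" for x
      by (auto simp: T_def torus_map_def mem_box_cart cbox_Pair_eq)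
    have contG: "continuous_on T G"
      unfolding G_def
    proof (intro continuous_intros continuous_on_compose2[OF g(1)])
      show "\<forall>z\<in>T. - 1 \<le> snd z $ i \<and> snd z $ i \<le> 1" for i
        by (auto simp: T_def mem_box_cart cbox_Pair_eq)
    qed (use \<rho> in auto)
    obtain P where P: "real_polynomial_function P" "\<And>z. z \<in> T \<Longrightarrow> \<bar>G z - P z\<bar> < \<epsilon>"
      using Stone_Weierstrass_real_polynomial_function[OF _ contG \<epsilon>(1)] compact_cbox unfolding T_def by blast
    define p where "p x = P (torus_map \<rho> x)" for x
    have tp: "trig_polynomial p" unfolding p_def by (rule trig_polynomial_torus[OF P(1)])
    note pI = trig_polynomial_integral_tendsto[OF prob cos tp]
    have Gp: "\<bar>G (torus_map \<rho> x) - p x\<bar> \<le> \<epsilon>" for x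
      using P(2)[OF in_T[of x]] by (simp add: p_def)
    have G_bd: "\<bar>G z\<bar> \<le> K" for z
    proof -
      have "\<bar>\<Prod>i\<in>UNIV. max 0 (min 1 (2 * fst z $ i))\<bar> \<le> 1"
        unfolding abs_prod by (rule prod_le_1) auto
      then have "\<bar>G z\<bar> \<le> K * 1"
        unfolding G_def abs_mult using K by (intro mult_mono) auto
      then show ?thesis by simp
    qed
    have G_eq: "G (torus_map \<rho> x) = g x" if "norm x \<le> L" for x
    proof -
      have "arcsin (sin (\<rho> * x $ i)) / \<rho> = x $ i" for i
        using small[OF that, of i] \<rho> by (subst arcsin_sin) (auto simp: abs_le_iff)
      moreover have "max 0 (min 1 (2 * cos (\<rho> * x $ i))) = 1" for i
      proof -
        have "cos (pi / 3) \<le> cos \<bar>\<rho> * x $ i\<bar>"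
          using small[OF that, of i] by (intro cos_monotone_0_pi_le) auto
        then show ?thesis by (simp add: cos_60)
      qed
      ultimately show ?thesis by (simp add: G_def torus_map_def)
    qed
    have pg: "\<bar>g x - p x\<bar> \<le> \<epsilon> + 2 * K * indicator {x. L < norm x} x" for x
    proof (cases "norm x \<le> L")
      case True then show ?thesis using Gp[of x] G_eq[OF True] by simp
    next
      case False
      then show ?thesis using Gp[of x] G_bd[of "torus_map \<rho> x"] K(2)[of x] by simp
    qed
    have close: "\<bar>(\<integral>x. g x \<partial>\<mu>') - (\<integral>x. p x \<partial>\<mu>')\<bar> \<le> \<epsilon> + 2 * K * measure \<mu>' {x. L < norm x}"
      if "prob_space \<mu>'" and s: "sets \<mu>' = sets borel" and p: "integrable \<mu>' p" for \<mu>' :: "(real ^ 'k) measure"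
    proof -
      interpret prob_space \<mu>' by fact
      have gi: "integrable \<mu>' g"
      proof (rule integrable_const_bound[of _ K])
        show "g \<in> borel_measurable \<mu>'" unfolding measurable_cong_sets[OF s refl] by measurable
      qed (use K in auto)
      have A: "{x. L < norm x} \<in> sets \<mu>'" unfolding s by measurable
      have "\<bar>(\<integral>x. g x \<partial>\<mu>') - (\<integral>x. p x \<partial>\<mu>')\<bar> = \<bar>\<integral>x. g x - p x \<partial>\<mu>'\<bar>"
        using gi p by simp
      also have "\<dots> \<le> (\<integral>x. \<bar>g x - p x\<bar> \<partial>\<mu>')" by (rule integral_abs_bound)
      also have "\<dots> \<le> (\<integral>x. \<epsilon> + 2 * K * indicator {x. L < norm x} x \<partial>\<mu>')"
        using gi p A by (intro integral_mono pg) (auto intro!: integrable_real_indicator simp: emeasure_eq_measure)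
      also have "\<dots> = \<epsilon> + 2 * K * measure \<mu>' {x. L < norm x}"
        using A by (simp add: prob_space emeasure_eq_measure)
      finally show ?thesis .
    qed
    have \<nu>_small: "measure \<nu> {x. L < norm x} \<le> \<epsilon>"
    proof -
      have "measure \<nu> {x. L < norm x} \<le> measure \<nu> {x. real m < norm x}"
        by (rule \<nu>.finite_measure_mono) (auto simp: L_def prob)
      then show ?thesis using m by simp
    qed
    have "\<forall>\<^sub>F n in sequentially. \<bar>(\<integral>x. p x \<partial>\<mu> n) - (\<integral>x. p x \<partial>\<nu>)\<bar> < \<epsilon>"
      using tendstoD[OF conjunct2[OF conjunct2[OF pI]] \<epsilon>(1)] by (simp add: dist_real_def)
    with L1 show "\<forall>\<^sub>F n in sequentially. dist (\<integral>x. g x \<partial>\<mu> n) (\<integral>x. g x \<partial>\<nu>) < e"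
    proof eventually_elim
      case (elim n)
      have "measure (\<mu> n) {x. L < norm x} \<le> measure (\<mu> n) {x. L1 < norm x}"
        by (rule finite_measure.finite_measure_mono[OF prob_space.finite_measure[OF prob(1)]]) (auto simp: L_def prob)
      with elim have \<mu>_small: "measure (\<mu> n) {x. L < norm x} \<le> \<epsilon>" by simp
      have 1: "2 * K * measure (\<mu> n) {x. L < norm x} \<le> 2 * K * \<epsilon>" "2 * K * measure \<nu> {x. L < norm x} \<le> 2 * K * \<epsilon>"
        using \<mu>_small \<nu>_small K by (auto intro: mult_left_mono)
      have "\<bar>(\<integral>x. g x \<partial>\<mu> n) - (\<integral>x. g x \<partial>\<nu>)\<bar> < 3 * \<epsilon> + 4 * K * \<epsilon>"
        using close[OF prob(1,2) conjunct1[OF pI, rule_format], of n] close[OF prob(3,4)] pI 1 elim(2)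
        by linarith
      also have "\<dots> \<le> e"
      proof -
        have "8 * (K * \<epsilon>) + 8 * \<epsilon> = e" using \<epsilon>(2) by (simp add: algebra_simps)
        moreover have "0 \<le> K * \<epsilon>" using K \<epsilon> by simp
        ultimately show ?thesis using \<epsilon>(1) by linarith
      qed
      finally show ?case by (simp add: dist_real_def)
    qed
  qed
qed

section \<open>Events of high probability and samples of independent variables\<close>

context prob_space
begin

text \<open>Membership in \<open>hp \<epsilon>\<close> asks for a measurable subset of the event only, so the event itself need
  not be measurable.\<close>

definition hp :: "real \<Rightarrow> (nat \<Rightarrow> 'a \<Rightarrow> bool) \<Rightarrow> bool" where
  "hp \<epsilon> E \<longleftrightarrow> (\<forall>\<^sub>F n in sequentially. \<exists>A\<in>events. 1 - \<epsilon> \<le> prob A \<and> (\<forall>\<omega>\<in>A. E n \<omega>))"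

definition whp :: "(nat \<Rightarrow> 'a \<Rightarrow> bool) \<Rightarrow> bool" where
  "whp E \<longleftrightarrow> (\<forall>\<epsilon>>0. hp \<epsilon> E)"

lemma hp_mono:
  assumes "hp \<epsilon> E" "\<forall>\<^sub>F n in sequentially. \<forall>\<omega>\<in>space M. E n \<omega> \<longrightarrow> F n \<omega>"
  shows "hp \<epsilon> F"
  using assms unfolding hp_def
proof eventually_elim
  case (elim n)
  then show ?case using sets.sets_into_space by blast
qed

lemma hp_conj:
  assumes "hp \<epsilon> E" "hp \<delta> F"
  shows "hp (\<epsilon> + \<delta>) (\<lambda>n \<omega>. E n \<omega> \<and> F n \<omega>)"
  using assms unfolding hp_def
proof eventually_elim
  case (elim n)
  then obtain A B where AB: "A \<in> events" "1 - \<epsilon> \<le> prob A" "\<forall>\<omega>\<in>A. E n \<omega>"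
    "B \<in> events" "1 - \<delta> \<le> prob B" "\<forall>\<omega>\<in>B. F n \<omega>" by blast
  have "prob (space M - (A \<inter> B)) = prob ((space M - A) \<union> (space M - B))"
    by (rule arg_cong[of _ _ prob]) auto
  also have "\<dots> \<le> prob (space M - A) + prob (space M - B)"
    using AB by (intro measure_Un_le) auto
  finally have "1 - (\<epsilon> + \<delta>) \<le> prob (A \<inter> B)"
    using AB by (simp add: prob_compl)
  then show ?case using AB by (intro bexI[of _ "A \<inter> B"]) auto
qed

lemma whp_mono:
  assumes "whp E" "\<forall>\<^sub>F n in sequentially. \<forall>\<omega>\<in>space M. E n \<omega> \<longrightarrow> F n \<omega>"
  shows "whp F"
  using assms hp_mono unfolding whp_def by blast

lemma whp_conj: "whp E \<Longrightarrow> whp F \<Longrightarrow> whp (\<lambda>n \<omega>. E n \<omega> \<and> F n \<omega>)"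
  unfolding whp_def
proof (intro allI impI)
  fix \<epsilon> :: real assume "\<forall>\<epsilon>>0. hp \<epsilon> E" "\<forall>\<epsilon>>0. hp \<epsilon> F" "0 < \<epsilon>"
  then have "hp (\<epsilon> / 2) E" "hp (\<epsilon> / 2) F" by simp_all
  from hp_conj[OF this] show "hp \<epsilon> (\<lambda>n \<omega>. E n \<omega> \<and> F n \<omega>)" by simp
qed

lemma whp_True: "whp (\<lambda>n \<omega>. True)"
  unfolding whp_def hp_def by (auto intro!: always_eventually bexI[of _ "space M"] simp: prob_space)

lemma whp_ball:
  "finite I \<Longrightarrow> (\<And>i. i \<in> I \<Longrightarrow> whp (E i)) \<Longrightarrow> whp (\<lambda>n \<omega>. \<forall>i\<in>I. E i n \<omega>)"
proof (induction I rule: finite_induct)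
  case empty then show ?case by (simp add: whp_True)
next
  case (insert i I)
  then have "whp (\<lambda>n \<omega>. E i n \<omega> \<and> (\<forall>i\<in>I. E i n \<omega>))" by (intro whp_conj) auto
  then show ?case by simp
qed

text \<open>The events that \<open>E\<close> holds from \<open>N\<close> on increase to an event of
  full probability, so continuity from below applies.\<close>

lemma whp_AE_eventually:
  assumes "AE \<omega> in M. \<forall>\<^sub>F n in sequentially. E n \<omega>"
    and [measurable]: "\<And>n. {\<omega> \<in> space M. E n \<omega>} \<in> events"
  shows "whp E"
  unfolding whp_def hp_def
proof (intro allI impI)
  fix \<epsilon> :: real assume \<epsilon>: "0 < \<epsilon>"
  define A where "A N = {\<omega> \<in> space M. \<forall>n\<ge>N. E n \<omega>}" for N
  have Am[measurable]: "A N \<in> events" for N unfolding A_def by measurable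
  have "(\<lambda>N. prob (A N)) \<longlonglongrightarrow> prob (\<Union>N. A N)"
    by (rule finite_Lim_measure_incseq) (auto simp: incseq_def A_def)
  also have "prob (\<Union>N. A N) = 1"
  proof (subst prob_eq_1)
    show "AE x in M. x \<in> (\<Union>N. A N)"
      using assms(1) AE_space by eventually_elim (auto simp: A_def eventually_sequentially)
  qed measurable
  finally have "\<forall>\<^sub>F N in sequentially. 1 - \<epsilon> < prob (A N)"
    by (rule order_tendstoD) (use \<epsilon> in simp)
  then show "\<forall>\<^sub>F n in sequentially. \<exists>A\<in>events. 1 - \<epsilon> \<le> prob A \<and> (\<forall>\<omega>\<in>A. E n \<omega>)"
  proof eventually_elim
    case (elim N)
    then show ?case by (intro bexI[of _ "A N"]) (auto simp: A_def)
  qed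
qed

lemma hp_markov:
  assumes [measurable]: "\<And>n. S n \<in> borel_measurable M"
    and "\<forall>\<^sub>F n in sequentially. integrable M (\<lambda>\<omega>. \<bar>S n \<omega>\<bar>) \<and> (\<integral>\<omega>. \<bar>S n \<omega>\<bar> \<partial>M) \<le> \<epsilon> * c"
    and c: "0 < c"
  shows "hp \<epsilon> (\<lambda>n \<omega>. \<bar>S n \<omega>\<bar> < c)"
  unfolding hp_def using assms(2)
proof eventually_elim
  case (elim n)
  have "prob {\<omega>\<in>space M. c \<le> \<bar>S n \<omega>\<bar>} \<le> (\<integral>\<omega>. \<bar>S n \<omega>\<bar> \<partial>M) / c"
    using elim c by (intro integral_Markov_inequality_measure[of _ _ "{}"]) auto
  also have "\<dots> \<le> \<epsilon>" using elim c by (simp add: field_simps)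
  finally have "1 - \<epsilon> \<le> prob {\<omega>\<in>space M. \<not> c \<le> \<bar>S n \<omega>\<bar>}"
    by (subst prob_neg) auto
  then show ?case
    by (intro bexI[of _ "{\<omega>\<in>space M. \<not> c \<le> \<bar>S n \<omega>\<bar>}"]) auto
qed

text \<open>Samples are numbered from 1, whereas the central limit theorem is applied to a sequence
  indexed by all natural numbers.\<close>

lemma indep_sets_Suc:
  assumes "indep_sets F {1..}"
  shows "indep_sets (\<lambda>i. F (Suc i)) UNIV"
proof (rule indep_setsI)
  show "F (Suc i) \<subseteq> events" for i using assms by (auto simp: indep_sets_def)
  fix A J assume J: "J \<noteq> {}" "J \<subseteq> UNIV" "finite J" and A: "\<forall>j\<in>J. A j \<in> F (Suc j)"
  have "prob (\<Inter>j\<in>Suc ` J. A (j - 1)) = (\<Prod>j\<in>Suc ` J. prob (A (j - 1)))"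
    using J A by (intro indep_setsD[OF assms]) auto
  then show "prob (\<Inter>j\<in>J. A j) = (\<Prod>j\<in>J. prob (A j))"
    by (simp add: prod.reindex)
qed

lemma indep_vars_Suc:
  assumes "indep_vars N X {1..}"
  shows "indep_vars (\<lambda>i. N (Suc i)) (\<lambda>i. X (Suc i)) UNIV"
  using assms indep_sets_Suc[of "\<lambda>i. {X i -` A \<inter> space M | A. A \<in> sets (N i)}"]
  unfolding indep_vars_def2 by auto

end

section \<open>Averages over an i.i.d. sample: weak law and central limit theorem\<close>

locale iid_sample = prob_space M for M :: "'w measure" +
  fixes Z :: "nat \<Rightarrow> 'w \<Rightarrow> 'a :: topological_space" and D :: "'a measure"
  assumes indep: "indep_vars (\<lambda>_. borel) Z {1..}"
    and distr_Z: "\<And>i. 1 \<le> i \<Longrightarrow> distr M borel (Z i) = D"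
begin

definition avg :: "('a \<Rightarrow> real) \<Rightarrow> nat \<Rightarrow> 'w \<Rightarrow> real" where
  "avg \<phi> n \<omega> = (\<Sum>i=1..n. \<phi> (Z i \<omega>)) / n"

lemma Z_measurable: "1 \<le> i \<Longrightarrow> Z i \<in> borel_measurable M"
  using indep by (auto simp: indep_vars_def2)

lemma sets_D: "sets D = sets borel"
  using distr_Z[of 1] by (metis order_refl sets_distr)

lemma prob_space_D: "prob_space D"
  using prob_space_distr[OF Z_measurable, of 1] distr_Z[of 1] by simp

lemma integrable_Z:
  fixes \<phi> :: "'a \<Rightarrow> 'b :: {banach, second_countable_topology}"
  assumes "1 \<le> i" "\<phi> \<in> borel_measurable borel"
  shows "integrable M (\<lambda>\<omega>. \<phi> (Z i \<omega>)) \<longleftrightarrow> integrable D \<phi>"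
  using assms unfolding distr_Z[OF assms(1), symmetric]
  by (subst integrable_distr_eq) (auto simp: Z_measurable)

lemma integral_Z:
  fixes \<phi> :: "'a \<Rightarrow> 'b :: {banach, second_countable_topology}"
  assumes "1 \<le> i" "\<phi> \<in> borel_measurable borel"
  shows "(\<integral>\<omega>. \<phi> (Z i \<omega>) \<partial>M) = (\<integral>z. \<phi> z \<partial>D)"
  using assms unfolding distr_Z[OF assms(1), symmetric]
  by (subst integral_distr) (auto simp: Z_measurable)

lemma phi_Z_measurable:
  "\<phi> \<in> borel_measurable borel \<Longrightarrow> 1 \<le> i \<Longrightarrow> (\<lambda>\<omega>. \<phi> (Z i \<omega>)) \<in> borel_measurable M"
  by (rule measurable_compose[OF Z_measurable])

lemma avg_measurable: "\<phi> \<in> borel_measurable borel \<Longrightarrow> avg \<phi> n \<in> borel_measurable M"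
  unfolding avg_def[abs_def]
  by (intro borel_measurable_divide borel_measurable_sum phi_Z_measurable borel_measurable_const) auto

lemma integral_abs_avg_le:
  assumes m: "\<phi> \<in> borel_measurable borel" and i: "integrable D \<phi>"
  shows "integrable M (\<lambda>\<omega>. \<bar>avg \<phi> n \<omega>\<bar>)" "(\<integral>\<omega>. \<bar>avg \<phi> n \<omega>\<bar> \<partial>M) \<le> (\<integral>z. \<bar>\<phi> z\<bar> \<partial>D)"
proof -
  have int: "integrable M (\<lambda>\<omega>. \<phi> (Z i \<omega>))" if "1 \<le> i" for i
    using integrable_Z[OF that m] i by simp
  show *: "integrable M (\<lambda>\<omega>. \<bar>avg \<phi> n \<omega>\<bar>)"
    unfolding avg_def using int by (intro integrable_abs integrable_divide Bochner_Integration.integrable_sum) auto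
  have "(\<integral>\<omega>. \<bar>avg \<phi> n \<omega>\<bar> \<partial>M) \<le> (\<integral>\<omega>. (\<Sum>i=1..n. \<bar>\<phi> (Z i \<omega>)\<bar>) / n \<partial>M)"
    using int by (intro integral_mono * integrable_abs integrable_divide Bochner_Integration.integrable_sum)
      (auto simp: avg_def abs_divide intro!: divide_right_mono sum_abs)
  also have "\<dots> = (\<Sum>i=1..n. \<integral>\<omega>. \<bar>\<phi> (Z i \<omega>)\<bar> \<partial>M) / n"
    using int by simp
  also have "(\<Sum>i=1..n. \<integral>\<omega>. \<bar>\<phi> (Z i \<omega>)\<bar> \<partial>M) = (\<Sum>i=1..n. \<integral>z. \<bar>\<phi> z\<bar> \<partial>D)"
    using m by (intro sum.cong refl integral_Z) auto
  also have "(\<Sum>i=1..n. \<integral>z. \<bar>\<phi> z\<bar> \<partial>D) / n \<le> (\<integral>z. \<bar>\<phi> z\<bar> \<partial>D)"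
    by (cases "n = 0") auto
  finally show "(\<integral>\<omega>. \<bar>avg \<phi> n \<omega>\<bar> \<partial>M) \<le> (\<integral>z. \<bar>\<phi> z\<bar> \<partial>D)" .
qed

text \<open>After expanding the square, the cross terms vanish because independent factors of mean
  zero have a product of mean zero; the \<open>n\<close> diagonal terms remain.\<close>

lemma second_moment_sum:
  assumes m[measurable]: "\<phi> \<in> borel_measurable borel" and sq: "integrable D (\<lambda>z. (\<phi> z)\<^sup>2)"
    and mean: "(\<integral>z. \<phi> z \<partial>D) = 0"
  shows "integrable M (\<lambda>\<omega>. (\<Sum>i=1..n. \<phi> (Z i \<omega>))\<^sup>2)"
    and "(\<integral>\<omega>. (\<Sum>i=1..n. \<phi> (Z i \<omega>))\<^sup>2 \<partial>M) = n * (\<integral>z. (\<phi> z)\<^sup>2 \<partial>D)"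
proof -
  interpret D: prob_space D by (rule prob_space_D)
  have mD: "\<phi> \<in> borel_measurable D" unfolding measurable_cong_sets[OF sets_D refl] by (rule m)
  have iD: "integrable D \<phi>"
    by (rule D.square_integrable_imp_integrable[OF mD]) (use sq in simp)
  have prod: "integrable M (\<lambda>\<omega>. \<phi> (Z i \<omega>) * \<phi> (Z j \<omega>)) \<and>
      (\<integral>\<omega>. \<phi> (Z i \<omega>) * \<phi> (Z j \<omega>) \<partial>M) = (if i = j then \<integral>z. (\<phi> z)\<^sup>2 \<partial>D else 0)"
    if ij: "1 \<le> i" "1 \<le> j" for i j
  proof (cases "i = j")
    case True
    then show ?thesis
      using integrable_Z[OF ij(1), of "\<lambda>z. (\<phi> z)\<^sup>2"] integral_Z[OF ij(1), of "\<lambda>z. (\<phi> z)\<^sup>2"] sq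
      by (simp add: power2_eq_square)
  next
    case False
    have ind: "indep_vars (\<lambda>_. borel) (\<lambda>i \<omega>. \<phi> (Z i \<omega>)) {i, j}"
      using ij by (intro indep_vars_subset[OF indep_vars_compose2[OF indep]]) auto
    have int: "integrable M (\<lambda>\<omega>. \<phi> (Z k \<omega>))" if "k \<in> {i, j}" for k
      using integrable_Z[OF _ m, of k] iD that ij by auto
    from indep_vars_lebesgue_integral[OF _ ind int] indep_vars_integrable[OF _ ind int] False
    show ?thesis using integral_Z[OF ij(1) m] mean by simp
  qed
  have eq: "(\<Sum>i=1..n. \<phi> (Z i \<omega>))\<^sup>2 = (\<Sum>i=1..n. \<Sum>j=1..n. \<phi> (Z i \<omega>) * \<phi> (Z j \<omega>))" for \<omega>
    by (simp add: power2_eq_square sum_product)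
  show "integrable M (\<lambda>\<omega>. (\<Sum>i=1..n. \<phi> (Z i \<omega>))\<^sup>2)"
    unfolding eq using prod by (intro Bochner_Integration.integrable_sum) auto
  have "(\<integral>\<omega>. (\<Sum>i=1..n. \<phi> (Z i \<omega>))\<^sup>2 \<partial>M) =
      (\<Sum>i=1..n. \<Sum>j=1..n. if i = j then \<integral>z. (\<phi> z)\<^sup>2 \<partial>D else 0)"
  proof -
    have "(\<integral>\<omega>. (\<Sum>i=1..n. \<phi> (Z i \<omega>))\<^sup>2 \<partial>M) = (\<Sum>i=1..n. \<integral>\<omega>. (\<Sum>j=1..n. \<phi> (Z i \<omega>) * \<phi> (Z j \<omega>)) \<partial>M)"
      unfolding eq
      by (intro Bochner_Integration.integral_sum Bochner_Integration.integrable_sum) (use prod in auto)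
    also have "\<dots> = (\<Sum>i=1..n. \<Sum>j=1..n. \<integral>\<omega>. \<phi> (Z i \<omega>) * \<phi> (Z j \<omega>) \<partial>M)"
      by (intro sum.cong refl Bochner_Integration.integral_sum) (use prod in auto)
    also have "\<dots> = (\<Sum>i=1..n. \<Sum>j=1..n. if i = j then \<integral>z. (\<phi> z)\<^sup>2 \<partial>D else 0)"
      by (intro sum.cong refl) (use prod in auto)
    finally show ?thesis .
  qed
  also have "\<dots> = n * (\<integral>z. (\<phi> z)\<^sup>2 \<partial>D)" by simp
  finally show "(\<integral>\<omega>. (\<Sum>i=1..n. \<phi> (Z i \<omega>))\<^sup>2 \<partial>M) = n * (\<integral>z. (\<phi> z)\<^sup>2 \<partial>D)" .
qed

text \<open>Chebyshev's inequality: for \<open>n > 0\<close> the second moment of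
  \<open>sqrt n * avg \<phi> n\<close> does not depend on \<open>n\<close>.\<close>

lemma hp_sum_bounded:
  assumes m[measurable]: "\<phi> \<in> borel_measurable borel" and sq: "integrable D (\<lambda>z. (\<phi> z)\<^sup>2)"
    and mean: "(\<integral>z. \<phi> z \<partial>D) = 0" and \<epsilon>: "0 < \<epsilon>"
  shows "\<exists>K>0. hp \<epsilon> (\<lambda>n \<omega>. \<bar>sqrt n * avg \<phi> n \<omega>\<bar> < K)"
proof -
  define V where "V = (\<integral>z. (\<phi> z)\<^sup>2 \<partial>D)"
  have V: "0 \<le> V" unfolding V_def by (intro integral_nonneg_AE) auto
  \<comment> \<open>Gives \<open>V \<le> \<epsilon> * K\<^sup>2\<close>, as Markov's inequality for
    the square requires; the summand 1 keeps \<open>K\<close> positive when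
    \<open>V = 0\<close>.\<close>
  define K where "K = sqrt (V / \<epsilon> + 1)"
  have K: "0 < K" "K\<^sup>2 = V / \<epsilon> + 1" using V \<epsilon> unfolding K_def by (auto simp: add_nonneg_pos)
  have eq: "(sqrt n * avg \<phi> n \<omega>)\<^sup>2 = (\<Sum>i=1..n. \<phi> (Z i \<omega>))\<^sup>2 / n" if "0 < n" for n \<omega>
    using that by (simp add: avg_def power_mult_distrib power_divide) (simp add: power2_eq_square)
  have "hp \<epsilon> (\<lambda>n \<omega>. \<bar>(sqrt n * avg \<phi> n \<omega>)\<^sup>2\<bar> < K\<^sup>2)"
  proof (rule hp_markov)
    show "(\<lambda>\<omega>. (sqrt n * avg \<phi> n \<omega>)\<^sup>2) \<in> borel_measurable M" for n
      using avg_measurable[OF m] by simp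
    show "\<forall>\<^sub>F n in sequentially. integrable M (\<lambda>\<omega>. \<bar>(sqrt n * avg \<phi> n \<omega>)\<^sup>2\<bar>) \<and>
        (\<integral>\<omega>. \<bar>(sqrt n * avg \<phi> n \<omega>)\<^sup>2\<bar> \<partial>M) \<le> \<epsilon> * K\<^sup>2"
      using eventually_gt_at_top[of 0]
    proof eventually_elim
      case (elim n)
      show ?case
        using second_moment_sum[OF m sq mean, of n] elim \<epsilon> V
        unfolding abs_power2 eq[OF elim] K(2) V_def[symmetric]
        by (auto simp: field_simps)
    qed
  qed (rule zero_less_power[OF K(1)])
  then have "hp \<epsilon> (\<lambda>n \<omega>. \<bar>sqrt n * avg \<phi> n \<omega>\<bar> < K)"
  proof (rule hp_mono, intro always_eventually allI ballI impI)
    fix n \<omega> assume "\<bar>(sqrt n * avg \<phi> n \<omega>)\<^sup>2\<bar> < K\<^sup>2"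
    then show "\<bar>sqrt n * avg \<phi> n \<omega>\<bar> < K"
      using K(1) by (metis abs_power2 abs_of_pos power2_less_imp_less power2_abs less_imp_le)
  qed
  with K(1) show ?thesis by blast
qed

lemma avg_diff: "avg (\<lambda>z. \<phi> z - \<psi> z) n \<omega> = avg \<phi> n \<omega> - avg \<psi> n \<omega>"
  by (simp add: avg_def sum_subtractf diff_divide_distrib)

lemma avg_const: "0 < n \<Longrightarrow> avg (\<lambda>z. c) n \<omega> = c"
  by (simp add: avg_def)

text \<open>Only a first moment is assumed, so \<open>\<phi>\<close> is truncated at a level
  \<open>k\<close>. The bounded part has a variance and averages out at rate
  \<open>1 / sqrt n\<close>; the average of the rest is small in mean, uniformly in
  \<open>n\<close>.\<close>

lemma weak_law_large_numbers:
  assumes m[measurable]: "\<phi> \<in> borel_measurable borel" and int: "integrable D \<phi>" and \<eta>: "0 < \<eta>"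
  shows "whp (\<lambda>n \<omega>. \<bar>avg \<phi> n \<omega> - (\<integral>z. \<phi> z \<partial>D)\<bar> < \<eta>)"
  unfolding whp_def
proof (intro allI impI)
  fix \<epsilon> :: real assume \<epsilon>: "0 < \<epsilon>"
  interpret D: prob_space D by (rule prob_space_D)
  have mD: "borel_measurable D = borel_measurable borel" by (rule measurable_cong_sets[OF sets_D refl])
  \<comment> \<open>The first entry is what Markov's inequality requires for the average of the
    remainder, the second bounds the change of the mean caused by truncation.\<close>
  define \<delta> where "\<delta> = min (\<epsilon> * \<eta> / 8) (\<eta> / 4)"
  have \<delta>: "0 < \<delta>" "\<delta> \<le> \<epsilon> / 2 * (\<eta> / 4)" "\<delta> \<le> \<eta> / 4" using \<epsilon> \<eta> by (auto simp: \<delta>_def)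
  define T where "T k z = \<phi> z * indicator {z. \<bar>\<phi> z\<bar> \<le> real k} z" for k z
  have Tm[measurable]: "T k \<in> borel_measurable borel" for k unfolding T_def by measurable
  have TmD: "T k \<in> borel_measurable D" for k unfolding mD by (rule Tm)
  have "(\<lambda>k. \<integral>z. \<bar>\<phi> z - T k z\<bar> \<partial>D) \<longlonglongrightarrow> (\<integral>z. 0 \<partial>D)"
  proof (rule integral_dominated_convergence[where w="\<lambda>z. \<bar>\<phi> z\<bar>"])
    show "(\<lambda>z. \<bar>\<phi> z - T k z\<bar>) \<in> borel_measurable D" for k unfolding mD by measurable
    show "AE z in D. (\<lambda>k. \<bar>\<phi> z - T k z\<bar>) \<longlonglongrightarrow> 0"
    proof (rule AE_I2)
      fix z
      obtain k0 where k0: "\<bar>\<phi> z\<bar> \<le> real k0" using real_arch_simple by blast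
      have "\<forall>\<^sub>F k in sequentially. \<bar>\<phi> z - T k z\<bar> = 0"
        using eventually_ge_at_top[of k0] by eventually_elim (use k0 in \<open>auto simp: T_def\<close>)
      then show "(\<lambda>k. \<bar>\<phi> z - T k z\<bar>) \<longlonglongrightarrow> 0" by (rule tendsto_eventually)
    qed
    show "AE z in D. norm \<bar>\<phi> z - T k z\<bar> \<le> \<bar>\<phi> z\<bar>" for k
      by (auto simp: T_def split: split_indicator)
  qed (use int in auto)
  then have "\<forall>\<^sub>F k in sequentially. (\<integral>z. \<bar>\<phi> z - T k z\<bar> \<partial>D) < \<delta>"
    using \<delta>(1) by (intro order_tendstoD) auto
  then obtain k where k: "(\<integral>z. \<bar>\<phi> z - T k z\<bar> \<partial>D) < \<delta>" unfolding eventually_sequentially by blast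
  have Tbd: "\<bar>T k z\<bar> \<le> real k" for z by (auto simp: T_def split: split_indicator)
  have Tint: "integrable D (T k)" using Tbd by (intro D.integrable_const_bound[of _ "real k"] TmD) auto
  define c where "c = (\<integral>z. T k z \<partial>D)"
  define \<psi> where "\<psi> z = T k z - c" for z
  have \<psi>m: "\<psi> \<in> borel_measurable borel" unfolding \<psi>_def by measurable
  have cbd: "\<bar>c\<bar> \<le> real k"
  proof -
    have "(\<integral>z. \<bar>T k z\<bar> \<partial>D) \<le> real k" using Tint Tbd by (intro D.integral_le_const) auto
    then show ?thesis using integral_abs_bound[of D "T k"] unfolding c_def by linarith
  qed
  have \<psi>sq: "integrable D (\<lambda>z. (\<psi> z)\<^sup>2)"
  proof (rule D.integrable_const_bound[of _ "(2 * real k)\<^sup>2"])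
    show "AE z in D. norm ((\<psi> z)\<^sup>2) \<le> (2 * real k)\<^sup>2"
    proof (rule AE_I2)
      fix z have "\<bar>\<psi> z\<bar> \<le> 2 * real k" using Tbd[of z] cbd unfolding \<psi>_def by linarith
      then show "norm ((\<psi> z)\<^sup>2) \<le> (2 * real k)\<^sup>2" using power_mono[of "\<bar>\<psi> z\<bar>" "2 * real k" 2] by simp
    qed
    show "(\<lambda>z. (\<psi> z)\<^sup>2) \<in> borel_measurable D" unfolding mD using \<psi>m by simp
  qed
  have \<psi>mean: "(\<integral>z. \<psi> z \<partial>D) = 0"
    unfolding \<psi>_def using Tint by (simp add: c_def D.prob_space)
  obtain K where K: "0 < K" "hp (\<epsilon> / 2) (\<lambda>n \<omega>. \<bar>sqrt n * avg \<psi> n \<omega>\<bar> < K)"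
    using hp_sum_bounded[OF \<psi>m \<psi>sq \<psi>mean, of "\<epsilon> / 2"] \<epsilon> by auto
  have small: "hp (\<epsilon> / 2) (\<lambda>n \<omega>. \<bar>avg (\<lambda>z. \<phi> z - T k z) n \<omega>\<bar> < \<eta> / 4)"
  proof (rule hp_markov)
    show "avg (\<lambda>z. \<phi> z - T k z) n \<in> borel_measurable M" for n by (rule avg_measurable) measurable
    have d: "(\<lambda>z. \<phi> z - T k z) \<in> borel_measurable borel" "integrable D (\<lambda>z. \<phi> z - T k z)"
      using int Tint by auto
    show "\<forall>\<^sub>F n in sequentially. integrable M (\<lambda>\<omega>. \<bar>avg (\<lambda>z. \<phi> z - T k z) n \<omega>\<bar>) \<and>
        (\<integral>\<omega>. \<bar>avg (\<lambda>z. \<phi> z - T k z) n \<omega>\<bar> \<partial>M) \<le> \<epsilon> / 2 * (\<eta> / 4)"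
      using integral_abs_avg_le(2)[OF d] k \<delta>(2)
      by (intro always_eventually allI conjI integral_abs_avg_le(1)[OF d]) (meson less_imp_le order_trans)
  qed (use \<eta> in simp)
  have "\<bar>c - (\<integral>z. \<phi> z \<partial>D)\<bar> \<le> \<delta>"
  proof -
    have "c - (\<integral>z. \<phi> z \<partial>D) = - (\<integral>z. \<phi> z - T k z \<partial>D)" using int Tint by (simp add: c_def)
    then show ?thesis using integral_abs_bound[of D "\<lambda>z. \<phi> z - T k z"] k by linarith
  qed
  have "\<forall>\<^sub>F n in sequentially. K < \<eta> / 2 * sqrt n"
    using \<eta> by real_asymp
  have "hp (\<epsilon> / 2 + \<epsilon> / 2) (\<lambda>n \<omega>. \<bar>avg \<phi> n \<omega> - (\<integral>z. \<phi> z \<partial>D)\<bar> < \<eta>)"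
  proof (rule hp_mono[OF hp_conj[OF K(2) small]])
    show "\<forall>\<^sub>F n in sequentially. \<forall>\<omega>\<in>space M. \<bar>sqrt n * avg \<psi> n \<omega>\<bar> < K \<and> \<bar>avg (\<lambda>z. \<phi> z - T k z) n \<omega>\<bar> < \<eta> / 4 \<longrightarrow>
       \<bar>avg \<phi> n \<omega> - (\<integral>z. \<phi> z \<partial>D)\<bar> < \<eta>"
      using \<open>\<forall>\<^sub>F n in sequentially. K < \<eta> / 2 * sqrt n\<close> eventually_gt_at_top[of 0]
    proof eventually_elim
      case (elim n)
      show ?case
      proof (intro ballI impI)
        fix \<omega> assume *: "\<bar>sqrt n * avg \<psi> n \<omega>\<bar> < K \<and> \<bar>avg (\<lambda>z. \<phi> z - T k z) n \<omega>\<bar> < \<eta> / 4"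
        moreover have "\<bar>sqrt n * avg \<psi> n \<omega>\<bar> = sqrt n * \<bar>avg \<psi> n \<omega>\<bar>" by (simp add: abs_mult)
        moreover have "\<eta> / 2 * sqrt n = sqrt n * (\<eta> / 2)" by (rule mult.commute)
        ultimately have "sqrt n * \<bar>avg \<psi> n \<omega>\<bar> < sqrt n * (\<eta> / 2)" using elim(1) by linarith
        then have "\<bar>avg \<psi> n \<omega>\<bar> < \<eta> / 2" by (rule mult_left_less_imp_less) simp
        moreover have "avg \<psi> n \<omega> = avg (T k) n \<omega> - c"
          unfolding \<psi>_def using elim by (simp add: avg_diff avg_const)
        ultimately show "\<bar>avg \<phi> n \<omega> - (\<integral>z. \<phi> z \<partial>D)\<bar> < \<eta>"
          using * \<open>\<bar>c - (\<integral>z. \<phi> z \<partial>D)\<bar> \<le> \<delta>\<close> \<delta>(3) unfolding avg_diff by linarith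
      qed
    qed
  qed
  then show "hp \<epsilon> (\<lambda>n \<omega>. \<bar>avg \<phi> n \<omega> - (\<integral>z. \<phi> z \<partial>D)\<bar> < \<eta>)" by simp
qed

text \<open>The central limit theorem concerns standardised sums; evaluating their characteristic
  functions at the standard deviation \<open>\<sigma>\<close> undoes the standardisation.\<close>

lemma iexp_avg_tendsto:
  assumes m[measurable]: "\<phi> \<in> borel_measurable borel" and sq: "integrable D (\<lambda>z. (\<phi> z)\<^sup>2)"
    and mean: "(\<integral>z. \<phi> z \<partial>D) = 0" and pos: "0 < (\<integral>z. (\<phi> z)\<^sup>2 \<partial>D)"
  shows "(\<lambda>n. \<integral>\<omega>. iexp (sqrt n * avg \<phi> n \<omega>) \<partial>M) \<longlonglongrightarrow> complex_of_real (exp (- (\<integral>z. (\<phi> z)\<^sup>2 \<partial>D) / 2))"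
proof -
  define \<sigma> where "\<sigma> = sqrt (\<integral>z. (\<phi> z)\<^sup>2 \<partial>D)"
  have \<sigma>: "0 < \<sigma>" "\<sigma>\<^sup>2 = (\<integral>z. (\<phi> z)\<^sup>2 \<partial>D)" using pos by (auto simp: \<sigma>_def)
  let ?X = "\<lambda>i \<omega>. \<phi> (Z (Suc i) \<omega>)"
  let ?S = "\<lambda>n \<omega>. (\<Sum>i<n. ?X i \<omega>) / sqrt (n * \<sigma>\<^sup>2)"
  have rv[measurable]: "random_variable borel (?X i)" for i
    by (rule phi_Z_measurable[OF m]) simp
  have "weak_conv_m (\<lambda>n. distr M borel (?S n)) std_normal_distribution"
  proof (rule central_limit_theorem_zero_mean[where \<mu>="distr D borel \<phi>"])
    show "indep_vars (\<lambda>i. borel) ?X UNIV"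
      by (rule indep_vars_compose2[OF indep_vars_Suc[OF indep]]) simp
    show *: "expectation (?X n) = 0" for n using integral_Z[OF _ m, of "Suc n"] mean by simp
    show "integrable M (\<lambda>\<omega>. (?X n \<omega>)\<^sup>2)" for n
      using integrable_Z[of "Suc n" "\<lambda>z. (\<phi> z)\<^sup>2"] sq by simp
    show "variance (?X n) = \<sigma>\<^sup>2" for n
      using integral_Z[of "Suc n" "\<lambda>z. (\<phi> z)\<^sup>2"] by (simp add: * \<sigma>)
    show "distr M borel (?X n) = distr D borel \<phi>" for n
      unfolding distr_Z[of "Suc n", simplified, symmetric]
      by (subst distr_distr) (auto simp: comp_def Z_measurable)
  qed fact
  then have "(\<lambda>n. char (distr M borel (?S n)) \<sigma>) \<longlonglongrightarrow> char std_normal_distribution \<sigma>"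
    by (intro levy_continuity1 real_distribution_distr real_dist_normal_dist) measurable
  moreover have "\<forall>\<^sub>F n in sequentially. char (distr M borel (?S n)) \<sigma> = (\<integral>\<omega>. iexp (sqrt n * avg \<phi> n \<omega>) \<partial>M)"
    using eventually_gt_at_top[of 0]
  proof eventually_elim
    case that: (elim n)
    have "\<sigma> * ?S n \<omega> = sqrt n * avg \<phi> n \<omega>" for \<omega>
    proof -
      have "(\<Sum>i=1..n. \<phi> (Z i \<omega>)) = (\<Sum>i<n. ?X i \<omega>)"
        by (rule sum.reindex_bij_witness[of _ Suc "\<lambda>i. i - 1"]) auto
      moreover have "real n = sqrt n * sqrt n" by simp
      ultimately show ?thesis using \<sigma>(1) that
        by (simp add: avg_def real_sqrt_mult field_simps)
    qed
    moreover have "char (distr M borel (?S n)) \<sigma> = (\<integral>\<omega>. iexp (\<sigma> * ?S n \<omega>) \<partial>M)"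
      unfolding char_def by (intro integral_distr) measurable
    ultimately show ?case by (simp only:)
  qed
  ultimately have "(\<lambda>n. \<integral>\<omega>. iexp (sqrt n * avg \<phi> n \<omega>) \<partial>M) \<longlonglongrightarrow> char std_normal_distribution \<sigma>"
    by (rule Lim_transform_eventually)
  then show ?thesis by (simp add: char_std_normal_distribution \<sigma>)
qed

end

section \<open>Consistency\<close>

text \<open>The estimation problem stripped of regression: maximise
  \<open>ln (\<eta> \<bullet> q)\<close> plus the average of \<open>g (\<eta> \<bullet> z)\<close>
  over the half-space \<open>\<eta> \<bullet> q > 0\<close>, with truth \<open>q\<close>.
  \<open>separated\<close> is the strict Kullback-Leibler inequality, and
  \<open>\<alpha> \<le> 1\<close> ensures that \<open>\<bar>t\<bar> powr \<alpha>\<close> dominates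
  \<open>min 1 \<bar>t\<bar>\<close>.\<close>

locale location_scale_sample = iid_sample M Z D
  for M :: "'w measure" and Z :: "nat \<Rightarrow> 'w \<Rightarrow> 'a :: euclidean_space" and D :: "'a measure" +
  fixes g g' g'' :: "real \<Rightarrow> real" and q :: 'a and A B \<alpha> :: real
  assumes g_deriv: "\<And>t. (g has_real_derivative g' t) (at t)"
    and g'_deriv: "\<And>t. (g' has_real_derivative g'' t) (at t)"
    and g''_cont: "continuous_on UNIV g''"
    and g''_bound: "\<And>t. \<bar>g'' t\<bar> \<le> B"
    and g'_bound: "\<And>t. \<bar>g' t\<bar> \<le> B * \<bar>t\<bar>"
    and g_upper: "\<And>t. g t \<le> A - \<bar>t\<bar> powr \<alpha>"
    and alpha: "0 < \<alpha>" "\<alpha> \<le> 1"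
    and norm_q: "norm q = 1"
    and sq_integrable: "integrable D (\<lambda>z. (norm z)\<^sup>2)"
    and nondegenerate: "\<And>\<eta>. \<eta> \<noteq> 0 \<Longrightarrow> \<not> (AE z in D. \<eta> \<bullet> z = 0)"
    and separated: "\<And>\<eta>. 0 < \<eta> \<bullet> q \<Longrightarrow> \<eta> \<noteq> q \<Longrightarrow> ln (\<eta> \<bullet> q) + (\<integral>z. g (\<eta> \<bullet> z) \<partial>D) < (\<integral>z. g (q \<bullet> z) \<partial>D)"
begin

lemma meas_D: "borel_measurable D = borel_measurable borel"
  by (rule measurable_cong_sets[OF sets_D refl])

lemma B_nonneg: "0 \<le> B"
  using g''_bound[of 0] by simp

lemma g_cont: "continuous_on UNIV g" and g'_cont: "continuous_on UNIV g'"
  using g_deriv g'_deriv by (auto intro!: DERIV_continuous_on simp: has_field_derivative_at_within)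

lemma g_measurable[measurable]: "g \<in> borel_measurable borel" "g' \<in> borel_measurable borel"
    "g'' \<in> borel_measurable borel"
  using g_cont g'_cont g''_cont by (auto intro: borel_measurable_continuous_onI)

text \<open>The mean value theorem with the linear growth of \<open>g'\<close>. Together with
  Cauchy-Schwarz it makes \<open>g (\<eta> \<bullet> z)\<close> Lipschitz in \<eta> on bounded sets,
  with a constant of order \<open>(norm z)\<^sup>2\<close>, which is integrable.\<close>

lemma g_diff_bound: "\<bar>g a - g b\<bar> \<le> B * max \<bar>a\<bar> \<bar>b\<bar> * \<bar>a - b\<bar>"
proof -
  have "\<bar>g x - g y\<bar> \<le> B * max \<bar>x\<bar> \<bar>y\<bar> * \<bar>x - y\<bar>" if xy: "x < y" for x y
  proof -
    obtain \<xi> where \<xi>: "x < \<xi>" "\<xi> < y" "g y - g x = (y - x) * g' \<xi>"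
      using MVT2[OF xy, of g g'] g_deriv by auto
    have "\<bar>g' \<xi>\<bar> \<le> B * max \<bar>x\<bar> \<bar>y\<bar>"
      by (rule order_trans[OF g'_bound]) (use \<xi> B_nonneg in \<open>intro mult_left_mono; auto\<close>)
    then have "\<bar>y - x\<bar> * \<bar>g' \<xi>\<bar> \<le> \<bar>y - x\<bar> * (B * max \<bar>x\<bar> \<bar>y\<bar>)" by (intro mult_left_mono) auto
    then show ?thesis using \<xi>(3) by (metis abs_minus_commute abs_mult mult.commute)
  qed
  from this[of a b] this[of b a] show ?thesis
    by (cases a b rule: linorder_cases) (auto simp: abs_minus_commute max.commute)
qed

lemma norm_integrable: "integrable D (\<lambda>z. norm z)"
proof -
  interpret D: prob_space D by (rule prob_space_D)
  show ?thesis
    by (rule D.square_integrable_imp_integrable) (use sq_integrable in \<open>auto simp: meas_D\<close>)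
qed

lemma g_inner_integrable: "integrable D (\<lambda>z. g (\<eta> \<bullet> z))"
proof -
  interpret D: prob_space D by (rule prob_space_D)
  have "integrable D (\<lambda>z. \<bar>g 0\<bar> + B * (norm \<eta>)\<^sup>2 * (norm z)\<^sup>2)"
    using sq_integrable by simp
  then show ?thesis
  proof (rule Bochner_Integration.integrable_bound)
    show "AE z in D. norm (g (\<eta> \<bullet> z)) \<le> norm (\<bar>g 0\<bar> + B * (norm \<eta>)\<^sup>2 * (norm z)\<^sup>2)"
    proof (rule AE_I2)
      fix z
      have "\<bar>g (\<eta> \<bullet> z) - g 0\<bar> \<le> B * \<bar>\<eta> \<bullet> z\<bar> * \<bar>\<eta> \<bullet> z\<bar>" using g_diff_bound[of "\<eta> \<bullet> z" 0] by simp
      also have "\<dots> = B * \<bar>\<eta> \<bullet> z\<bar>\<^sup>2" by (simp add: power2_eq_square)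
      also have "\<dots> \<le> B * (norm \<eta> * norm z)\<^sup>2"
        using B_nonneg Cauchy_Schwarz_ineq2[of \<eta> z] by (intro mult_left_mono power_mono) auto
      finally show "norm (g (\<eta> \<bullet> z)) \<le> norm (\<bar>g 0\<bar> + B * (norm \<eta>)\<^sup>2 * (norm z)\<^sup>2)"
        using B_nonneg by (simp add: power_mult_distrib mult.assoc)
    qed
  qed (simp add: meas_D)
qed

lemma avg_add: "avg (\<lambda>z. \<phi> z + \<psi> z) n \<omega> = avg \<phi> n \<omega> + avg \<psi> n \<omega>"
  by (simp add: avg_def sum.distrib add_divide_distrib)

lemma avg_cmult: "avg (\<lambda>z. c * \<phi> z) n \<omega> = c * avg \<phi> n \<omega>"
  by (simp add: avg_def sum_distrib_left)

lemma avg_mono: "(\<And>z. \<phi> z \<le> \<psi> z) \<Longrightarrow> avg \<phi> n \<omega> \<le> avg \<psi> n \<omega>"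
  by (simp add: avg_def sum_mono divide_right_mono)

lemma abs_avg_le: "(\<And>z. \<bar>\<phi> z\<bar> \<le> \<psi> z) \<Longrightarrow> \<bar>avg \<phi> n \<omega>\<bar> \<le> avg \<psi> n \<omega>"
  unfolding avg_def abs_divide by (auto intro!: divide_right_mono order_trans[OF sum_abs] sum_mono)

text \<open>A finite net of \<open>K\<close> leaves finitely many weak laws. Away from the net
  points, averages and means move by at most the mesh size times the average and the mean of
  \<open>L\<close>.\<close>

lemma uniform_law_large_numbers:
  fixes \<phi> :: "'a \<Rightarrow> 'a \<Rightarrow> real"
  assumes K: "compact K"
    and m: "\<And>v. \<phi> v \<in> borel_measurable borel" and int: "\<And>v. integrable D (\<phi> v)"
    and Lm: "L \<in> borel_measurable borel" and Lint: "integrable D L" and L0: "\<And>z. 0 \<le> L z"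
    and lip: "\<And>v w z. v \<in> K \<Longrightarrow> w \<in> K \<Longrightarrow> \<bar>\<phi> v z - \<phi> w z\<bar> \<le> norm (v - w) * L z"
    and \<eta>: "0 < \<eta>"
  shows "whp (\<lambda>n \<omega>. \<forall>v\<in>K. \<bar>avg (\<phi> v) n \<omega> - (\<integral>z. \<phi> v z \<partial>D)\<bar> < \<eta>)"
proof -
  define I where "I = (\<integral>z. L z \<partial>D)"
  have I: "0 \<le> I" unfolding I_def using L0 by (intro integral_nonneg_AE) auto
  \<comment> \<open>With high probability the average of \<open>L\<close> stays below
    \<open>I + 1\<close>, so moving by less than \<open>\<rho>\<close> costs at most
    \<open>\<eta> / 4\<close> in the average, and likewise in the mean.\<close>
  define \<rho> where "\<rho> = \<eta> / (4 * (I + 1))"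
  have \<rho>: "0 < \<rho>" "\<rho> * (I + 1) = \<eta> / 4" using \<eta> I by (auto simp: \<rho>_def field_simps)
  obtain K0 where K0: "finite K0" "K0 \<subseteq> K" "K \<subseteq> (\<Union>x\<in>K0. ball x \<rho>)"
    using compactE_image[OF K, of K "\<lambda>x. ball x \<rho>"] \<rho>(1) by (metis UN_I centre_in_ball open_ball subsetI)
  have "whp (\<lambda>n \<omega>. (\<forall>v\<in>K0. \<bar>avg (\<phi> v) n \<omega> - (\<integral>z. \<phi> v z \<partial>D)\<bar> < \<eta> / 4) \<and> \<bar>avg L n \<omega> - I\<bar> < 1)"
    unfolding I_def using \<eta>
    by (intro whp_conj whp_ball K0 weak_law_large_numbers m int Lm Lint) auto
  then show ?thesis
  proof (rule whp_mono, intro always_eventually allI ballI impI)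
    fix n \<omega> v
    assume *: "(\<forall>v\<in>K0. \<bar>avg (\<phi> v) n \<omega> - (\<integral>z. \<phi> v z \<partial>D)\<bar> < \<eta> / 4) \<and> \<bar>avg L n \<omega> - I\<bar> < 1" and v: "v \<in> K"
    obtain w where w: "w \<in> K0" "norm (v - w) < \<rho>"
      using K0(3) v by (auto simp: dist_norm norm_minus_commute)
    have d: "\<bar>\<phi> v z - \<phi> w z\<bar> \<le> \<rho> * L z" for z
      using lip[OF v, of w z] w K0(2) mult_right_mono[of "norm (v - w)" \<rho> "L z"] L0[of z] by force
    have "\<bar>avg (\<phi> v) n \<omega> - avg (\<phi> w) n \<omega>\<bar> \<le> \<rho> * avg L n \<omega>"
      using abs_avg_le[of "\<lambda>z. \<phi> v z - \<phi> w z" "\<lambda>z. \<rho> * L z" n \<omega>, OF d] by (simp add: avg_diff avg_cmult)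
    also have "\<dots> \<le> \<rho> * (I + 1)" using * \<rho>(1) by (intro mult_left_mono) auto
    finally have 1: "\<bar>avg (\<phi> v) n \<omega> - avg (\<phi> w) n \<omega>\<bar> \<le> \<eta> / 4" using \<rho>(2) by simp
    have "\<bar>(\<integral>z. \<phi> v z \<partial>D) - (\<integral>z. \<phi> w z \<partial>D)\<bar> = \<bar>\<integral>z. \<phi> v z - \<phi> w z \<partial>D\<bar>"
      using int by simp
    also have "\<dots> \<le> (\<integral>z. \<bar>\<phi> v z - \<phi> w z\<bar> \<partial>D)" by (rule integral_abs_bound)
    also have "\<dots> \<le> (\<integral>z. \<rho> * L z \<partial>D)"
      using d int Lint by (intro integral_mono) auto
    also have "\<dots> \<le> \<rho> * (I + 1)" using \<rho>(1) by (simp add: I_def)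
    finally have 2: "\<bar>(\<integral>z. \<phi> v z \<partial>D) - (\<integral>z. \<phi> w z \<partial>D)\<bar> \<le> \<eta> / 4" using \<rho>(2) by simp
    have "\<bar>avg (\<phi> w) n \<omega> - (\<integral>z. \<phi> w z \<partial>D)\<bar> < \<eta> / 4" using * w(1) by blast
    with 1 2 \<eta> show "\<bar>avg (\<phi> v) n \<omega> - (\<integral>z. \<phi> v z \<partial>D)\<bar> < \<eta>" by linarith
  qed
qed

lemma continuous_on_integral_lipschitz:
  fixes \<phi> :: "'a \<Rightarrow> 'a \<Rightarrow> real"
  assumes int: "\<And>v. integrable D (\<phi> v)" and Lint: "integrable D L"
    and lip: "\<And>v w z. v \<in> K \<Longrightarrow> w \<in> K \<Longrightarrow> \<bar>\<phi> v z - \<phi> w z\<bar> \<le> norm (v - w) * L z"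
  shows "continuous_on K (\<lambda>v. \<integral>z. \<phi> v z \<partial>D)"
proof (rule continuous_onI)
  fix x and e :: real assume x: "x \<in> K" and e: "0 < e"
  define I where "I = \<bar>\<integral>z. L z \<partial>D\<bar>"
  have bd: "dist (\<integral>z. \<phi> y z \<partial>D) (\<integral>z. \<phi> x z \<partial>D) \<le> norm (y - x) * I" if "y \<in> K" for y
  proof -
    have "\<bar>(\<integral>z. \<phi> y z \<partial>D) - (\<integral>z. \<phi> x z \<partial>D)\<bar> = \<bar>\<integral>z. \<phi> y z - \<phi> x z \<partial>D\<bar>" using int by simp
    also have "\<dots> \<le> (\<integral>z. \<bar>\<phi> y z - \<phi> x z\<bar> \<partial>D)" by (rule integral_abs_bound)
    also have "\<dots> \<le> (\<integral>z. norm (y - x) * L z \<partial>D)"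
      using lip[OF that x] int Lint by (intro integral_mono) auto
    also have "\<dots> \<le> norm (y - x) * I" by (auto simp: I_def intro: mult_left_mono)
    finally show ?thesis by (simp add: dist_real_def)
  qed
  show "\<exists>d>0. \<forall>x'\<in>K. dist x' x < d \<longrightarrow> dist (\<integral>z. \<phi> x' z \<partial>D) (\<integral>z. \<phi> x z \<partial>D) \<le> e"
  proof (intro exI[of _ "e / (I + 1)"] conjI ballI impI)
    show "0 < e / (I + 1)" using e by (simp add: I_def add_nonneg_pos)
    fix y assume y: "y \<in> K" "dist y x < e / (I + 1)"
    have "norm (y - x) * I \<le> norm (y - x) * (I + 1)" by (intro mult_left_mono) auto
    also have "\<dots> \<le> e" using y(2) by (simp add: dist_norm I_def add_nonneg_pos field_simps)
    finally show "dist (\<integral>z. \<phi> y z \<partial>D) (\<integral>z. \<phi> x z \<partial>D) \<le> e" using bd[OF y(1)] by simp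
  qed
qed

lemma min_inner_lipschitz: "\<bar>min 1 \<bar>v \<bullet> z\<bar> - min 1 \<bar>w \<bullet> z\<bar>\<bar> \<le> norm (v - w) * norm z" for v w z :: 'a
proof -
  have "\<bar>min 1 \<bar>v \<bullet> z\<bar> - min 1 \<bar>w \<bullet> z\<bar>\<bar> \<le> \<bar>(v - w) \<bullet> z\<bar>"
    unfolding inner_diff_left by (auto simp: min_def)
  then show ?thesis using Cauchy_Schwarz_ineq2[of "v - w" z] by simp
qed

lemma min_inner_measurable: "(\<lambda>z. min 1 \<bar>v \<bullet> z\<bar>) \<in> borel_measurable borel" for v :: 'a
  by measurable

lemma min_inner_integrable: "integrable D (\<lambda>z. min 1 \<bar>v \<bullet> z\<bar>)"
proof -
  interpret D: prob_space D by (rule prob_space_D)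
  show ?thesis
    by (rule D.integrable_const_bound[of _ 1]) (auto simp: meas_D)
qed

text \<open>Truncation at 1 makes the statistic bounded, and it stays Lipschitz in the direction.
  Its mean is positive in each direction by \<open>nondegenerate\<close>, hence bounded below on the
  compact sphere, and the uniform law transfers the bound to the sample.\<close>

lemma spread_out:
  "\<exists>c>0. whp (\<lambda>n \<omega>. \<forall>v\<in>sphere 0 1. c \<le> avg (\<lambda>z. min 1 \<bar>v \<bullet> z\<bar>) n \<omega>)"
proof -
  let ?\<mu> = "\<lambda>v. \<integral>z. min 1 \<bar>v \<bullet> z\<bar> \<partial>D"
  have pos: "0 < ?\<mu> v" if "v \<noteq> 0" for v
  proof -
    have "0 \<le> ?\<mu> v" by (intro integral_nonneg_AE) auto
    moreover have "?\<mu> v \<noteq> 0"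
    proof
      assume "?\<mu> v = 0"
      then have "AE z in D. min 1 \<bar>v \<bullet> z\<bar> = 0"
        by (subst (asm) integral_nonneg_eq_0_iff_AE[OF min_inner_integrable]) auto
      then have "AE z in D. v \<bullet> z = 0" by eventually_elim (auto simp: min_def split: if_splits)
      with nondegenerate[OF that] show False by blast
    qed
    ultimately show ?thesis by linarith
  qed
  have "sphere 0 1 \<noteq> ({} :: 'a set)" using norm_q by (auto simp: sphere_def)
  moreover have "continuous_on (sphere 0 1) ?\<mu>"
    by (rule continuous_on_integral_lipschitz[OF min_inner_integrable norm_integrable]) (rule min_inner_lipschitz)
  ultimately obtain v0 where v0: "v0 \<in> sphere 0 1" "\<And>v. v \<in> sphere 0 1 \<Longrightarrow> ?\<mu> v0 \<le> ?\<mu> v"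
    using continuous_attains_inf[of "sphere 0 1" ?\<mu>] compact_sphere by blast
  have c: "0 < ?\<mu> v0 / 2" using pos[of v0] v0(1) by (cases "v0 = 0") auto
  have "whp (\<lambda>n \<omega>. \<forall>v\<in>sphere 0 1. \<bar>avg (\<lambda>z. min 1 \<bar>v \<bullet> z\<bar>) n \<omega> - ?\<mu> v\<bar> < ?\<mu> v0 / 2)"
    by (rule uniform_law_large_numbers[OF compact_sphere min_inner_measurable min_inner_integrable _ norm_integrable])
       (use c in \<open>auto simp: min_inner_lipschitz\<close>)
  then have "whp (\<lambda>n \<omega>. \<forall>v\<in>sphere 0 1. ?\<mu> v0 / 2 \<le> avg (\<lambda>z. min 1 \<bar>v \<bullet> z\<bar>) n \<omega>)"
  proof (rule whp_mono, intro always_eventually allI ballI impI)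
    fix n \<omega> v assume *: "\<forall>v\<in>sphere 0 1. \<bar>avg (\<lambda>z. min 1 \<bar>v \<bullet> z\<bar>) n \<omega> - ?\<mu> v\<bar> < ?\<mu> v0 / 2"
      and v: "v \<in> sphere (0 :: 'a) 1"
    have "\<bar>avg (\<lambda>z. min 1 \<bar>v \<bullet> z\<bar>) n \<omega> - ?\<mu> v\<bar> < ?\<mu> v0 / 2" using * v by blast
    with v0(2)[OF v] show "?\<mu> v0 / 2 \<le> avg (\<lambda>z. min 1 \<bar>v \<bullet> z\<bar>) n \<omega>" by linarith
  qed
  with c show ?thesis by blast
qed

lemma powr_scaled_ge_min:
  assumes "0 \<le> r" shows "r powr \<alpha> * min 1 \<bar>x\<bar> \<le> \<bar>r * x\<bar> powr \<alpha>"
proof -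
  have "min 1 \<bar>x\<bar> \<le> \<bar>x\<bar> powr \<alpha>"
  proof (cases "\<bar>x\<bar> \<le> 1")
    case True
    then have "\<bar>x\<bar> powr 1 \<le> \<bar>x\<bar> powr \<alpha>" using alpha by (intro powr_mono') simp_all
    then show ?thesis using True by simp
  next
    case False
    then have "1 powr \<alpha> \<le> \<bar>x\<bar> powr \<alpha>" using alpha by (intro powr_mono2) auto
    then show ?thesis using False by simp
  qed
  then have "r powr \<alpha> * min 1 \<bar>x\<bar> \<le> r powr \<alpha> * \<bar>x\<bar> powr \<alpha>" by (intro mult_left_mono) auto
  then show ?thesis using assms by (simp add: abs_mult powr_mult)
qed

lemma inner_q_le: "\<eta> \<bullet> q \<le> norm \<eta>"
  using norm_cauchy_schwarz[of \<eta> q] norm_q by simp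

text \<open>For \<open>c > 0\<close> the first bound tends to minus infinity as
  \<open>norm \<eta>\<close> grows, since a power beats the logarithm; the second does so as
  \<open>\<eta> \<bullet> q\<close> tends to 0. Together they confine good candidates to a compact
  set.\<close>

lemma loglik_upper:
  assumes pos: "0 < \<eta> \<bullet> q" and n: "0 < n"
    and c: "\<forall>v\<in>sphere 0 1. c \<le> avg (\<lambda>z. min 1 \<bar>v \<bullet> z\<bar>) n \<omega>"
  shows "ln (\<eta> \<bullet> q) + avg (\<lambda>z. g (\<eta> \<bullet> z)) n \<omega> \<le> ln (norm \<eta>) + A - norm \<eta> powr \<alpha> * c"
    and "ln (\<eta> \<bullet> q) + avg (\<lambda>z. g (\<eta> \<bullet> z)) n \<omega> \<le> ln (\<eta> \<bullet> q) + A"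
proof -
  have ne: "\<eta> \<noteq> 0" using pos by auto
  define v where "v = \<eta> /\<^sub>R norm \<eta>"
  have v: "v \<in> sphere 0 1" "\<eta> = norm \<eta> *\<^sub>R v" using ne by (auto simp: v_def)
  have "avg (\<lambda>z. g (\<eta> \<bullet> z)) n \<omega> \<le> avg (\<lambda>z. A - norm \<eta> powr \<alpha> * min 1 \<bar>v \<bullet> z\<bar>) n \<omega>"
  proof (rule avg_mono)
    fix z
    have "\<eta> \<bullet> z = norm \<eta> * (v \<bullet> z)" by (subst v(2)) simp
    then show "g (\<eta> \<bullet> z) \<le> A - norm \<eta> powr \<alpha> * min 1 \<bar>v \<bullet> z\<bar>"
      using g_upper[of "\<eta> \<bullet> z"] powr_scaled_ge_min[of "norm \<eta>" "v \<bullet> z"] by simp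
  qed
  also have "\<dots> = A - norm \<eta> powr \<alpha> * avg (\<lambda>z. min 1 \<bar>v \<bullet> z\<bar>) n \<omega>"
    using n by (simp add: avg_diff avg_cmult avg_const)
  also have "\<dots> \<le> A - norm \<eta> powr \<alpha> * c" using c v(1) by (auto intro: mult_left_mono)
  finally have "avg (\<lambda>z. g (\<eta> \<bullet> z)) n \<omega> \<le> A - norm \<eta> powr \<alpha> * c" .
  moreover have "ln (\<eta> \<bullet> q) \<le> ln (norm \<eta>)" using pos inner_q_le[of \<eta>] by (subst ln_le_cancel_iff) auto
  ultimately show "ln (\<eta> \<bullet> q) + avg (\<lambda>z. g (\<eta> \<bullet> z)) n \<omega> \<le> ln (norm \<eta>) + A - norm \<eta> powr \<alpha> * c" by simp
  have "avg (\<lambda>z. g (\<eta> \<bullet> z)) n \<omega> \<le> avg (\<lambda>z. A) n \<omega>"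
  proof (rule avg_mono)
    fix z show "g (\<eta> \<bullet> z) \<le> A" using g_upper[of "\<eta> \<bullet> z"] powr_ge_zero[of "\<bar>\<eta> \<bullet> z\<bar>" \<alpha>] by linarith
  qed
  then show "ln (\<eta> \<bullet> q) + avg (\<lambda>z. g (\<eta> \<bullet> z)) n \<omega> \<le> ln (\<eta> \<bullet> q) + A" using n by (simp add: avg_const)
qed

text \<open>Wald's argument: off a compact set the criterion lies below its value at
  \<open>q\<close> by \<open>loglik_upper\<close>; on the compact set without a ball around
  \<open>q\<close> it does so by separation and the uniform law. It suffices that
  \<open>\<eta> n\<close> is at least as good as \<open>q\<close>.\<close>

lemma consistent:
  assumes max: "whp (\<lambda>n \<omega>. 0 < \<eta> n \<omega> \<bullet> q \<and> avg (\<lambda>z. g (q \<bullet> z)) n \<omega> \<le> ln (\<eta> n \<omega> \<bullet> q) + avg (\<lambda>z. g (\<eta> n \<omega> \<bullet> z)) n \<omega>)"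
    and r: "0 < r"
  shows "whp (\<lambda>n \<omega>. norm (\<eta> n \<omega> - q) < r)"
proof -
  define L0 where "L0 = (\<integral>z. g (q \<bullet> z) \<partial>D)"
  obtain c where c: "0 < c" "whp (\<lambda>n \<omega>. \<forall>v\<in>sphere 0 1. c \<le> avg (\<lambda>z. min 1 \<bar>v \<bullet> z\<bar>) n \<omega>)"
    using spread_out by blast
  have "filterlim (\<lambda>x. ln x + A - x powr \<alpha> * c) at_bot at_top"
    using c(1) alpha(1) by real_asymp
  then have "\<forall>\<^sub>F x in at_top. ln x + A - x powr \<alpha> * c < L0 - 1"
    by (simp add: filterlim_at_bot_dense)
  then obtain R0 where R0: "\<And>x. R0 \<le> x \<Longrightarrow> ln x + A - x powr \<alpha> * c < L0 - 1"
    unfolding eventually_at_top_linorder by blast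
  define R where "R = max 1 R0"
  \<comment> \<open>Chosen so that \<open>ln \<gamma> + A = L0 - 2\<close>, whereas the criterion at
    \<open>q\<close> exceeds \<open>L0 - 1\<close> with high probability.\<close>
  define \<gamma> where "\<gamma> = exp (L0 - 2 - A)"
  define K where "K = cball 0 R \<inter> {\<eta>. \<gamma> \<le> \<eta> \<bullet> q} - ball q r"
  have "compact (cball 0 R \<inter> {\<eta>. \<gamma> \<le> \<eta> \<bullet> q} \<inter> - ball q r)"
    by (intro compact_Int_closed closed_Collect_le continuous_intros) auto
  then have K: "compact K" unfolding K_def Diff_eq .
  have lip: "\<bar>g (v \<bullet> z) - g (w \<bullet> z)\<bar> \<le> norm (v - w) * (B * R * (norm z)\<^sup>2)" if "v \<in> K" "w \<in> K" for v w z
  proof -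
    have *: "\<bar>v \<bullet> z\<bar> \<le> R * norm z" if "v \<in> K" for v
      using Cauchy_Schwarz_ineq2[of v z] that mult_right_mono[of "norm v" R "norm z"] by (auto simp: K_def)
    have "\<bar>g (v \<bullet> z) - g (w \<bullet> z)\<bar> \<le> B * max \<bar>v \<bullet> z\<bar> \<bar>w \<bullet> z\<bar> * \<bar>v \<bullet> z - w \<bullet> z\<bar>" by (rule g_diff_bound)
    also have "\<dots> \<le> B * (R * norm z) * (norm (v - w) * norm z)"
      using B_nonneg *[OF that(1)] *[OF that(2)] Cauchy_Schwarz_ineq2[of "v - w" z]
      by (intro mult_mono) (auto simp: inner_diff_left)
    finally show ?thesis by (simp add: power2_eq_square mult_ac)
  qed
  have Lint: "integrable D (\<lambda>z. B * R * (norm z)\<^sup>2)" using sq_integrable by simp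
  have K_q: "q \<notin> K" "\<eta> \<bullet> q > 0" if "\<eta> \<in> K" for \<eta>
    using that r unfolding K_def \<gamma>_def by (auto intro: less_le_trans[OF exp_gt_zero])
  have "\<exists>d>0. \<forall>\<eta>\<in>K. ln (\<eta> \<bullet> q) + (\<integral>z. g (\<eta> \<bullet> z) \<partial>D) \<le> L0 - d"
  proof (cases "K = {}")
    case True then show ?thesis by (auto intro: exI[of _ 1])
  next
    case False
    have "continuous_on K (\<lambda>\<eta>. ln (\<eta> \<bullet> q) + (\<integral>z. g (\<eta> \<bullet> z) \<partial>D))"
      by (intro continuous_intros continuous_on_integral_lipschitz[OF g_inner_integrable Lint] lip)
         (use K_q in force)+
    from continuous_attains_sup[OF K False this] obtain \<eta>1 where \<eta>1: "\<eta>1 \<in> K"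
      "\<And>\<eta>. \<eta> \<in> K \<Longrightarrow> ln (\<eta> \<bullet> q) + (\<integral>z. g (\<eta> \<bullet> z) \<partial>D) \<le> ln (\<eta>1 \<bullet> q) + (\<integral>z. g (\<eta>1 \<bullet> z) \<partial>D)" by blast
    have "ln (\<eta>1 \<bullet> q) + (\<integral>z. g (\<eta>1 \<bullet> z) \<partial>D) < L0"
      unfolding L0_def by (rule separated) (use K_q[OF \<eta>1(1)] \<eta>1(1) in auto)
    with \<eta>1 show ?thesis
      by (intro exI[of _ "L0 - (ln (\<eta>1 \<bullet> q) + (\<integral>z. g (\<eta>1 \<bullet> z) \<partial>D))"]) auto
  qed
  then obtain d where d: "0 < d" "\<And>\<eta>. \<eta> \<in> K \<Longrightarrow> ln (\<eta> \<bullet> q) + (\<integral>z. g (\<eta> \<bullet> z) \<partial>D) \<le> L0 - d" by blast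
  have unif: "whp (\<lambda>n \<omega>. \<forall>\<eta>\<in>K. \<bar>avg (\<lambda>z. g (\<eta> \<bullet> z)) n \<omega> - (\<integral>z. g (\<eta> \<bullet> z) \<partial>D)\<bar> < d / 2)"
    by (rule uniform_law_large_numbers[OF K _ g_inner_integrable _ Lint _ lip])
       (use d(1) B_nonneg in \<open>auto simp: R_def\<close>)
  have "whp (\<lambda>n \<omega>. \<bar>avg (\<lambda>z. g (q \<bullet> z)) n \<omega> - L0\<bar> < min 1 (d / 2))"
    unfolding L0_def by (rule weak_law_large_numbers[OF _ g_inner_integrable]) (use d(1) in auto)
  from whp_conj[OF whp_conj[OF max c(2)] whp_conj[OF unif this]]
  show ?thesis
  proof (rule whp_mono, goal_cases)
    case 1
    show ?case using eventually_gt_at_top[of 0]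
    proof (eventually_elim, intro ballI impI, elim conjE)
      fix n :: nat and \<omega>
      let ?e = "\<eta> n \<omega>"
      assume n: "0 < n" and pos: "0 < ?e \<bullet> q"
        and ge: "avg (\<lambda>z. g (q \<bullet> z)) n \<omega> \<le> ln (?e \<bullet> q) + avg (\<lambda>z. g (?e \<bullet> z)) n \<omega>"
        and sp: "\<forall>v\<in>sphere 0 1. c \<le> avg (\<lambda>z. min 1 \<bar>v \<bullet> z\<bar>) n \<omega>"
        and un: "\<forall>\<eta>\<in>K. \<bar>avg (\<lambda>z. g (\<eta> \<bullet> z)) n \<omega> - (\<integral>z. g (\<eta> \<bullet> z) \<partial>D)\<bar> < d / 2"
        and L: "\<bar>avg (\<lambda>z. g (q \<bullet> z)) n \<omega> - L0\<bar> < min 1 (d / 2)"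
      show "norm (?e - q) < r"
      proof (rule ccontr)
        assume far: "\<not> norm (?e - q) < r"
        have "norm ?e \<le> R"
        proof (rule ccontr)
          assume "\<not> norm ?e \<le> R"
          then have "ln (norm ?e) + A - norm ?e powr \<alpha> * c < L0 - 1" by (intro R0) (auto simp: R_def)
          with loglik_upper(1)[OF pos n sp] ge L show False by linarith
        qed
        moreover have "\<gamma> \<le> ?e \<bullet> q"
        proof (rule ccontr)
          assume "\<not> \<gamma> \<le> ?e \<bullet> q"
          then have "ln (?e \<bullet> q) < ln \<gamma>" using pos by (subst ln_less_cancel_iff) (simp_all add: \<gamma>_def)
          with loglik_upper(2)[OF pos n sp] ge L show False by (simp add: \<gamma>_def)
        qed
        ultimately have "?e \<in> K" using far by (auto simp: K_def dist_norm norm_minus_commute)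
        then have "\<bar>avg (\<lambda>z. g (?e \<bullet> z)) n \<omega> - (\<integral>z. g (?e \<bullet> z) \<partial>D)\<bar> < d / 2" using un by blast
        with d(2)[OF \<open>?e \<in> K\<close>] ge L show False by linarith
      qed
    qed
  qed
qed

end

section \<open>Expansion of the score\<close>

text \<open>Minus the gradient at \<open>\<eta> = q\<close> of the contribution of one observation,
  where \<open>norm q = 1\<close> removes the denominator of the logarithmic derivative. With this
  sign \<open>J \<delta>\<close> for \<open>\<delta> = q - \<eta>\<close> is approximated by the
  average of \<open>\<psi>\<close>.\<close>

definition (in location_scale_sample) \<psi> :: "'a \<Rightarrow> 'a" where
  "\<psi> z = - q - g' (q \<bullet> z) *\<^sub>R z"

text \<open>\<open>J_hessian\<close> makes \<open>J\<close> minus the expected Hessian of the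
  criterion at \<open>q\<close>, and \<open>score_variance\<close> makes it the covariance of the
  score. This information equality is assumed here and verified for the model in
  \<open>location_scale_info_law\<close>.\<close>

locale location_scale_info = location_scale_sample +
  fixes J :: "'b \<Rightarrow> 'b" and l :: real
  assumes J_coercive: "0 < l" "\<And>v. l * (norm v)\<^sup>2 \<le> v \<bullet> J v"
    and J_hessian: "\<And>u v. v \<bullet> J u = (u \<bullet> q) * (v \<bullet> q) - (\<integral>z. g'' (q \<bullet> z) * (u \<bullet> z) * (v \<bullet> z) \<partial>D)"
    and score_mean: "\<And>v. (\<integral>z. v \<bullet> \<psi> z \<partial>D) = 0"
    and score_variance: "\<And>v. integrable D (\<lambda>z. (v \<bullet> \<psi> z)\<^sup>2)" "\<And>v. (\<integral>z. (v \<bullet> \<psi> z)\<^sup>2 \<partial>D) = v \<bullet> J v"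

lemma (in location_scale_sample) tail_second_moment:
  assumes "0 < e"
  obtains K where "0 < K" "(\<integral>z. (norm z)\<^sup>2 * indicator {z. K < norm z} z \<partial>D) < e"
proof -
  have "(\<lambda>k. \<integral>z. (norm z)\<^sup>2 * indicator {z. real k < norm z} z \<partial>D) \<longlonglongrightarrow> (\<integral>z. 0 \<partial>D)"
  proof (rule integral_dominated_convergence[where w="\<lambda>z. (norm z)\<^sup>2"])
    show "AE z in D. (\<lambda>k. (norm z)\<^sup>2 * indicator {z. real k < norm z} z) \<longlonglongrightarrow> 0"
    proof (rule AE_I2)
      fix z
      obtain k0 where k0: "norm z \<le> real k0" using real_arch_simple by blast
      have "\<forall>\<^sub>F k in sequentially. (norm z)\<^sup>2 * indicator {z. real k < norm z} z = (0 :: real)"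
        using eventually_ge_at_top[of k0] by eventually_elim (use k0 in auto)
      then show "(\<lambda>k. (norm z)\<^sup>2 * indicator {z. real k < norm z} z :: real) \<longlonglongrightarrow> 0" by (rule tendsto_eventually)
    qed
  qed (auto simp: meas_D sq_integrable split: split_indicator)
  then have "\<forall>\<^sub>F k in sequentially. (\<integral>z. (norm z)\<^sup>2 * indicator {z. real k < norm z} z \<partial>D) < e"
    using assms by (intro order_tendstoD) auto
  then have "\<forall>\<^sub>F k in sequentially. 0 < k \<and> (\<integral>z. (norm z)\<^sup>2 * indicator {z. real k < norm z} z \<partial>D) < e"
    using eventually_gt_at_top[of 0] by eventually_elim auto
  then obtain k :: nat where "0 < k \<and> (\<integral>z. (norm z)\<^sup>2 * indicator {z. real k < norm z} z \<partial>D) < e"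
    unfolding eventually_sequentially by blast
  then show ?thesis using that[of "real k"] by simp
qed

text \<open>The remainder is \<open>\<delta> \<bullet> z\<close> times an increment of
  \<open>g''\<close>. For \<open>norm z \<le> K\<close> the increment is small by uniform continuity
  on a compact interval; for larger \<open>z\<close> it is at most \<open>2 * B\<close>, and the
  tail of the second moment is small. One dominating \<open>W\<close> of small mean thus serves all
  small \<open>\<delta>\<close>, also random ones.\<close>

lemma (in location_scale_sample) taylor_remainder:
  assumes \<tau>: "0 < \<tau>"
  obtains r W where "0 < r" "W \<in> borel_measurable borel" "integrable D W" "(\<integral>z. W z \<partial>D) < \<tau>"
    "\<And>\<delta> z. norm \<delta> < r \<Longrightarrow>
      \<bar>g' ((q - \<delta>) \<bullet> z) - g' (q \<bullet> z) + g'' (q \<bullet> z) * (\<delta> \<bullet> z)\<bar> * norm z \<le> norm \<delta> * W z"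
proof -
  define I where "I = (\<integral>z. (norm z)\<^sup>2 \<partial>D)"
  have I: "0 \<le> I" unfolding I_def by (intro integral_nonneg_AE) auto
  obtain K where K: "0 < K" "(\<integral>z. (norm z)\<^sup>2 * indicator {z. K < norm z} z \<partial>D) < \<tau> / (4 * (B + 1))"
    using tail_second_moment[of "\<tau> / (4 * (B + 1))"] \<tau> B_nonneg by auto
  define e where "e = \<tau> / (2 * (I + 1))"
  have e: "0 < e" "e * (I + 1) = \<tau> / 2" using \<tau> I by (auto simp: e_def field_simps)
  have "uniformly_continuous_on {- (2 * K)..2 * K} g''"
    by (intro compact_uniformly_continuous continuous_on_subset[OF g''_cont]) auto
  then obtain d where d: "0 < d"
    "\<And>s t. s \<in> {- (2 * K)..2 * K} \<Longrightarrow> t \<in> {- (2 * K)..2 * K} \<Longrightarrow> \<bar>t - s\<bar> < d \<Longrightarrow> \<bar>g'' t - g'' s\<bar> < e"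
    unfolding uniformly_continuous_on_def dist_real_def using e(1) by metis
  \<comment> \<open>For \<open>norm z \<le> K\<close>, the bound \<open>r \<le> 1\<close> keeps the
    intermediate point in \<open>[- 2 * K, 2 * K]\<close>, and \<open>r * K \<le> d\<close> keeps it
    within \<open>d\<close> of \<open>q \<bullet> z\<close>.\<close>
  define r where "r = min 1 (d / K)"
  have r: "0 < r" "r \<le> 1" "r * K \<le> d" using d(1) K(1) by (auto simp: r_def min_def field_simps)
  define W where "W z = 2 * B * ((norm z)\<^sup>2 * indicator {z. K < norm z} z) + e * (norm z)\<^sup>2" for z :: 'a
  have Wm: "W \<in> borel_measurable borel" unfolding W_def by measurable
  have "integrable D (\<lambda>z. indicator {z. K < norm z} z *\<^sub>R (norm z)\<^sup>2)"
    using sq_integrable by (rule integrable_mult_indicator[rotated]) (simp add: sets_D)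
  then have int: "integrable D (\<lambda>z. (norm z)\<^sup>2 * indicator {z. K < norm z} z)"
    by (simp add: mult.commute)
  have Wint: "integrable D W" unfolding W_def using int sq_integrable by simp
  have "(\<integral>z. W z \<partial>D) = 2 * B * (\<integral>z. (norm z)\<^sup>2 * indicator {z. K < norm z} z \<partial>D) + e * I"
    unfolding W_def I_def using int sq_integrable by simp
  also have "\<dots> \<le> 2 * B * (\<tau> / (4 * (B + 1))) + e * I"
    using K(2) B_nonneg e(1) I by (intro add_mono mult_left_mono) auto
  also have "2 * B * (\<tau> / (4 * (B + 1))) \<le> \<tau> / 2"
    using \<tau> B_nonneg by (simp add: field_simps)
  finally have Wsmall: "(\<integral>z. W z \<partial>D) < \<tau>" using e by (simp add: algebra_simps)
  have main: "\<bar>g' ((q - \<delta>) \<bullet> z) - g' (q \<bullet> z) + g'' (q \<bullet> z) * (\<delta> \<bullet> z)\<bar> * norm z \<le> norm \<delta> * W z"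
    if \<delta>: "norm \<delta> < r" for \<delta> z
  proof -
    let ?a = "q \<bullet> z" and ?h = "\<delta> \<bullet> z"
    have "\<exists>\<xi>. \<bar>\<xi> - ?a\<bar> \<le> \<bar>?h\<bar> \<and> g' (?a - ?h) - g' ?a = - ?h * g'' \<xi>"
    proof (cases ?h "0 :: real" rule: linorder_cases)
      case less
      then obtain \<xi> where "?a < \<xi>" "\<xi> < ?a - ?h" "g' (?a - ?h) - g' ?a = (?a - ?h - ?a) * g'' \<xi>"
        using MVT2[of ?a "?a - ?h" g' g''] g'_deriv by auto
      then show ?thesis using less by (intro exI[of _ \<xi>]) auto
    next
      case greater
      then obtain \<xi> where "?a - ?h < \<xi>" "\<xi> < ?a" "g' ?a - g' (?a - ?h) = (?a - (?a - ?h)) * g'' \<xi>"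
        using MVT2[of "?a - ?h" ?a g' g''] g'_deriv by auto
      then show ?thesis using greater by (intro exI[of _ \<xi>]) auto
    qed auto
    then obtain \<xi> where \<xi>: "\<bar>\<xi> - ?a\<bar> \<le> \<bar>?h\<bar>" "g' (?a - ?h) - g' ?a = - ?h * g'' \<xi>" by blast
    have h: "\<bar>?h\<bar> \<le> norm \<delta> * norm z" by (rule Cauchy_Schwarz_ineq2)
    have a: "\<bar>?a\<bar> \<le> norm z" using Cauchy_Schwarz_ineq2[of q z] norm_q by simp
    have "g' ((q - \<delta>) \<bullet> z) - g' ?a + g'' ?a * ?h = ?h * (g'' ?a - g'' \<xi>)"
      using \<xi>(2) by (simp add: inner_diff_left algebra_simps)
    then have "\<bar>g' ((q - \<delta>) \<bullet> z) - g' ?a + g'' ?a * ?h\<bar> * norm z = \<bar>?h\<bar> * (\<bar>g'' ?a - g'' \<xi>\<bar> * norm z)"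
      by (simp add: abs_mult)
    also have "\<dots> \<le> norm \<delta> * norm z * (\<bar>g'' ?a - g'' \<xi>\<bar> * norm z)"
      using h by (intro mult_right_mono) auto
    also have "\<dots> = norm \<delta> * (\<bar>g'' ?a - g'' \<xi>\<bar> * (norm z)\<^sup>2)"
      by (simp add: power2_eq_square)
    also have "\<bar>g'' ?a - g'' \<xi>\<bar> * (norm z)\<^sup>2 \<le> W z"
    proof (cases "K < norm z")
      case True
      have "\<bar>g'' ?a - g'' \<xi>\<bar> \<le> 2 * B" using g''_bound[of ?a] g''_bound[of \<xi>] by linarith
      then have "\<bar>g'' ?a - g'' \<xi>\<bar> * (norm z)\<^sup>2 \<le> 2 * B * (norm z)\<^sup>2" by (intro mult_right_mono) auto
      then show ?thesis using True e(1) by (simp add: W_def add_increasing2)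
    next
      case False
      have "norm \<delta> * norm z \<le> r * K" using \<delta> False r(1) by (intro mult_mono) auto
      have hd: "\<bar>?h\<bar> < d"
      proof (cases "norm z = 0")
        case True then show ?thesis using d(1) by simp
      next
        case nz: False
        then have "norm \<delta> * norm z < r * norm z" using \<delta> by simp
        also have "\<dots> \<le> r * K" using False r(1) by (intro mult_left_mono) auto
        finally show ?thesis using h r(3) by linarith
      qed
      have "norm \<delta> * norm z \<le> 1 * K" using \<delta> False r by (intro mult_mono) auto
      then have "\<bar>g'' ?a - g'' \<xi>\<bar> < e"
        using \<xi>(1) h a False K(1) hd by (intro d(2)) auto
      then have "\<bar>g'' ?a - g'' \<xi>\<bar> * (norm z)\<^sup>2 \<le> e * (norm z)\<^sup>2" by (intro mult_right_mono) auto
      then show ?thesis using False by (simp add: W_def)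
    qed
    finally show ?thesis by (simp add: mult_left_mono)
  qed
  show ?thesis using that[OF r(1) Wm Wint Wsmall main] by blast
qed

context location_scale_info
begin

lemma avg_sum: "avg (\<lambda>z. \<Sum>i\<in>I. \<phi> i z) n \<omega> = (\<Sum>i\<in>I. avg (\<phi> i) n \<omega>)"
  unfolding avg_def by (subst sum.swap) (simp add: sum_divide_distrib)

lemma psi_measurable[measurable]: "\<psi> \<in> borel_measurable borel"
  unfolding \<psi>_def[abs_def] by measurable

lemma hessian_integrable: "integrable D (\<lambda>z. g'' (q \<bullet> z) * (u \<bullet> z) * (v \<bullet> z))"
proof (rule Bochner_Integration.integrable_bound)
  show "integrable D (\<lambda>z. B * norm u * norm v * (norm z)\<^sup>2)" using sq_integrable by simp
  show "AE z in D. norm (g'' (q \<bullet> z) * (u \<bullet> z) * (v \<bullet> z)) \<le> norm (B * norm u * norm v * (norm z)\<^sup>2)"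
  proof (rule AE_I2)
    fix z
    have "\<bar>g'' (q \<bullet> z)\<bar> * \<bar>u \<bullet> z\<bar> * \<bar>v \<bullet> z\<bar> \<le> B * (norm u * norm z) * (norm v * norm z)"
      using B_nonneg by (intro mult_mono g''_bound Cauchy_Schwarz_ineq2) auto
    then show "norm (g'' (q \<bullet> z) * (u \<bullet> z) * (v \<bullet> z)) \<le> norm (B * norm u * norm v * (norm z)\<^sup>2)"
      using B_nonneg by (simp add: abs_mult power2_eq_square mult_ac)
  qed
qed (simp add: meas_D)

text \<open>By bilinearity it suffices to control the entries for pairs of basis vectors, each
  within \<open>\<tau> / N\<^sup>2\<close>. The bound holds for all \<open>u\<close> and
  \<open>v\<close> on one event, so a random \<open>u\<close> may be inserted.\<close>

lemma hessian_average:
  assumes \<tau>: "0 < \<tau>"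
  shows "whp (\<lambda>n \<omega>. \<forall>u v. \<bar>avg (\<lambda>z. g'' (q \<bullet> z) * (u \<bullet> z) * (v \<bullet> z)) n \<omega> -
     (\<integral>z. g'' (q \<bullet> z) * (u \<bullet> z) * (v \<bullet> z) \<partial>D)\<bar> \<le> \<tau> * norm u * norm v)"
proof -
  define N where "N = real DIM('b)"
  have N: "0 < N" by (simp add: N_def)
  define d where "d u v n \<omega> = avg (\<lambda>z. g'' (q \<bullet> z) * (u \<bullet> z) * (v \<bullet> z)) n \<omega> -
     (\<integral>z. g'' (q \<bullet> z) * (u \<bullet> z) * (v \<bullet> z) \<partial>D)" for u v n \<omega>
  have expand: "g'' (q \<bullet> z) * (u \<bullet> z) * (v \<bullet> z) =
      (\<Sum>a\<in>Basis. \<Sum>b\<in>Basis. (u \<bullet> a) * (v \<bullet> b) * (g'' (q \<bullet> z) * (a \<bullet> z) * (b \<bullet> z)))" for u v z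
    by (subst euclidean_inner[of u z], subst euclidean_inner[of v z])
       (simp add: sum_distrib_left sum_distrib_right inner_commute mult_ac)
  have d: "d u v n \<omega> = (\<Sum>a\<in>Basis. \<Sum>b\<in>Basis. (u \<bullet> a) * (v \<bullet> b) * d a b n \<omega>)" for u v n \<omega>
  proof -
    have "avg (\<lambda>z. g'' (q \<bullet> z) * (u \<bullet> z) * (v \<bullet> z)) n \<omega> =
      (\<Sum>a\<in>Basis. \<Sum>b\<in>Basis. (u \<bullet> a) * (v \<bullet> b) * avg (\<lambda>z. g'' (q \<bullet> z) * (a \<bullet> z) * (b \<bullet> z)) n \<omega>)"
      unfolding expand[of _ u v] avg_sum avg_cmult ..
    moreover have "(\<integral>z. g'' (q \<bullet> z) * (u \<bullet> z) * (v \<bullet> z) \<partial>D) =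
      (\<Sum>a\<in>Basis. \<Sum>b\<in>Basis. (u \<bullet> a) * (v \<bullet> b) * (\<integral>z. g'' (q \<bullet> z) * (a \<bullet> z) * (b \<bullet> z) \<partial>D))"
      unfolding expand[of _ u v] using hessian_integrable
      by (subst Bochner_Integration.integral_sum) (auto simp: Bochner_Integration.integral_sum intro!: Bochner_Integration.integrable_sum)
    ultimately show ?thesis by (simp add: d_def sum_subtractf right_diff_distrib)
  qed
  have "whp (\<lambda>n \<omega>. \<forall>a\<in>Basis. \<forall>b\<in>Basis. \<bar>d a b n \<omega>\<bar> < \<tau> / N\<^sup>2)"
    unfolding d_def using \<tau> N
    by (intro whp_ball finite_Basis weak_law_large_numbers hessian_integrable) auto
  then show ?thesis unfolding d_def[symmetric]
  proof (rule whp_mono, intro always_eventually allI ballI impI)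
    fix n \<omega> u v assume *: "\<forall>a\<in>Basis. \<forall>b\<in>Basis. \<bar>d a b n \<omega>\<bar> < \<tau> / N\<^sup>2"
    have "\<bar>d u v n \<omega>\<bar> \<le> (\<Sum>a\<in>Basis. \<Sum>b\<in>Basis. \<bar>(u \<bullet> a) * (v \<bullet> b) * d a b n \<omega>\<bar>)"
      unfolding d[of u v] by (intro order_trans[OF sum_abs] sum_mono) auto
    also have "\<dots> \<le> (\<Sum>a\<in>(Basis :: 'b set). \<Sum>b\<in>(Basis :: 'b set). norm u * norm v * (\<tau> / N\<^sup>2))"
    proof (intro sum_mono)
      fix a b :: 'b assume ab: "a \<in> Basis" "b \<in> Basis"
      then have "\<bar>u \<bullet> a\<bar> * \<bar>v \<bullet> b\<bar> * \<bar>d a b n \<omega>\<bar> \<le> norm u * norm v * (\<tau> / N\<^sup>2)"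
        using * by (intro mult_mono Basis_le_norm) (auto intro: less_imp_le)
      then show "\<bar>(u \<bullet> a) * (v \<bullet> b) * d a b n \<omega>\<bar> \<le> norm u * norm v * (\<tau> / N\<^sup>2)" by (simp add: abs_mult)
    qed
    also have "\<dots> = \<tau> * norm u * norm v"
      using N by (simp add: N_def[symmetric] power2_eq_square)
    finally show "\<bar>d u v n \<omega>\<bar> \<le> \<tau> * norm u * norm v" .
  qed
qed

text \<open>The error is relative to \<open>norm \<delta>\<close> and uniform in \<open>v\<close>,
  so that later \<open>v\<close> may be \<open>\<delta>\<close> itself. A quarter of
  \<open>\<tau>\<close> goes to the second-order part of
  \<open>1 / (1 - \<delta> \<bullet> q)\<close>, a quarter to the fluctuation of the empirical
  Hessian, and half to the Taylor remainder of \<open>g'\<close>.\<close>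

lemma score_expansion:
  assumes score: "whp (\<lambda>n \<omega>. \<forall>v. (v \<bullet> q) / (1 - \<delta> n \<omega> \<bullet> q) + avg (\<lambda>z. g' ((q - \<delta> n \<omega>) \<bullet> z) * (v \<bullet> z)) n \<omega> = 0)"
    and small: "\<And>r. 0 < r \<Longrightarrow> whp (\<lambda>n \<omega>. norm (\<delta> n \<omega>) < r)"
    and \<tau>: "0 < \<tau>"
  shows "whp (\<lambda>n \<omega>. \<forall>v. \<bar>v \<bullet> J (\<delta> n \<omega>) - avg (\<lambda>z. v \<bullet> \<psi> z) n \<omega>\<bar> \<le> \<tau> * norm v * norm (\<delta> n \<omega>))"
proof -
  have \<tau>4: "0 < \<tau> / 4" using \<tau> by simp
  obtain r W where rW: "0 < r" and Wm: "W \<in> borel_measurable borel" and Wint: "integrable D W"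
    and Wsmall: "(\<integral>z. W z \<partial>D) < \<tau> / 4"
    and W: "\<And>\<delta> z. norm \<delta> < r \<Longrightarrow>
      \<bar>g' ((q - \<delta>) \<bullet> z) - g' (q \<bullet> z) + g'' (q \<bullet> z) * (\<delta> \<bullet> z)\<bar> * norm z \<le> norm \<delta> * W z"
    using taylor_remainder[OF \<tau>4] by blast
  \<comment> \<open>With \<open>\<kappa> = \<delta> \<bullet> q\<close>, the entry
    \<open>1 / 2\<close> keeps \<open>1 - \<kappa>\<close> above \<open>1 / 2\<close>, and
    \<open>\<tau> / 8\<close> then bounds \<open>\<kappa>\<^sup>2 / (1 - \<kappa>)\<close> by
    \<open>\<tau> / 4 * norm \<delta>\<close>.\<close>
  define \<rho> where "\<rho> = min r (min (1 / 2) (\<tau> / 8))"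
  have \<rho>: "0 < \<rho>" using rW \<tau> by (simp add: \<rho>_def)
  have "whp (\<lambda>n \<omega>. \<bar>avg W n \<omega> - (\<integral>z. W z \<partial>D)\<bar> < \<tau> / 4)"
    by (rule weak_law_large_numbers[OF Wm Wint]) (use \<tau> in simp)
  from whp_conj[OF whp_conj[OF score small[OF \<rho>]] whp_conj[OF this hessian_average[OF \<tau>4]]]
  show ?thesis
  proof (rule whp_mono, goal_cases)
    case 1
    show ?case using eventually_gt_at_top[of 0]
    proof (eventually_elim, intro ballI impI allI, elim conjE)
      fix n :: nat and \<omega> v
      let ?\<delta> = "\<delta> n \<omega>"
      let ?\<kappa> = "?\<delta> \<bullet> q"
      assume n: "0 < n"
        and sc: "\<forall>v. (v \<bullet> q) / (1 - ?\<kappa>) + avg (\<lambda>z. g' ((q - ?\<delta>) \<bullet> z) * (v \<bullet> z)) n \<omega> = 0"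
        and sm: "norm ?\<delta> < \<rho>"
        and aW: "\<bar>avg W n \<omega> - (\<integral>z. W z \<partial>D)\<bar> < \<tau> / 4"
        and hess: "\<forall>u v. \<bar>avg (\<lambda>z. g'' (q \<bullet> z) * (u \<bullet> z) * (v \<bullet> z)) n \<omega> -
            (\<integral>z. g'' (q \<bullet> z) * (u \<bullet> z) * (v \<bullet> z) \<partial>D)\<bar> \<le> \<tau> / 4 * norm u * norm v"
      define rem where "rem z = g' ((q - ?\<delta>) \<bullet> z) - g' (q \<bullet> z) + g'' (q \<bullet> z) * (?\<delta> \<bullet> z)" for z
      define H where "H = avg (\<lambda>z. g'' (q \<bullet> z) * (?\<delta> \<bullet> z) * (v \<bullet> z)) n \<omega>"
      define E where "E = (\<integral>z. g'' (q \<bullet> z) * (?\<delta> \<bullet> z) * (v \<bullet> z) \<partial>D)"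
      define G where "G = avg (\<lambda>z. g' (q \<bullet> z) * (v \<bullet> z)) n \<omega>"
      define Rm where "Rm = avg (\<lambda>z. rem z * (v \<bullet> z)) n \<omega>"
      have split: "avg (\<lambda>z. g' ((q - ?\<delta>) \<bullet> z) * (v \<bullet> z)) n \<omega> =
         avg (\<lambda>z. (g' (q \<bullet> z) * (v \<bullet> z) - g'' (q \<bullet> z) * (?\<delta> \<bullet> z) * (v \<bullet> z)) + rem z * (v \<bullet> z)) n \<omega>"
        by (rule arg_cong[of _ _ "\<lambda>\<phi>. avg \<phi> n \<omega>"]) (auto simp: rem_def algebra_simps)
      have 1: "(v \<bullet> q) / (1 - ?\<kappa>) + (G - H + Rm) = 0"
        using spec[OF sc, of v] unfolding split avg_add avg_diff G_def H_def Rm_def .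
      have "avg (\<lambda>z. v \<bullet> \<psi> z) n \<omega> = avg (\<lambda>z. - (v \<bullet> q) - g' (q \<bullet> z) * (v \<bullet> z)) n \<omega>"
        by (simp add: \<psi>_def inner_diff_right)
      then have 2: "avg (\<lambda>z. v \<bullet> \<psi> z) n \<omega> = - (v \<bullet> q) - G"
        using n by (simp only: avg_diff avg_const G_def)
      have \<kappa>: "\<bar>?\<kappa>\<bar> \<le> norm ?\<delta>" using Cauchy_Schwarz_ineq2[of ?\<delta> q] norm_q by simp
      then have half: "\<bar>?\<kappa>\<bar> < 1 / 2" using sm by (simp add: \<rho>_def)
      have id: "?\<kappa> * (v \<bullet> q) + v \<bullet> q - (v \<bullet> q) / (1 - ?\<kappa>) = - ((v \<bullet> q) * (?\<kappa>\<^sup>2 / (1 - ?\<kappa>)))"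
        using half by (simp add: field_simps power2_eq_square)
      have "v \<bullet> J ?\<delta> - avg (\<lambda>z. v \<bullet> \<psi> z) n \<omega> = (?\<kappa> * (v \<bullet> q) + v \<bullet> q - (v \<bullet> q) / (1 - ?\<kappa>)) + (H - E) - Rm"
        using 1 unfolding 2 J_hessian E_def[symmetric] by linarith
      then have "v \<bullet> J ?\<delta> - avg (\<lambda>z. v \<bullet> \<psi> z) n \<omega> = - ((v \<bullet> q) * (?\<kappa>\<^sup>2 / (1 - ?\<kappa>))) + (H - E) - Rm"
        unfolding id .
      then have tri: "\<bar>v \<bullet> J ?\<delta> - avg (\<lambda>z. v \<bullet> \<psi> z) n \<omega>\<bar> \<le> \<bar>(v \<bullet> q) * (?\<kappa>\<^sup>2 / (1 - ?\<kappa>))\<bar> + \<bar>H - E\<bar> + \<bar>Rm\<bar>"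
        by linarith
      have T1: "\<bar>(v \<bullet> q) * (?\<kappa>\<^sup>2 / (1 - ?\<kappa>))\<bar> \<le> \<tau> / 4 * norm v * norm ?\<delta>"
      proof -
        have "?\<kappa>\<^sup>2 / (1 - ?\<kappa>) \<le> ?\<kappa>\<^sup>2 / (1 / 2)"
          using half by (intro divide_left_mono) auto
        also have "?\<kappa>\<^sup>2 = \<bar>?\<kappa>\<bar> * \<bar>?\<kappa>\<bar>" by (simp add: power2_eq_square)
        also have "\<dots> \<le> (\<tau> / 8) * norm ?\<delta>"
          using \<kappa> sm \<tau> by (intro mult_mono) (auto simp: \<rho>_def)
        finally have "?\<kappa>\<^sup>2 / (1 - ?\<kappa>) \<le> \<tau> / 4 * norm ?\<delta>" by (simp add: power2_eq_square)
        moreover have "\<bar>v \<bullet> q\<bar> \<le> norm v" using Cauchy_Schwarz_ineq2[of v q] norm_q by simp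
        moreover have "0 \<le> ?\<kappa>\<^sup>2 / (1 - ?\<kappa>)" using half by simp
        ultimately have "\<bar>v \<bullet> q\<bar> * (?\<kappa>\<^sup>2 / (1 - ?\<kappa>)) \<le> norm v * (\<tau> / 4 * norm ?\<delta>)"
          by (intro mult_mono) auto
        then show ?thesis unfolding abs_mult abs_of_nonneg[OF \<open>0 \<le> ?\<kappa>\<^sup>2 / (1 - ?\<kappa>)\<close>] by (simp only: mult_ac)
      qed
      have T2: "\<bar>H - E\<bar> \<le> \<tau> / 4 * norm v * norm ?\<delta>"
      proof -
        have "\<bar>H - E\<bar> \<le> \<tau> / 4 * norm ?\<delta> * norm v" unfolding H_def E_def by (rule hess[rule_format])
        then show ?thesis by (simp only: mult_ac)
      qed
      have T3: "\<bar>Rm\<bar> \<le> \<tau> / 2 * norm v * norm ?\<delta>"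
      proof -
        have "\<bar>Rm\<bar> \<le> avg (\<lambda>z. (norm v * norm ?\<delta>) * W z) n \<omega>"
          unfolding Rm_def
        proof (rule abs_avg_le)
          fix z
          have "\<bar>rem z * (v \<bullet> z)\<bar> \<le> \<bar>rem z\<bar> * (norm v * norm z)"
            unfolding abs_mult by (intro mult_left_mono Cauchy_Schwarz_ineq2) auto
          also have "\<dots> = norm v * (\<bar>rem z\<bar> * norm z)" by simp
          also have "\<dots> \<le> norm v * (norm ?\<delta> * W z)"
            unfolding rem_def using sm by (intro mult_left_mono W) (auto simp: \<rho>_def)
          finally show "\<bar>rem z * (v \<bullet> z)\<bar> \<le> norm v * norm ?\<delta> * W z" by simp
        qed
        also have "\<dots> = (norm v * norm ?\<delta>) * avg W n \<omega>" by (rule avg_cmult)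
        also have "\<dots> \<le> (norm v * norm ?\<delta>) * (\<tau> / 2)"
        proof (intro mult_left_mono)
          show "avg W n \<omega> \<le> \<tau> / 2" using aW Wsmall by linarith
        qed auto
        finally show ?thesis by (simp add: mult_ac)
      qed
      show "\<bar>v \<bullet> J ?\<delta> - avg (\<lambda>z. v \<bullet> \<psi> z) n \<omega>\<bar> \<le> \<tau> * norm v * norm ?\<delta>"
        using tri T1 T2 T3 by (simp add: algebra_simps)
    qed
  qed
qed

lemma inner_psi_measurable: "(\<lambda>z. v \<bullet> \<psi> z) \<in> borel_measurable borel"
  by measurable

lemma hp_sum_finite:
  assumes "finite I" "\<And>i \<epsilon>. i \<in> I \<Longrightarrow> 0 < \<epsilon> \<Longrightarrow> \<exists>K>0. hp \<epsilon> (\<lambda>n \<omega>. X i n \<omega> < K)" "0 < \<epsilon>"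
  shows "\<exists>K>0. hp \<epsilon> (\<lambda>n \<omega>. (\<Sum>i\<in>I. X i n \<omega>) < (K :: real))"
  using assms(1,2,3)
proof (induction I arbitrary: \<epsilon> rule: finite_induct)
  case empty
  then show ?case using whp_True unfolding whp_def by (auto intro!: exI[of _ 1] elim!: hp_mono)
next
  case (insert i I)
  obtain K1 where K1: "0 < K1" "hp (\<epsilon> / 2) (\<lambda>n \<omega>. X i n \<omega> < K1)"
    using insert.prems(1)[of i "\<epsilon> / 2"] insert.prems(2) by auto
  obtain K2 where K2: "0 < K2" "hp (\<epsilon> / 2) (\<lambda>n \<omega>. (\<Sum>i\<in>I. X i n \<omega>) < K2)"
    using insert.IH[of "\<epsilon> / 2"] insert.prems by auto
  have "hp (\<epsilon> / 2 + \<epsilon> / 2) (\<lambda>n \<omega>. (\<Sum>i\<in>insert i I. X i n \<omega>) < K1 + K2)"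
    by (rule hp_mono[OF hp_conj[OF K1(2) K2(2)]]) (use insert.hyps in \<open>auto intro!: always_eventually\<close>)
  then show ?case using K1 K2 by (intro exI[of _ "K1 + K2"]) auto
qed

text \<open>Taking \<open>v = \<delta>\<close> and \<open>\<tau> = l / 2\<close> in the expansion,
  coercivity absorbs the error: \<open>l / 2 * norm \<delta>\<close> is at most the sum of the
  absolute coordinates of the averaged score, which is of order \<open>1 / sqrt n\<close>.\<close>

lemma root_n_bounded:
  assumes exp: "\<And>\<tau>. 0 < \<tau> \<Longrightarrow>
      whp (\<lambda>n \<omega>. \<forall>v. \<bar>v \<bullet> J (\<delta> n \<omega>) - avg (\<lambda>z. v \<bullet> \<psi> z) n \<omega>\<bar> \<le> \<tau> * norm v * norm (\<delta> n \<omega>))"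
    and \<epsilon>: "0 < \<epsilon>"
  shows "\<exists>K>0. hp \<epsilon> (\<lambda>n \<omega>. sqrt n * norm (\<delta> n \<omega>) < K)"
proof -
  have "\<exists>K>0. hp (\<epsilon> / 2) (\<lambda>n \<omega>. (\<Sum>b\<in>Basis. \<bar>sqrt n * avg (\<lambda>z. b \<bullet> \<psi> z) n \<omega>\<bar>) < K)"
  proof (rule hp_sum_finite)
    show "\<exists>K>0. hp \<epsilon> (\<lambda>n \<omega>. \<bar>sqrt n * avg (\<lambda>z. b \<bullet> \<psi> z) n \<omega>\<bar> < K)" if "0 < \<epsilon>" for b \<epsilon>
      by (rule hp_sum_bounded[OF inner_psi_measurable score_variance(1) score_mean that])
  qed (use \<epsilon> in auto)
  then obtain K where K: "0 < K"
    "hp (\<epsilon> / 2) (\<lambda>n \<omega>. (\<Sum>b\<in>Basis. \<bar>sqrt n * avg (\<lambda>z. b \<bullet> \<psi> z) n \<omega>\<bar>) < K)" by blast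
  have h: "hp (\<epsilon> / 2) (\<lambda>n \<omega>. \<forall>v. \<bar>v \<bullet> J (\<delta> n \<omega>) - avg (\<lambda>z. v \<bullet> \<psi> z) n \<omega>\<bar> \<le> l / 2 * norm v * norm (\<delta> n \<omega>))"
    using exp[of "l / 2"] J_coercive(1) \<epsilon> unfolding whp_def by simp
  have "hp (\<epsilon> / 2 + \<epsilon> / 2) (\<lambda>n \<omega>. sqrt n * norm (\<delta> n \<omega>) < 2 / l * K)"
  proof (rule hp_mono[OF hp_conj[OF K(2) h]], intro always_eventually allI ballI impI, elim conjE)
    fix n \<omega>
    let ?\<delta> = "\<delta> n \<omega>"
    let ?S = "\<Sum>b\<in>Basis. \<bar>avg (\<lambda>z. b \<bullet> \<psi> z) n \<omega>\<bar>"
    assume *: "(\<Sum>b\<in>Basis. \<bar>sqrt n * avg (\<lambda>z. b \<bullet> \<psi> z) n \<omega>\<bar>) < K"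
      and **: "\<forall>v. \<bar>v \<bullet> J ?\<delta> - avg (\<lambda>z. v \<bullet> \<psi> z) n \<omega>\<bar> \<le> l / 2 * norm v * norm ?\<delta>"
    have "avg (\<lambda>z. ?\<delta> \<bullet> \<psi> z) n \<omega> = (\<Sum>b\<in>Basis. (?\<delta> \<bullet> b) * avg (\<lambda>z. b \<bullet> \<psi> z) n \<omega>)"
      by (subst euclidean_inner) (simp only: avg_sum avg_cmult inner_commute[of "\<psi> _"])
    also have "\<dots> \<le> (\<Sum>b\<in>Basis. norm ?\<delta> * \<bar>avg (\<lambda>z. b \<bullet> \<psi> z) n \<omega>\<bar>)"
    proof (rule sum_mono)
      fix b :: 'b assume "b \<in> Basis"
      then have "\<bar>?\<delta> \<bullet> b\<bar> * \<bar>avg (\<lambda>z. b \<bullet> \<psi> z) n \<omega>\<bar> \<le> norm ?\<delta> * \<bar>avg (\<lambda>z. b \<bullet> \<psi> z) n \<omega>\<bar>"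
        by (intro mult_right_mono Basis_le_norm) auto
      then show "(?\<delta> \<bullet> b) * avg (\<lambda>z. b \<bullet> \<psi> z) n \<omega> \<le> norm ?\<delta> * \<bar>avg (\<lambda>z. b \<bullet> \<psi> z) n \<omega>\<bar>"
        using abs_ge_self[of "(?\<delta> \<bullet> b) * avg (\<lambda>z. b \<bullet> \<psi> z) n \<omega>"] by (simp add: abs_mult)
    qed
    finally have up: "avg (\<lambda>z. ?\<delta> \<bullet> \<psi> z) n \<omega> \<le> norm ?\<delta> * ?S" by (simp add: sum_distrib_left)
    have "l * (norm ?\<delta>)\<^sup>2 \<le> norm ?\<delta> * ?S + l / 2 * (norm ?\<delta>)\<^sup>2"
      using J_coercive(2)[of ?\<delta>] spec[OF **, of ?\<delta>] up unfolding power2_eq_square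
      by (simp only: mult.assoc)
    then have "norm ?\<delta> * (l / 2 * norm ?\<delta>) \<le> norm ?\<delta> * ?S" by (simp add: power2_eq_square algebra_simps)
    then have "l / 2 * norm ?\<delta> \<le> ?S"
      by (cases "?\<delta> = 0") (auto simp: sum_nonneg)
    then have "sqrt n * (l / 2 * norm ?\<delta>) \<le> sqrt n * ?S" by (intro mult_left_mono) auto
    also have "\<dots> < K" using * by (simp add: abs_mult sum_distrib_left)
    finally show "sqrt n * norm ?\<delta> < 2 / l * K" using J_coercive(1) by (simp add: field_simps)
  qed
  then show ?thesis using K(1) J_coercive(1) by (intro exI[of _ "2 / l * K"]) auto
qed

text \<open>Once \<open>sqrt n * norm (\<delta> n \<omega>)\<close> is bounded with high
  probability, the relative error of the expansion becomes an arbitrarily small absolute one.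
  \<open>J\<close> may change sides because the right-hand side of \<open>J_hessian\<close> is
  symmetric.\<close>

lemma asymptotically_linear:
  assumes exp: "\<And>\<tau>. 0 < \<tau> \<Longrightarrow>
      whp (\<lambda>n \<omega>. \<forall>v. \<bar>v \<bullet> J (\<delta> n \<omega>) - avg (\<lambda>z. v \<bullet> \<psi> z) n \<omega>\<bar> \<le> \<tau> * norm v * norm (\<delta> n \<omega>))"
    and \<tau>: "0 < \<tau>"
  shows "whp (\<lambda>n \<omega>. \<bar>sqrt n * (J v \<bullet> \<delta> n \<omega>) - sqrt n * avg (\<lambda>z. v \<bullet> \<psi> z) n \<omega>\<bar> < \<tau>)"
  unfolding whp_def
proof (intro allI impI)
  fix \<epsilon> :: real assume \<epsilon>: "0 < \<epsilon>"
  obtain K where K: "0 < K" "hp (\<epsilon> / 2) (\<lambda>n \<omega>. sqrt n * norm (\<delta> n \<omega>) < K)"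
    using root_n_bounded[OF exp, of "\<epsilon> / 2"] \<epsilon> by auto
  define \<tau>' where "\<tau>' = \<tau> / (2 * K * (norm v + 1))"
  have \<tau>': "0 < \<tau>'" "\<tau>' * norm v * K < \<tau>"
  proof -
    have p: "0 < K * (norm v + 1)" using K(1) by (intro mult_pos_pos) (auto simp: add_nonneg_pos)
    then show "0 < \<tau>'" using \<tau> by (simp add: \<tau>'_def)
    have "\<tau>' * norm v * K \<le> \<tau>' * (K * (norm v + 1))" using \<open>0 < \<tau>'\<close> K(1) by (simp add: algebra_simps)
    also have "\<dots> = \<tau> / 2" using p unfolding \<tau>'_def by (simp add: field_simps)
    finally show "\<tau>' * norm v * K < \<tau>" using \<tau> by simp
  qed
  have sym: "J v \<bullet> u = v \<bullet> J u" for u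
    unfolding J_hessian inner_commute[of "J v" u] by (simp add: mult_ac)
  have h: "hp (\<epsilon> / 2) (\<lambda>n \<omega>. \<forall>v. \<bar>v \<bullet> J (\<delta> n \<omega>) - avg (\<lambda>z. v \<bullet> \<psi> z) n \<omega>\<bar> \<le> \<tau>' * norm v * norm (\<delta> n \<omega>))"
    using exp[OF \<tau>'(1)] \<epsilon> unfolding whp_def by simp
  have "hp (\<epsilon> / 2 + \<epsilon> / 2) (\<lambda>n \<omega>. \<bar>sqrt n * (J v \<bullet> \<delta> n \<omega>) - sqrt n * avg (\<lambda>z. v \<bullet> \<psi> z) n \<omega>\<bar> < \<tau>)"
  proof (rule hp_mono[OF hp_conj[OF K(2) h]], intro always_eventually allI ballI impI, elim conjE)
    fix n \<omega>
    assume *: "sqrt n * norm (\<delta> n \<omega>) < K"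
      and **: "\<forall>v. \<bar>v \<bullet> J (\<delta> n \<omega>) - avg (\<lambda>z. v \<bullet> \<psi> z) n \<omega>\<bar> \<le> \<tau>' * norm v * norm (\<delta> n \<omega>)"
    have "\<bar>sqrt n * (J v \<bullet> \<delta> n \<omega>) - sqrt n * avg (\<lambda>z. v \<bullet> \<psi> z) n \<omega>\<bar> =
        sqrt n * \<bar>v \<bullet> J (\<delta> n \<omega>) - avg (\<lambda>z. v \<bullet> \<psi> z) n \<omega>\<bar>"
      unfolding sym by (simp add: right_diff_distrib[symmetric] abs_mult)
    also have "\<dots> \<le> sqrt n * (\<tau>' * norm v * norm (\<delta> n \<omega>))" using ** by (intro mult_left_mono) auto
    also have "\<dots> = \<tau>' * norm v * (sqrt n * norm (\<delta> n \<omega>))" by simp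
    also have "\<dots> \<le> \<tau>' * norm v * K" using * \<tau>'(1) by (intro mult_left_mono) auto
    finally show "\<bar>sqrt n * (J v \<bullet> \<delta> n \<omega>) - sqrt n * avg (\<lambda>z. v \<bullet> \<psi> z) n \<omega>\<bar> < \<tau>" using \<tau>'(2) by simp
  qed
  then show "hp \<epsilon> (\<lambda>n \<omega>. \<bar>sqrt n * (J v \<bullet> \<delta> n \<omega>) - sqrt n * avg (\<lambda>z. v \<bullet> \<psi> z) n \<omega>\<bar> < \<tau>)" by simp
qed

end

section \<open>Smooth densities with bounded log-Hessian\<close>

text \<open>The set where \<open>F\<close> is nonzero is open and negligible, hence empty. This
  upgrades almost everywhere identities between continuous functions to identities
  everywhere.\<close>

lemma continuous_AE_lborel_zero:
  fixes F :: "real \<Rightarrow> real"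
  assumes "continuous_on UNIV F" "AE t in lborel. F t = 0"
  shows "F t = 0"
proof (rule ccontr)
  assume "F t \<noteq> 0"
  have o: "open {t. F t \<noteq> 0}"
    using assms(1) by (intro open_Collect_neq continuous_on_const)
  then have "{t. F t \<noteq> 0} \<in> null_sets lborel"
    using assms(2) by (subst null_sets_def) (auto simp: AE_iff_measurable[OF _ refl])
  then have "negligible {t. F t \<noteq> 0}"
    by (simp add: negligible_iff_null_sets null_sets_completionI)
  with o have "{t. F t \<noteq> 0} = {}" using open_not_negligible by blast
  with \<open>F t \<noteq> 0\<close> show False by blast
qed

text \<open>The integration by parts used below: each information identity says that a suitable
  derivative integrates to zero.\<close>

lemma integral_derivative_zero:
  fixes F F' :: "real \<Rightarrow> real"
  assumes der: "\<And>t. (F has_real_derivative F' t) (at t)" and cont: "continuous_on UNIV F'"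
    and int: "integrable lborel F'" and top: "(F \<longlongrightarrow> 0) at_top" and bot: "(F \<longlongrightarrow> 0) at_bot"
  shows "(\<integral>t. F' t \<partial>lborel) = 0"
proof -
  have "(LBINT t=-\<infinity>..\<infinity>. F' t) = 0 - 0"
  proof (rule interval_integral_FTC_integrable)
    show "(F has_vector_derivative F' x) (at x)" for x
      using der[of x] by (simp add: has_real_derivative_iff_has_vector_derivative)
    show "isCont F' x" for x using cont by (simp add: continuous_on_eq_continuous_at)
    show "set_integrable lborel (einterval (- \<infinity>) \<infinity>) F'"
      using int by (simp add: set_integrable_def)
    show "((F \<circ> real_of_ereal) \<longlongrightarrow> 0) (at_right (- \<infinity>))"
      using bot by (simp add: ereal_tendsto_simps1)
    show "((F \<circ> real_of_ereal) \<longlongrightarrow> 0) (at_left \<infinity>)"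
      using top by (simp add: ereal_tendsto_simps1)
  qed auto
  then show ?thesis by (simp add: interval_lebesgue_integral_def set_lebesgue_integral_def)
qed

lemma integral_odd:
  fixes F :: "real \<Rightarrow> real"
  assumes "\<And>t. F (- t) = - F t"
  shows "(\<integral>t. F t \<partial>lborel) = 0"
  using lborel_integral_real_affine[of "-1" F 0] assms by simp

text \<open>The properties of \<open>f\<close> available once (A8) has made it positive and (A10)
  has bounded the second derivative of its logarithm.\<close>

locale smooth_density =
  fixes f f1 f2 :: "real \<Rightarrow> real" and \<alpha> C B :: real
  assumes pos: "\<And>t. 0 < f t" and even: "\<And>t. f (- t) = f t"
    and f_deriv: "\<And>t. (f has_real_derivative f1 t) (at t)"
    and f1_deriv: "\<And>t. (f1 has_real_derivative f2 t) (at t)"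
    and f2_cont: "continuous_on UNIV f2"
    and f_integrable: "integrable lborel f" and f_integral: "(\<integral>t. f t \<partial>lborel) = 1"
    and f_sq: "integrable lborel (\<lambda>t. t\<^sup>2 * f t)"
    and alpha: "0 < \<alpha>" and C: "0 < C" and f_upper: "\<And>t. f t \<le> C * exp (- (\<bar>t\<bar> powr \<alpha>))"
    and fisher_integrable: "integrable lborel (\<lambda>t. t\<^sup>2 * ((f1 t)\<^sup>2 / f t))"
    and fisher_pos: "0 < (\<integral>t. t\<^sup>2 * ((f1 t)\<^sup>2 / f t) \<partial>lborel)"
    and log_hessian_bound: "\<And>t. \<bar>f2 t / f t - (f1 t / f t)\<^sup>2\<bar> \<le> B"
begin

definition g :: "real \<Rightarrow> real" where "g t = ln (f t)"
definition g' :: "real \<Rightarrow> real" where "g' t = f1 t / f t"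
definition g'' :: "real \<Rightarrow> real" where "g'' t = f2 t / f t - (f1 t / f t)\<^sup>2"

lemma f_nz: "f t \<noteq> 0"
  using pos[of t] by simp

lemma f_cont: "continuous_on S f" and f1_cont: "continuous_on S f1"
  using f_deriv f1_deriv by (auto intro!: DERIV_continuous_on intro: has_field_derivative_at_within)

lemma g_deriv: "(g has_real_derivative g' t) (at t)"
  unfolding g_def[abs_def] g'_def using pos[of t] by (auto intro!: derivative_eq_intros f_deriv)

lemma g'_deriv: "(g' has_real_derivative g'' t) (at t)"
  unfolding g'_def[abs_def] g''_def using f_nz[of t]
  by (auto intro!: derivative_eq_intros f_deriv f1_deriv simp: field_simps power2_eq_square)

lemma g''_cont: "continuous_on UNIV g''"
  unfolding g''_def using f_nz by (intro continuous_intros f_cont f1_cont f2_cont) auto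

lemma g_cont: "continuous_on S g" and g'_cont: "continuous_on S g'"
  using g_deriv g'_deriv by (auto intro!: DERIV_continuous_on intro: has_field_derivative_at_within)

lemma measurable_f[measurable]: "f \<in> borel_measurable borel" "f1 \<in> borel_measurable borel"
    "f2 \<in> borel_measurable borel" "g \<in> borel_measurable borel" "g' \<in> borel_measurable borel"
    "g'' \<in> borel_measurable borel"
  using f_cont[of UNIV] f1_cont[of UNIV] f2_cont g_cont[of UNIV] g'_cont[of UNIV] g''_cont
  by (auto intro: borel_measurable_continuous_onI)

lemma g''_bound: "\<bar>g'' t\<bar> \<le> B"
  unfolding g''_def by (rule log_hessian_bound)

lemma B_nonneg: "0 \<le> B"
  using g''_bound[of 0] by simp

lemma f1_odd: "f1 (- t) = - f1 t"
proof -
  have "((\<lambda>t. f (- t)) has_real_derivative - f1 (- t)) (at t)"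
    using f_deriv[of "- t"] by (simp add: DERIV_mirror)
  then have "(f has_real_derivative - f1 (- t)) (at t)" by (simp add: even)
  from DERIV_unique[OF this f_deriv] show ?thesis by simp
qed

lemma f2_even: "f2 (- t) = f2 t"
proof -
  have "((\<lambda>t. f1 (- t)) has_real_derivative - f2 (- t)) (at t)"
    using f1_deriv[of "- t"] by (simp add: DERIV_mirror)
  moreover have "((\<lambda>t. f1 (- t)) has_real_derivative - f2 t) (at t)"
    unfolding f1_odd by (intro derivative_intros f1_deriv)
  ultimately show ?thesis using DERIV_unique by fastforce
qed

lemma g'_odd: "g' (- t) = - g' t" and g''_even: "g'' (- t) = g'' t"
  by (simp_all add: g'_def g''_def f1_odd f2_even even)

text \<open>\<open>g'\<close> is odd, so it vanishes at 0, and its derivative is bounded by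
  \<open>B\<close>.\<close>

lemma g'_bound: "\<bar>g' t\<bar> \<le> B * \<bar>t\<bar>"
proof -
  have 0: "g' 0 = 0" using g'_odd[of 0] by simp
  have "\<bar>g' t\<bar> \<le> B * \<bar>t\<bar>" if t: "0 < t" for t
  proof -
    obtain \<xi> where "g' t - g' 0 = (t - 0) * g'' \<xi>"
      using MVT2[OF t, of g' g''] g'_deriv by auto
    then have "\<bar>g' t\<bar> = \<bar>g'' \<xi>\<bar> * \<bar>t\<bar>" using 0 by (simp add: abs_mult)
    then show ?thesis using g''_bound[of \<xi>] by (simp add: mult_right_mono)
  qed
  from this[of t] this[of "- t"] show ?thesis
    by (cases t "0 :: real" rule: linorder_cases) (auto simp: 0 g'_odd)
qed

lemma f1_eq: "f1 t = g' t * f t" and f2_eq: "f2 t = (g'' t + (g' t)\<^sup>2) * f t"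
  using f_nz[of t] by (simp_all add: g'_def g''_def)

lemma f2_eq': "f2 t = g'' t * f t + (g' t)\<^sup>2 * f t"
  using f2_eq[of t] by (simp add: distrib_right)

lemma fisher_eq: "(f1 t)\<^sup>2 / f t = (g' t)\<^sup>2 * f t"
  using f_nz[of t] by (simp add: f1_eq power2_eq_square)

text \<open>Capping the exponent at 1 costs only an additive constant, which is absorbed in
  \<open>A\<close>.\<close>

lemma g_upper: "\<exists>A. \<forall>t. g t \<le> A - \<bar>t\<bar> powr (min \<alpha> 1)"
proof (intro exI allI)
  fix t
  have "f t \<le> C * exp (- (\<bar>t\<bar> powr \<alpha>))" by (rule f_upper)
  then have "g t \<le> ln C - \<bar>t\<bar> powr \<alpha>"
    unfolding g_def using pos[of t] C by (subst (asm) ln_le_cancel_iff[symmetric]) (auto simp: ln_mult)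
  moreover have "\<bar>t\<bar> powr (min \<alpha> 1) \<le> \<bar>t\<bar> powr \<alpha> + 1"
  proof (cases "\<bar>t\<bar> \<le> 1")
    case True
    then have "\<bar>t\<bar> powr (min \<alpha> 1) \<le> 1 powr (min \<alpha> 1)" using alpha by (intro powr_mono2) auto
    then show ?thesis by (simp add: add_increasing)
  next
    case False
    then have "\<bar>t\<bar> powr (min \<alpha> 1) \<le> \<bar>t\<bar> powr \<alpha>" by (intro powr_mono) auto
    then show ?thesis by simp
  qed
  ultimately show "g t \<le> (ln C + 1) - \<bar>t\<bar> powr (min \<alpha> 1)" by simp
qed

lemma power_f_vanishes: "((\<lambda>t. \<bar>t\<bar> ^ k * f t) \<longlongrightarrow> 0) at_top" "((\<lambda>t. \<bar>t\<bar> ^ k * f t) \<longlongrightarrow> 0) at_bot"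
proof -
  show 1: "((\<lambda>t. \<bar>t\<bar> ^ k * f t) \<longlongrightarrow> 0) at_top"
  proof (rule tendsto_sandwich[of "\<lambda>_. 0"])
    show "((\<lambda>t. t ^ k * (C * exp (- (t powr \<alpha>)))) \<longlongrightarrow> 0) at_top"
      using alpha C by real_asymp
    show "\<forall>\<^sub>F t in at_top. \<bar>t\<bar> ^ k * f t \<le> t ^ k * (C * exp (- (t powr \<alpha>)))"
      using eventually_gt_at_top[of 0]
    proof eventually_elim
      case (elim t)
      then show ?case using f_upper[of t] by (auto intro!: mult_left_mono)
    qed
    show "\<forall>\<^sub>F t in at_top. 0 \<le> \<bar>t\<bar> ^ k * f t"
      using pos by (intro always_eventually allI mult_nonneg_nonneg) (auto intro: less_imp_le)
  qed auto
  then show "((\<lambda>t. \<bar>t\<bar> ^ k * f t) \<longlongrightarrow> 0) at_bot"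
    unfolding filterlim_at_bot_mirror by (simp add: even)
qed

text \<open>The boundary terms in the integrations by parts are bounded by powers of
  \<open>\<bar>t\<bar>\<close> times \<open>f\<close>, which (A4) sends to zero.\<close>

lemma vanishes:
  assumes "\<And>t. \<bar>F t\<bar> \<le> c * (\<bar>t\<bar> ^ k * f t) + d * (\<bar>t\<bar> ^ l * f t)"
  shows "(F \<longlongrightarrow> 0) at_top" "(F \<longlongrightarrow> 0) at_bot"
proof -
  have *: "((\<lambda>t. c * (\<bar>t\<bar> ^ k * f t) + d * (\<bar>t\<bar> ^ l * f t)) \<longlongrightarrow> c * 0 + d * 0) at_top"
    "((\<lambda>t. c * (\<bar>t\<bar> ^ k * f t) + d * (\<bar>t\<bar> ^ l * f t)) \<longlongrightarrow> c * 0 + d * 0) at_bot"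
    by (intro tendsto_intros power_f_vanishes)+
  show "(F \<longlongrightarrow> 0) at_top" "(F \<longlongrightarrow> 0) at_bot"
  proof -
    have le: "\<forall>t. norm (F t) \<le> c * (\<bar>t\<bar> ^ k * f t) + d * (\<bar>t\<bar> ^ l * f t)" using assms by simp
    show "(F \<longlongrightarrow> 0) at_top" "(F \<longlongrightarrow> 0) at_bot"
      using Lim_null_comparison[OF always_eventually[OF le]] * by simp_all
  qed
qed

text \<open>The dominating functions are those with assumed integrability. The last one handles
  \<open>t\<^sup>2 * (g' t)\<^sup>2 * f t\<close>, which the linear bound on \<open>g'\<close> would
  compare with a fourth moment.\<close>

lemma integrable_dominated:
  assumes [measurable]: "F \<in> borel_measurable borel"
    and "\<And>t. \<bar>F t\<bar> \<le> c * f t + d * (t\<^sup>2 * f t) + e * (t\<^sup>2 * ((f1 t)\<^sup>2 / f t))"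
  shows "integrable lborel F"
proof (rule Bochner_Integration.integrable_bound)
  show "integrable lborel (\<lambda>t. c * f t + d * (t\<^sup>2 * f t) + e * (t\<^sup>2 * ((f1 t)\<^sup>2 / f t)))"
    by (intro Bochner_Integration.integrable_add integrable_mult_right f_integrable f_sq fisher_integrable)
  show "AE t in lborel. norm (F t) \<le> norm (c * f t + d * (t\<^sup>2 * f t) + e * (t\<^sup>2 * ((f1 t)\<^sup>2 / f t)))"
    unfolding real_norm_def by (intro AE_I2 order_trans[OF assms(2) abs_ge_self])
qed simp

lemma abs_le_one_plus_sq: "\<bar>t :: real\<bar> \<le> 1 + t\<^sup>2"
  using sum_squares_bound[of "\<bar>t\<bar>" 1] by (simp add: add_increasing2)

lemma g'_sq_bound: "(g' t)\<^sup>2 \<le> B\<^sup>2 * t\<^sup>2"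
  using power_mono[OF g'_bound[of t], of 2] by (simp add: power_mult_distrib)

lemma g_quadratic: "\<bar>g t - g 0\<bar> \<le> B * t\<^sup>2"
proof -
  have "\<bar>g t - g 0\<bar> \<le> B * t\<^sup>2" if tp: "0 < t" for t
  proof -
    obtain \<xi> where \<xi>: "0 < \<xi>" "\<xi> < t" "g t - g 0 = (t - 0) * g' \<xi>"
      using MVT2[OF tp, of g g'] g_deriv by auto
    have "\<bar>g' \<xi>\<bar> \<le> B * \<bar>\<xi>\<bar>" by (rule g'_bound)
    also have "\<dots> \<le> B * t" using \<xi> B_nonneg by (intro mult_left_mono) auto
    finally have "t * \<bar>g' \<xi>\<bar> \<le> t * (B * t)" using tp by (intro mult_left_mono) auto
    then show ?thesis using \<xi>(3) tp by (simp add: abs_mult power2_eq_square mult_ac)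
  qed
  from this[of t] this[of "- t"] show ?thesis
    by (cases t "0 :: real" rule: linorder_cases) (auto simp: g_def even)
qed

lemma integrable_f_moments:
  "integrable lborel (\<lambda>t. t * f t)"
  "integrable lborel (\<lambda>t. g' t * f t)"
  "integrable lborel (\<lambda>t. t * g' t * f t)"
  "integrable lborel (\<lambda>t. (g' t)\<^sup>2 * f t)"
  "integrable lborel (\<lambda>t. t * (g' t)\<^sup>2 * f t)"
  "integrable lborel (\<lambda>t. t\<^sup>2 * (g' t)\<^sup>2 * f t)"
  "integrable lborel (\<lambda>t. g'' t * f t)"
  "integrable lborel (\<lambda>t. t * g'' t * f t)"
  "integrable lborel (\<lambda>t. t\<^sup>2 * g'' t * f t)"
proof -
  note b = less_imp_le[OF pos]
  have bound: "\<bar>k * f t\<bar> \<le> c * f t + d * (t\<^sup>2 * f t) + e * (t\<^sup>2 * ((f1 t)\<^sup>2 / f t))"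
    if "\<bar>k\<bar> \<le> c + d * t\<^sup>2 + e * (t\<^sup>2 * (g' t)\<^sup>2)" for k c d e t
  proof -
    have "\<bar>k * f t\<bar> \<le> (c + d * t\<^sup>2 + e * (t\<^sup>2 * (g' t)\<^sup>2)) * f t"
      unfolding abs_mult using that b[of t] by (intro mult_mono) auto
    then show ?thesis unfolding fisher_eq by (simp add: algebra_simps)
  qed
  have 2: "\<bar>t * x\<bar> \<le> c + c * t\<^sup>2" if "\<bar>x\<bar> \<le> c" for t x c :: real
  proof -
    have "\<bar>t\<bar> * \<bar>x\<bar> \<le> (1 + t\<^sup>2) * c" using that abs_le_one_plus_sq[of t] by (intro mult_mono) auto
    then show ?thesis by (simp add: abs_mult algebra_simps)
  qed
  show "integrable lborel (\<lambda>t. t * f t)"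
    by (rule integrable_dominated[of _ 1 1 0], measurable, rule bound) (use abs_le_one_plus_sq in simp)
  show "integrable lborel (\<lambda>t. g' t * f t)"
  proof (rule integrable_dominated[of _ B B 0], measurable, rule bound)
    fix t show "\<bar>g' t\<bar> \<le> B + B * t\<^sup>2 + 0 * (t\<^sup>2 * (g' t)\<^sup>2)"
      using g'_bound[of t] mult_left_mono[OF abs_le_one_plus_sq[of t] B_nonneg] by (simp add: algebra_simps)
  qed
  show "integrable lborel (\<lambda>t. t * g' t * f t)"
  proof (rule integrable_dominated[of _ 0 B 0], measurable, rule bound)
    fix t show "\<bar>t * g' t\<bar> \<le> 0 + B * t\<^sup>2 + 0 * (t\<^sup>2 * (g' t)\<^sup>2)"
      using mult_left_mono[OF g'_bound[of t] abs_ge_zero[of t]]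
      by (simp add: abs_mult power2_eq_square mult_ac)
  qed
  show "integrable lborel (\<lambda>t. (g' t)\<^sup>2 * f t)"
    by (rule integrable_dominated[of _ 0 "B\<^sup>2" 0], measurable, rule bound) (use g'_sq_bound in simp)
  show "integrable lborel (\<lambda>t. t * (g' t)\<^sup>2 * f t)"
  proof (rule integrable_dominated[of _ 0 "B\<^sup>2" 1], measurable, rule bound)
    fix t
    have "\<bar>t\<bar> * (g' t)\<^sup>2 \<le> (1 + t\<^sup>2) * (g' t)\<^sup>2" by (intro mult_right_mono abs_le_one_plus_sq) auto
    then show "\<bar>t * (g' t)\<^sup>2\<bar> \<le> 0 + B\<^sup>2 * t\<^sup>2 + 1 * (t\<^sup>2 * (g' t)\<^sup>2)"
      using g'_sq_bound[of t] by (simp add: abs_mult algebra_simps)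
  qed
  show "integrable lborel (\<lambda>t. t\<^sup>2 * (g' t)\<^sup>2 * f t)"
    by (rule integrable_dominated[of _ 0 0 1], measurable, rule bound) simp
  show "integrable lborel (\<lambda>t. g'' t * f t)"
    by (rule integrable_dominated[of _ B 0 0], measurable, rule bound) (use g''_bound in simp)
  show "integrable lborel (\<lambda>t. t * g'' t * f t)"
    by (rule integrable_dominated[of _ B B 0], measurable, rule bound) (use 2[OF g''_bound] in simp)
  show "integrable lborel (\<lambda>t. t\<^sup>2 * g'' t * f t)"
  proof (rule integrable_dominated[of _ 0 B 0], measurable, rule bound)
    fix t show "\<bar>t\<^sup>2 * g'' t\<bar> \<le> 0 + B * t\<^sup>2 + 0 * (t\<^sup>2 * (g' t)\<^sup>2)"
      using mult_left_mono[OF g''_bound[of t] zero_le_power2[of t]] by (simp add: abs_mult mult.commute)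
  qed
qed

section \<open>Moment identities and positivity of the information\<close>

lemma integral_odd_moments:
  "(\<integral>t. t * f t \<partial>lborel) = 0" "(\<integral>t. g' t * f t \<partial>lborel) = 0"
  "(\<integral>t. t * (g' t)\<^sup>2 * f t \<partial>lborel) = 0" "(\<integral>t. t * g'' t * f t \<partial>lborel) = 0"
  by (rule integral_odd, simp add: even g'_odd g''_even)+

text \<open>\<open>t * f t\<close> vanishes at both ends and has derivative
  \<open>f t + t * g' t * f t\<close>, while \<open>f\<close> integrates to 1.\<close>

lemma integral_score_scale: "(\<integral>t. t * g' t * f t \<partial>lborel) = - 1"
proof -
  have "(\<integral>t. f t + t * g' t * f t \<partial>lborel) = 0"
  proof (rule integral_derivative_zero[of "\<lambda>t. t * f t"])
    show "((\<lambda>t. t * f t) has_real_derivative f t + t * g' t * f t) (at t)" for t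
      by (auto intro!: derivative_eq_intros f_deriv simp: f1_eq)
    show "continuous_on UNIV (\<lambda>t. f t + t * g' t * f t)"
      by (intro continuous_intros f_cont g'_cont)
    show "integrable lborel (\<lambda>t. f t + t * g' t * f t)"
      using f_integrable integrable_f_moments(3) by simp
  qed (rule vanishes[of _ 1 1 0 0], simp add: abs_mult less_imp_le[OF pos])+
  then show ?thesis using f_integrable f_integral integrable_f_moments(3) by simp
qed

lemma f1_abs_bound: "\<bar>f1 t\<bar> \<le> B * (\<bar>t\<bar> * f t)"
proof -
  have "\<bar>f1 t\<bar> = \<bar>g' t\<bar> * f t" using pos[of t] by (simp add: f1_eq abs_mult)
  also have "\<dots> \<le> B * \<bar>t\<bar> * f t" using g'_bound[of t] pos[of t] by (intro mult_right_mono) auto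
  finally show ?thesis by simp
qed

lemma integral_hessian_location: "(\<integral>t. g'' t * f t \<partial>lborel) = - (\<integral>t. (g' t)\<^sup>2 * f t \<partial>lborel)"
proof -
  have "(\<integral>t. g'' t * f t + (g' t)\<^sup>2 * f t \<partial>lborel) = 0"
  proof (rule integral_derivative_zero[of f1])
    show "(f1 has_real_derivative g'' t * f t + (g' t)\<^sup>2 * f t) (at t)" for t
      using f1_deriv[of t] f2_eq'[of t] by simp
    show "continuous_on UNIV (\<lambda>t. g'' t * f t + (g' t)\<^sup>2 * f t)"
      by (intro continuous_intros f_cont g'_cont g''_cont)
    show "integrable lborel (\<lambda>t. g'' t * f t + (g' t)\<^sup>2 * f t)"
      using integrable_f_moments by simp
    show "(f1 \<longlongrightarrow> 0) at_top" "(f1 \<longlongrightarrow> 0) at_bot"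
      by (rule vanishes[of f1 B 1 0 0], simp add: f1_abs_bound)+
  qed
  then show ?thesis using integrable_f_moments(4,7) by simp
qed

text \<open>In the derivative of \<open>t\<^sup>2 * f1 t - 2 * (t * f t)\<close> the terms with
  \<open>f1\<close> cancel, leaving \<open>t\<^sup>2 * f2 t - 2 * f t\<close>; hence
  \<open>t\<^sup>2 * f2 t\<close> integrates to 2.\<close>

lemma integral_hessian_scale: "(\<integral>t. t\<^sup>2 * g'' t * f t \<partial>lborel) = 2 - (\<integral>t. t\<^sup>2 * (g' t)\<^sup>2 * f t \<partial>lborel)"
proof -
  have "(\<integral>t. t\<^sup>2 * g'' t * f t + t\<^sup>2 * (g' t)\<^sup>2 * f t - 2 * f t \<partial>lborel) = 0"
  proof (rule integral_derivative_zero[of "\<lambda>t. t\<^sup>2 * f1 t - 2 * (t * f t)"])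
    show "((\<lambda>t. t\<^sup>2 * f1 t - 2 * (t * f t)) has_real_derivative
        t\<^sup>2 * g'' t * f t + t\<^sup>2 * (g' t)\<^sup>2 * f t - 2 * f t) (at t)" for t
    proof -
      have "((\<lambda>t. t\<^sup>2 * f1 t - 2 * (t * f t)) has_real_derivative t\<^sup>2 * f2 t - 2 * f t) (at t)"
        by (auto intro!: derivative_eq_intros f_deriv f1_deriv simp: algebra_simps)
      then show ?thesis using f2_eq'[of t] by (simp add: algebra_simps)
    qed
    show "continuous_on UNIV (\<lambda>t. t\<^sup>2 * g'' t * f t + t\<^sup>2 * (g' t)\<^sup>2 * f t - 2 * f t)"
      by (intro continuous_intros f_cont g'_cont g''_cont)
    show "integrable lborel (\<lambda>t. t\<^sup>2 * g'' t * f t + t\<^sup>2 * (g' t)\<^sup>2 * f t - 2 * f t)"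
      using integrable_f_moments f_integrable by simp
    have bd: "\<bar>t\<^sup>2 * f1 t - 2 * (t * f t)\<bar> \<le> B * (\<bar>t\<bar> ^ 3 * f t) + 2 * (\<bar>t\<bar> ^ 1 * f t)" for t
    proof -
      have "\<bar>t\<^sup>2 * f1 t\<bar> \<le> t\<^sup>2 * (B * (\<bar>t\<bar> * f t))"
        unfolding abs_mult using f1_abs_bound[of t] by (simp add: mult_left_mono)
      also have "\<dots> = B * (\<bar>t\<bar> ^ 3 * f t)"
      proof -
        have "\<bar>t\<bar> ^ 3 = t\<^sup>2 * \<bar>t\<bar>" unfolding power2_abs[of t, symmetric] by (simp only: power3_eq_cube power2_eq_square)
        then show ?thesis by simp
      qed
      finally have 1: "\<bar>t\<^sup>2 * f1 t\<bar> \<le> B * (\<bar>t\<bar> ^ 3 * f t)" .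
      have "\<bar>t * f t\<bar> = \<bar>t\<bar> ^ 1 * f t" using pos[of t] by (simp add: abs_mult)
      with 1 show ?thesis by linarith
    qed
    show "((\<lambda>t. t\<^sup>2 * f1 t - 2 * (t * f t)) \<longlongrightarrow> 0) at_top" "((\<lambda>t. t\<^sup>2 * f1 t - 2 * (t * f t)) \<longlongrightarrow> 0) at_bot"
      by (rule vanishes[OF bd])+
  qed
  then show ?thesis using integrable_f_moments(6,9) f_integrable f_integral by simp
qed

definition k1 :: real where "k1 = (\<integral>t. (g' t)\<^sup>2 * f t \<partial>lborel)"
definition k2 :: real where "k2 = (\<integral>t. t\<^sup>2 * (g' t)\<^sup>2 * f t \<partial>lborel)"

text \<open>If \<open>g'\<close> vanished almost everywhere, so would the integrand in
  \<open>fisher_pos\<close>.\<close>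

lemma k1_pos: "0 < k1"
proof -
  have "0 \<le> k1" unfolding k1_def using pos by (intro integral_nonneg_AE AE_I2) (simp add: less_imp_le)
  moreover have "k1 \<noteq> 0"
  proof
    assume "k1 = 0"
    then have "AE t in lborel. (g' t)\<^sup>2 * f t = 0"
      unfolding k1_def using integrable_f_moments(4) pos
      by (subst (asm) integral_nonneg_eq_0_iff_AE) (auto simp: less_imp_le)
    then have "AE t in lborel. t\<^sup>2 * ((f1 t)\<^sup>2 / f t) = 0"
      unfolding fisher_eq by eventually_elim auto
    then have "(\<integral>t. t\<^sup>2 * ((f1 t)\<^sup>2 / f t) \<partial>lborel) = 0" by (rule integral_eq_zero_AE)
    then show False using fisher_pos by simp
  qed
  ultimately show ?thesis by simp
qed

text \<open>\<open>k2 - 1\<close> is the variance of the scale score \<open>1 + t * g' t\<close>. It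
  could be zero only if this score vanished almost everywhere, hence by continuity everywhere, but
  its value at 0 is 1.\<close>

lemma k2_gt_1: "1 < k2"
proof -
  have eq: "(1 + t * g' t)\<^sup>2 * f t = f t + 2 * (t * g' t * f t) + t\<^sup>2 * (g' t)\<^sup>2 * f t" for t
    by (simp add: power2_eq_square algebra_simps)
  have int: "integrable lborel (\<lambda>t. (1 + t * g' t)\<^sup>2 * f t)"
    unfolding eq using integrable_f_moments f_integrable by simp
  have "(\<integral>t. (1 + t * g' t)\<^sup>2 * f t \<partial>lborel) = 1 + 2 * (- 1) + k2"
    unfolding eq k2_def using integrable_f_moments f_integrable
    by (simp add: f_integral integral_score_scale)
  then have val: "(\<integral>t. (1 + t * g' t)\<^sup>2 * f t \<partial>lborel) = k2 - 1" by simp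
  have "0 \<le> (\<integral>t. (1 + t * g' t)\<^sup>2 * f t \<partial>lborel)"
    using pos by (intro integral_nonneg_AE AE_I2) (simp add: less_imp_le)
  moreover have "(\<integral>t. (1 + t * g' t)\<^sup>2 * f t \<partial>lborel) \<noteq> 0"
  proof
    assume "(\<integral>t. (1 + t * g' t)\<^sup>2 * f t \<partial>lborel) = 0"
    then have "AE t in lborel. (1 + t * g' t)\<^sup>2 * f t = 0"
      using int pos by (subst (asm) integral_nonneg_eq_0_iff_AE) (auto simp: less_imp_le)
    then have "AE t in lborel. 1 + t * g' t = 0" by eventually_elim (use f_nz in auto)
    moreover have "continuous_on UNIV (\<lambda>t. 1 + t * g' t)"
      by (intro continuous_intros g'_cont)
    ultimately have "1 + 0 * g' 0 = 0" by (intro continuous_AE_lborel_zero)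
    then show False by simp
  qed
  ultimately show ?thesis unfolding val by simp
qed

end

section \<open>The regression model\<close>

lemma sum_UNIV_plus_unit: "(\<Sum>k\<in>UNIV. h k) = (\<Sum>i\<in>UNIV. h (Inl i)) + h (Inr ())"
  for h :: "'d::finite + unit \<Rightarrow> 'b::comm_monoid_add"
  unfolding UNIV_Plus_UNIV[symmetric] by (subst sum.Plus) (auto simp: UNIV_unit)

lemma inner_vec_snoc: "vec_snoc a b \<bullet> vec_snoc x t = a \<bullet> x + b * t"
  by (simp add: inner_vec_def sum_UNIV_plus_unit vec_snoc_def)

lemma vec_snoc_cases:
  fixes u :: "real ^ ('d::finite + unit)"
  obtains a b where "u = vec_snoc a b"
proof
  show "u = vec_snoc (\<chi> i. u $ Inl i) (u $ Inr ())"
    by (auto simp: vec_eq_iff vec_snoc_def split: sum.split)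
qed

lemma vec_snoc_eq_iff: "vec_snoc a b = vec_snoc a' b' \<longleftrightarrow> a = a' \<and> b = b'"
  by (auto simp: vec_eq_iff vec_snoc_def split: sum.splits)

lemma vec_snoc_0: "vec_snoc 0 0 = 0"
  by (auto simp: vec_eq_iff vec_snoc_def split: sum.split)

lemma vec_snoc_diff: "vec_snoc a b - vec_snoc a' b' = vec_snoc (a - a') (b - b')"
  by (auto simp: vec_eq_iff vec_snoc_def split: sum.split)

lemma vec_snoc_scaleR: "r *\<^sub>R vec_snoc a b = vec_snoc (r *\<^sub>R a) (r * b)"
  by (auto simp: vec_eq_iff vec_snoc_def split: sum.split)

lemma block_diag_mult_vec_snoc: "block_diag A c *v vec_snoc a b = vec_snoc (A *v a) (c * b)"
  by (auto simp: vec_eq_iff matrix_vector_mult_def sum_UNIV_plus_unit vec_snoc_def block_diag_def split: sum.split)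

lemma vec_snoc_measurable[measurable (raw)]:
  assumes [measurable]: "F \<in> borel_measurable M" "G \<in> borel_measurable M"
  shows "(\<lambda>x. vec_snoc (F x) (G x)) \<in> borel_measurable M"
proof -
  have "continuous_on UNIV (\<lambda>p :: (real ^ 'd) \<times> real. vec_snoc (fst p) (snd p))"
    unfolding vec_snoc_def
  proof (rule continuous_on_vec_lambda)
    fix i :: "'d + unit"
    show "continuous_on UNIV (\<lambda>p :: (real ^ 'd) \<times> real. case i of Inl i \<Rightarrow> fst p $ i | Inr _ \<Rightarrow> snd p)"
      by (cases i) (auto intro!: continuous_intros)
  qed
  then have [measurable]: "(\<lambda>p :: (real ^ 'd) \<times> real. vec_snoc (fst p) (snd p)) \<in> borel_measurable borel"
    by (rule borel_measurable_continuous_onI)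
  have "(\<lambda>x. (F x, G x)) \<in> borel_measurable M" by measurable
  from measurable_compose[OF this \<open>(\<lambda>p. vec_snoc (fst p) (snd p)) \<in> _\<close>] show ?thesis by simp
qed

lemma pos_definite_block_diag:
  assumes "pos_definite A" "0 < c"
  shows "pos_definite (block_diag A c)"
  unfolding pos_definite_def
proof (intro conjI allI impI)
  have "A $ i $ j = A $ j $ i" for i j
    using assms(1) unfolding pos_definite_def by (metis transpose_def vec_lambda_beta)
  then show "transpose (block_diag A c) = block_diag A c"
    by (auto simp: vec_eq_iff transpose_def block_diag_def split: sum.split)
  fix v :: "real ^ ('a + unit)" assume v: "v \<noteq> 0"
  obtain a b where ab: "v = vec_snoc a b" by (rule vec_snoc_cases)
  have eq: "v \<bullet> (block_diag A c *v v) = a \<bullet> (A *v a) + c * b\<^sup>2"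
    unfolding ab block_diag_mult_vec_snoc inner_vec_snoc by (simp add: power2_eq_square)
  show "0 < v \<bullet> (block_diag A c *v v)"
  proof (cases "a = 0")
    case True
    then have "b \<noteq> 0" using v ab by (auto simp: vec_snoc_0)
    then show ?thesis unfolding eq using True assms(2) by simp
  next
    case False
    then have "0 < a \<bullet> (A *v a)" using assms(1) by (simp add: pos_definite_def)
    then show ?thesis unfolding eq using assms(2) by (simp add: add_pos_nonneg)
  qed
qed

lemma pos_definite_scaleR: "pos_definite A \<Longrightarrow> 0 < r \<Longrightarrow> pos_definite (r *\<^sub>R A)"
  by (auto simp: pos_definite_def transpose_scalar scaleR_matrix_vector_assoc[symmetric])

lemma pos_definite_coercive:
  fixes S :: "real ^ 'k ^ 'k"
  assumes "pos_definite S"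
  shows "\<exists>l>0. \<forall>v. l * (norm v)\<^sup>2 \<le> v \<bullet> (S *v v)"
proof -
  have "continuous_on (sphere 0 1) (\<lambda>v. v \<bullet> (S *v v))"
    by (intro continuous_intros matrix_vector_mult_linear_continuous_on)
  moreover have "sphere (0 :: real ^ 'k) 1 \<noteq> {}"
  proof -
    have "axis undefined 1 \<in> sphere (0 :: real ^ 'k) 1" by simp
    then show ?thesis by blast
  qed
  ultimately obtain w where w: "w \<in> sphere 0 1" "\<And>v. v \<in> sphere 0 1 \<Longrightarrow> w \<bullet> (S *v w) \<le> v \<bullet> (S *v v)"
    using continuous_attains_inf[of "sphere 0 1" "\<lambda>v. v \<bullet> (S *v v)"] compact_sphere by blast
  have "w \<noteq> 0" using w(1) by auto
  then have pos: "0 < w \<bullet> (S *v w)" using assms by (simp add: pos_definite_def)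
  moreover have "w \<bullet> (S *v w) * (norm v)\<^sup>2 \<le> v \<bullet> (S *v v)" for v
  proof (cases "v = 0")
    case False
    have "w \<bullet> (S *v w) \<le> (v /\<^sub>R norm v) \<bullet> (S *v (v /\<^sub>R norm v))" using False by (intro w(2)) auto
    also have "\<dots> = (v \<bullet> (S *v v)) / (norm v)\<^sup>2"
      by (simp add: linear_cmul[OF matrix_vector_mul_linear] power2_eq_square field_simps)
    finally show ?thesis using False by (simp add: field_simps)
  qed simp
  ultimately show ?thesis by blast
qed

text \<open>In the model \<open>e\<close> is the noise divided by \<open>s0\<close>, so its density
  is the known \<open>f\<close> and the unknown scale disappears.\<close>

locale regression_noise = smooth_density f f1 f2 \<alpha> C B + P: prob_space P
  for f f1 f2 :: "real \<Rightarrow> real" and \<alpha> C B :: real and P :: "'p measure" +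
  fixes X :: "'p \<Rightarrow> real ^ 'd" and e :: "'p \<Rightarrow> real"
  assumes X_measurable[measurable]: "X \<in> borel_measurable P"
    and e_distributed: "distributed P lborel e (\<lambda>t. ennreal (f t))"
    and indep_X_e: "P.indep_set {X -` A \<inter> space P | A. A \<in> sets borel} {e -` A \<inter> space P | A. A \<in> sets borel}"
    and X_sq: "integrable P (\<lambda>\<omega>. (norm (X \<omega>))\<^sup>2)"
    and posdef: "pos_definite (second_moment P X)"
    and f_antimono: "antimono_on {0..} f"
begin

lemma e_measurable[measurable]: "e \<in> borel_measurable P"
  using e_distributed by (auto simp: distributed_def)

lemma prob_X_e:
  assumes "A \<in> sets borel" "A' \<in> sets borel"
  shows "P.prob ((X -` A \<inter> space P) \<inter> (e -` A' \<inter> space P)) = P.prob (X -` A \<inter> space P) * P.prob (e -` A' \<inter> space P)"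
  by (rule P.indep_setD[OF indep_X_e]) (use assms in auto)

lemma indep_var_X_e:
  fixes h :: "real ^ 'd \<Rightarrow> real"
  assumes h: "h \<in> borel_measurable borel" and k: "k \<in> borel_measurable borel"
  shows "P.indep_var borel (\<lambda>\<omega>. h (X \<omega>)) borel (\<lambda>\<omega>. k (e \<omega>))"
  unfolding P.indep_var_eq
proof (intro conjI P.indep_set_sigma_sets)
  show "P.random_variable borel (\<lambda>\<omega>. h (X \<omega>))" "P.random_variable borel (\<lambda>\<omega>. k (e \<omega>))"
    using h k by measurable
  show "Int_stable {(\<lambda>\<omega>. h (X \<omega>)) -` A \<inter> space P |A. A \<in> sets borel}"
    "Int_stable {(\<lambda>\<omega>. k (e \<omega>)) -` A \<inter> space P |A. A \<in> sets borel}"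
  proof (safe intro!: Int_stableI)
    fix A A' :: "real set" assume A: "A \<in> sets borel" "A' \<in> sets borel"
    show "\<exists>Aa. (\<lambda>\<omega>. h (X \<omega>)) -` A \<inter> space P \<inter> ((\<lambda>\<omega>. h (X \<omega>)) -` A' \<inter> space P) =
        (\<lambda>\<omega>. h (X \<omega>)) -` Aa \<inter> space P \<and> Aa \<in> sets borel"
      using A by (intro exI[of _ "A \<inter> A'"]) auto
    show "\<exists>Aa. (\<lambda>\<omega>. k (e \<omega>)) -` A \<inter> space P \<inter> ((\<lambda>\<omega>. k (e \<omega>)) -` A' \<inter> space P) =
        (\<lambda>\<omega>. k (e \<omega>)) -` Aa \<inter> space P \<and> Aa \<in> sets borel"
      using A by (intro exI[of _ "A \<inter> A'"]) auto
  qed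
  show "P.indep_set {(\<lambda>\<omega>. h (X \<omega>)) -` A \<inter> space P |A. A \<in> sets borel}
      {(\<lambda>\<omega>. k (e \<omega>)) -` A \<inter> space P |A. A \<in> sets borel}"
  proof (rule P.indep_setI)
    show "{(\<lambda>\<omega>. h (X \<omega>)) -` A \<inter> space P |A. A \<in> sets borel} \<subseteq> P.events"
      "{(\<lambda>\<omega>. k (e \<omega>)) -` A \<inter> space P |A. A \<in> sets borel} \<subseteq> P.events"
      using h k by (auto intro!: measurable_sets[of _ P borel])
    fix U V assume "U \<in> {(\<lambda>\<omega>. h (X \<omega>)) -` A \<inter> space P |A. A \<in> sets borel}"
      "V \<in> {(\<lambda>\<omega>. k (e \<omega>)) -` A \<inter> space P |A. A \<in> sets borel}"
    then obtain A A' where A: "A \<in> sets borel" "U = X -` (h -` A) \<inter> space P"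
      "A' \<in> sets borel" "V = e -` (k -` A') \<inter> space P" by (auto simp: vimage_def)
    have "h -` A \<in> sets borel" "k -` A' \<in> sets borel"
      using measurable_sets[OF h A(1)] measurable_sets[OF k A(3)] by auto
    then show "P.prob (U \<inter> V) = P.prob U * P.prob V" unfolding A by (rule prob_X_e)
  qed
qed

lemma expectation_product:
  fixes h :: "real ^ 'd \<Rightarrow> real"
  assumes [measurable]: "h \<in> borel_measurable borel" "k \<in> borel_measurable borel"
    and h: "integrable P (\<lambda>\<omega>. h (X \<omega>))" and k: "integrable lborel (\<lambda>t. k t * f t)"
  shows "has_bochner_integral P (\<lambda>\<omega>. k (e \<omega>) * h (X \<omega>)) ((\<integral>t. k t * f t \<partial>lborel) * (\<integral>\<omega>. h (X \<omega>) \<partial>P))"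
proof -
  have ke: "integrable P (\<lambda>\<omega>. k (e \<omega>))"
    using distributed_integrable[OF e_distributed, of k] k less_imp_le[OF pos] by (simp add: mult.commute)
  have ke': "(\<integral>\<omega>. k (e \<omega>) \<partial>P) = (\<integral>t. k t * f t \<partial>lborel)"
    using distributed_integral[OF e_distributed, of k] less_imp_le[OF pos] by (simp add: mult.commute)
  have ind: "P.indep_var borel (\<lambda>\<omega>. h (X \<omega>)) borel (\<lambda>\<omega>. k (e \<omega>))"
    by (rule indep_var_X_e) measurable
  show ?thesis
    using P.indep_var_integrable[OF ind h ke] P.indep_var_lebesgue_integral[OF ind h ke]
    by (simp add: has_bochner_integral_iff ke' mult.commute)
qed

lemma X_inner_integrable: "integrable P (\<lambda>\<omega>. a \<bullet> X \<omega>)"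
proof (rule P.square_integrable_imp_integrable)
  show "integrable P (\<lambda>\<omega>. (a \<bullet> X \<omega>)\<^sup>2)"
  proof (rule Bochner_Integration.integrable_bound)
    show "integrable P (\<lambda>\<omega>. (norm a)\<^sup>2 * (norm (X \<omega>))\<^sup>2)" using X_sq by simp
    show "AE \<omega> in P. norm ((a \<bullet> X \<omega>)\<^sup>2) \<le> norm ((norm a)\<^sup>2 * (norm (X \<omega>))\<^sup>2)"
    proof (rule AE_I2)
      fix \<omega> show "norm ((a \<bullet> X \<omega>)\<^sup>2) \<le> norm ((norm a)\<^sup>2 * (norm (X \<omega>))\<^sup>2)"
        using power_mono[OF Cauchy_Schwarz_ineq2[of a "X \<omega>"], of 2] by (simp add: power_mult_distrib)
    qed
  qed measurable
qed measurable

lemma X_inner_prod_integrable: "integrable P (\<lambda>\<omega>. (a \<bullet> X \<omega>) * (b \<bullet> X \<omega>))"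
proof (rule Bochner_Integration.integrable_bound)
  show "integrable P (\<lambda>\<omega>. norm a * norm b * (norm (X \<omega>))\<^sup>2)" using X_sq by simp
  show "AE \<omega> in P. norm ((a \<bullet> X \<omega>) * (b \<bullet> X \<omega>)) \<le> norm (norm a * norm b * (norm (X \<omega>))\<^sup>2)"
  proof (rule AE_I2)
    fix \<omega>
    have "\<bar>a \<bullet> X \<omega>\<bar> * \<bar>b \<bullet> X \<omega>\<bar> \<le> (norm a * norm (X \<omega>)) * (norm b * norm (X \<omega>))"
      by (intro mult_mono Cauchy_Schwarz_ineq2) auto
    then show "norm ((a \<bullet> X \<omega>) * (b \<bullet> X \<omega>)) \<le> norm (norm a * norm b * (norm (X \<omega>))\<^sup>2)"
      by (simp add: abs_mult power2_eq_square mult_ac)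
  qed
qed measurable

lemma second_moment_inner: "(\<integral>\<omega>. (a \<bullet> X \<omega>) * (b \<bullet> X \<omega>) \<partial>P) = a \<bullet> (second_moment P X *v b)"
proof -
  have int: "integrable P (\<lambda>\<omega>. X \<omega> $ i * X \<omega> $ j)" for i j
    using X_inner_prod_integrable[of "axis i 1" "axis j 1"] by (simp add: inner_axis')
  have "(\<integral>\<omega>. (a \<bullet> X \<omega>) * (b \<bullet> X \<omega>) \<partial>P) =
      (\<integral>\<omega>. (\<Sum>i\<in>UNIV. \<Sum>j\<in>UNIV. (a $ i * b $ j) * (X \<omega> $ i * X \<omega> $ j)) \<partial>P)"
    by (simp add: inner_vec_def sum_product mult_ac)
  also have "\<dots> = (\<Sum>i\<in>UNIV. \<integral>\<omega>. (\<Sum>j\<in>UNIV. (a $ i * b $ j) * (X \<omega> $ i * X \<omega> $ j)) \<partial>P)"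
    by (intro Bochner_Integration.integral_sum Bochner_Integration.integrable_sum integrable_mult_right int)
  also have "\<dots> = (\<Sum>i\<in>UNIV. \<Sum>j\<in>UNIV. \<integral>\<omega>. (a $ i * b $ j) * (X \<omega> $ i * X \<omega> $ j) \<partial>P)"
    by (intro sum.cong refl Bochner_Integration.integral_sum integrable_mult_right int)
  also have "\<dots> = a \<bullet> (second_moment P X *v b)"
    by (simp add: inner_vec_def matrix_vector_mult_def second_moment_def sum_distrib_left mult_ac)
  finally show ?thesis .
qed

text \<open>\<open>X\<close> is not assumed centred. In the score and information computations its
  mean is multiplied by integrals of odd functions, which vanish; hence the zero off-diagonal
  blocks.\<close>

definition \<mu> :: "real ^ 'd \<Rightarrow> real" where "\<mu> a = (\<integral>\<omega>. a \<bullet> X \<omega> \<partial>P)"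

lemma expectation_linear:
  assumes [measurable]: "k \<in> borel_measurable borel"
    and k: "integrable lborel (\<lambda>t. k t * f t)" "integrable lborel (\<lambda>t. t * k t * f t)"
  shows "has_bochner_integral P (\<lambda>\<omega>. k (e \<omega>) * (a \<bullet> X \<omega> + b * e \<omega>))
    ((\<integral>t. k t * f t \<partial>lborel) * \<mu> a + b * (\<integral>t. t * k t * f t \<partial>lborel))"
proof -
  have 1: "has_bochner_integral P (\<lambda>\<omega>. k (e \<omega>) * (a \<bullet> X \<omega>)) ((\<integral>t. k t * f t \<partial>lborel) * \<mu> a)"
    unfolding \<mu>_def by (rule expectation_product[of "\<lambda>x. a \<bullet> x"]) (use k X_inner_integrable in auto)
  have 2: "has_bochner_integral P (\<lambda>\<omega>. (e \<omega> * k (e \<omega>)) * 1) ((\<integral>t. t * k t * f t \<partial>lborel) * (\<integral>\<omega>. 1 \<partial>P))"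
    by (rule expectation_product[of "\<lambda>x. 1" "\<lambda>t. t * k t"]) (use k in auto)
  have "has_bochner_integral P (\<lambda>\<omega>. k (e \<omega>) * (a \<bullet> X \<omega>) + b * ((e \<omega> * k (e \<omega>)) * 1))
    ((\<integral>t. k t * f t \<partial>lborel) * \<mu> a + b * ((\<integral>t. t * k t * f t \<partial>lborel) * (\<integral>\<omega>. 1 \<partial>P)))"
    by (intro has_bochner_integral_add has_bochner_integral_mult_right 1 2)
  then show ?thesis by (simp add: P.prob_space algebra_simps)
qed

lemma expectation_quadratic:
  assumes [measurable]: "k \<in> borel_measurable borel"
    and k: "integrable lborel (\<lambda>t. k t * f t)" "integrable lborel (\<lambda>t. t * k t * f t)"
      "integrable lborel (\<lambda>t. t\<^sup>2 * k t * f t)"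
  shows "has_bochner_integral P (\<lambda>\<omega>. k (e \<omega>) * (a \<bullet> X \<omega> + b * e \<omega>) * (a' \<bullet> X \<omega> + b' * e \<omega>))
    ((\<integral>t. k t * f t \<partial>lborel) * (a \<bullet> (second_moment P X *v a')) +
     (\<integral>t. t * k t * f t \<partial>lborel) * (b' * \<mu> a + b * \<mu> a') + b * b' * (\<integral>t. t\<^sup>2 * k t * f t \<partial>lborel))"
proof -
  have 1: "has_bochner_integral P (\<lambda>\<omega>. k (e \<omega>) * ((a \<bullet> X \<omega>) * (a' \<bullet> X \<omega>)))
      ((\<integral>t. k t * f t \<partial>lborel) * (a \<bullet> (second_moment P X *v a')))"
    unfolding second_moment_inner[symmetric]
    by (rule expectation_product[of "\<lambda>x. (a \<bullet> x) * (a' \<bullet> x)"]) (use k X_inner_prod_integrable in auto)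
  have 2: "has_bochner_integral P (\<lambda>\<omega>. (e \<omega> * k (e \<omega>)) * (c \<bullet> X \<omega>)) ((\<integral>t. t * k t * f t \<partial>lborel) * \<mu> c)" for c
    unfolding \<mu>_def
    by (rule expectation_product[of "\<lambda>x. c \<bullet> x" "\<lambda>t. t * k t"]) (use k X_inner_integrable in auto)
  have 3: "has_bochner_integral P (\<lambda>\<omega>. ((e \<omega>)\<^sup>2 * k (e \<omega>)) * 1) ((\<integral>t. t\<^sup>2 * k t * f t \<partial>lborel) * (\<integral>\<omega>. 1 \<partial>P))"
    by (rule expectation_product[of "\<lambda>x. 1" "\<lambda>t. t\<^sup>2 * k t"]) (use k in auto)
  have "has_bochner_integral P (\<lambda>\<omega>. k (e \<omega>) * ((a \<bullet> X \<omega>) * (a' \<bullet> X \<omega>)) +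
      (b' * ((e \<omega> * k (e \<omega>)) * (a \<bullet> X \<omega>)) + b * ((e \<omega> * k (e \<omega>)) * (a' \<bullet> X \<omega>))) +
      (b * b') * (((e \<omega>)\<^sup>2 * k (e \<omega>)) * 1))
    ((\<integral>t. k t * f t \<partial>lborel) * (a \<bullet> (second_moment P X *v a')) +
     (b' * ((\<integral>t. t * k t * f t \<partial>lborel) * \<mu> a) + b * ((\<integral>t. t * k t * f t \<partial>lborel) * \<mu> a')) +
     (b * b') * ((\<integral>t. t\<^sup>2 * k t * f t \<partial>lborel) * (\<integral>\<omega>. 1 \<partial>P)))"
    by (intro has_bochner_integral_add has_bochner_integral_mult_right 1 2 3)
  then show ?thesis by (simp add: P.prob_space algebra_simps power2_eq_square)
qed

section \<open>Nondegeneracy and identifiability\<close>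

lemma f_le_f0: "f t \<le> f 0"
proof -
  have "f \<bar>t\<bar> \<le> f 0" using f_antimono by (auto simp: monotone_on_def)
  then show ?thesis using even[of t] by (cases "0 \<le> t") auto
qed

lemma not_AE_X_zero:
  assumes "a \<noteq> 0" shows "\<not> (AE \<omega> in P. a \<bullet> X \<omega> = 0)"
proof
  assume "AE \<omega> in P. a \<bullet> X \<omega> = 0"
  then have "AE \<omega> in P. (a \<bullet> X \<omega>) * (a \<bullet> X \<omega>) = 0" by eventually_elim auto
  then have "a \<bullet> (second_moment P X *v a) = 0"
    unfolding second_moment_inner[symmetric] by (rule integral_eq_zero_AE)
  then show False using posdef assms unfolding pos_definite_def by (metis less_irrefl)
qed

text \<open>The cross term in the second moment of \<open>a \<bullet> X + b * e\<close> vanishes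
  because \<open>f\<close> is even. The two remaining terms are nonnegative, and each is zero only
  if its coefficient is.\<close>

lemma nondegenerate:
  assumes "vec_snoc a b \<noteq> 0" shows "\<not> (AE \<omega> in P. a \<bullet> X \<omega> + b * e \<omega> = 0)"
proof
  assume "AE \<omega> in P. a \<bullet> X \<omega> + b * e \<omega> = 0"
  then have "AE \<omega> in P. 1 * (a \<bullet> X \<omega> + b * e \<omega>) * (a \<bullet> X \<omega> + b * e \<omega>) = 0" by eventually_elim auto
  then have "(\<integral>\<omega>. 1 * (a \<bullet> X \<omega> + b * e \<omega>) * (a \<bullet> X \<omega> + b * e \<omega>) \<partial>P) = 0" by (rule integral_eq_zero_AE)
  moreover have "has_bochner_integral P (\<lambda>\<omega>. 1 * (a \<bullet> X \<omega> + b * e \<omega>) * (a \<bullet> X \<omega> + b * e \<omega>))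
    ((\<integral>t. 1 * f t \<partial>lborel) * (a \<bullet> (second_moment P X *v a)) +
     (\<integral>t. t * 1 * f t \<partial>lborel) * (b * \<mu> a + b * \<mu> a) + b * b * (\<integral>t. t\<^sup>2 * 1 * f t \<partial>lborel))"
    by (rule expectation_quadratic) (use f_integrable f_sq integrable_f_moments in auto)
  ultimately have eq: "a \<bullet> (second_moment P X *v a) + b * b * (\<integral>t. t\<^sup>2 * f t \<partial>lborel) = 0"
    by (simp add: has_bochner_integral_iff f_integral integral_odd_moments)
  have sq: "0 < (\<integral>t. t\<^sup>2 * f t \<partial>lborel)"
  proof -
    have "0 \<le> (\<integral>t. t\<^sup>2 * f t \<partial>lborel)" using less_imp_le[OF pos] by (intro integral_nonneg_AE) auto
    moreover have "(\<integral>t. t\<^sup>2 * f t \<partial>lborel) \<noteq> 0"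
    proof
      assume "(\<integral>t. t\<^sup>2 * f t \<partial>lborel) = 0"
      then have "AE t in lborel. t\<^sup>2 * f t = 0"
        using f_sq less_imp_le[OF pos] by (subst (asm) integral_nonneg_eq_0_iff_AE) auto
      then have "1\<^sup>2 * f 1 = 0"
        by (intro continuous_AE_lborel_zero[of "\<lambda>t. t\<^sup>2 * f t"] continuous_intros f_cont)
      then show False using f_nz by simp
    qed
    ultimately show ?thesis by simp
  qed
  have pd: "0 < a \<bullet> (second_moment P X *v a)" if "a \<noteq> 0"
    using posdef that unfolding pos_definite_def by blast
  have "0 \<le> a \<bullet> (second_moment P X *v a)"
    using pd by (cases "a = 0") (simp_all add: less_imp_le)
  moreover have "0 \<le> b * b * (\<integral>t. t\<^sup>2 * f t \<partial>lborel)" using sq by simp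
  ultimately have "a \<bullet> (second_moment P X *v a) = 0" "b * b * (\<integral>t. t\<^sup>2 * f t \<partial>lborel) = 0"
    using eq by linarith+
  then have "a = 0" "b = 0" using pd sq by (metis less_irrefl, simp)
  then show False using assms by (simp add: vec_snoc_0)
qed

lemma g_residual_integrable: "integrable P (\<lambda>\<omega>. g (a \<bullet> X \<omega> + b * e \<omega>))"
proof (rule Bochner_Integration.integrable_bound)
  have "has_bochner_integral P (\<lambda>\<omega>. 1 * (a \<bullet> X \<omega> + b * e \<omega>) * (a \<bullet> X \<omega> + b * e \<omega>))
    ((\<integral>t. 1 * f t \<partial>lborel) * (a \<bullet> (second_moment P X *v a)) +
     (\<integral>t. t * 1 * f t \<partial>lborel) * (b * \<mu> a + b * \<mu> a) + b * b * (\<integral>t. t\<^sup>2 * 1 * f t \<partial>lborel))"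
    by (rule expectation_quadratic) (use f_integrable f_sq integrable_f_moments in auto)
  then have "integrable P (\<lambda>\<omega>. (a \<bullet> X \<omega> + b * e \<omega>)\<^sup>2)"
    by (simp add: has_bochner_integral_iff power2_eq_square)
  then show "integrable P (\<lambda>\<omega>. \<bar>g 0\<bar> + B * (a \<bullet> X \<omega> + b * e \<omega>)\<^sup>2)" by simp
  show "AE \<omega> in P. norm (g (a \<bullet> X \<omega> + b * e \<omega>)) \<le> norm (\<bar>g 0\<bar> + B * (a \<bullet> X \<omega> + b * e \<omega>)\<^sup>2)"
  proof (rule AE_I2)
    fix \<omega>
    have "\<bar>g (a \<bullet> X \<omega> + b * e \<omega>) - g 0\<bar> \<le> B * (a \<bullet> X \<omega> + b * e \<omega>)\<^sup>2" by (rule g_quadratic)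
    then show "norm (g (a \<bullet> X \<omega> + b * e \<omega>)) \<le> norm (\<bar>g 0\<bar> + B * (a \<bullet> X \<omega> + b * e \<omega>)\<^sup>2)"
      unfolding real_norm_def by linarith
  qed
qed measurable

lemma f_vanishes: "(f \<longlongrightarrow> 0) at_top"
  using power_f_vanishes(1)[of 0] by simp

text \<open>\<open>f 0\<close> is a positive maximum: the identity at \<open>t = 0\<close> gives
  \<open>b \<ge> 1\<close>, and at \<open>t = - c / b\<close> it gives \<open>b \<le> 1\<close>. A
  nonzero \<open>c\<close> would then be a period, so the value \<open>f 0\<close> would recur
  arbitrarily far out, against the decay of \<open>f\<close>.\<close>

lemma shifted_density_eq:
  assumes b: "0 < b" and eq: "\<And>t. b * f (c + b * t) = f t"
  shows "b = 1 \<and> c = 0"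
proof
  have "f 0 = b * f c" using eq[of 0] by simp
  also have "\<dots> \<le> b * f 0" using b f_le_f0[of c] by (intro mult_left_mono) auto
  finally have "1 \<le> b" using pos[of 0] by simp
  moreover have "b * f 0 \<le> f 0" using eq[of "- c / b"] f_le_f0[of "- c / b"] b by simp
  then have "b \<le> 1" using pos[of 0] by simp
  ultimately show b1: "b = 1" by simp
  show "c = 0"
  proof (rule ccontr)
    assume c: "c \<noteq> 0"
    have shift: "f (t + c) = f t" for t using eq[of t] b1 by (simp add: add.commute)
    have "f (real n * c) = f 0" for n
    proof (induction n)
      case (Suc n)
      then show ?case using shift[of "real n * c"] by (simp add: algebra_simps)
    qed simp
    then have n: "f (real n * \<bar>c\<bar>) = f 0" for n using even[of "real n * c"] by (cases "0 \<le> c") auto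
    have "filterlim (\<lambda>n. real n * \<bar>c\<bar>) at_top sequentially"
      using c by real_asymp
    from filterlim_compose[OF f_vanishes this] have "(\<lambda>n. f 0) \<longlonglongrightarrow> 0" by (simp add: n)
    then show False using f_nz[of 0] by (simp add: LIMSEQ_const_iff)
  qed
qed

lemma joint_distribution:
  "distr P (borel \<Otimes>\<^sub>M borel) (\<lambda>\<omega>. (X \<omega>, e \<omega>)) = distr P borel X \<Otimes>\<^sub>M density lborel (\<lambda>t. ennreal (f t))"
proof (rule pair_measure_eqI[symmetric])
  have Le: "density lborel (\<lambda>t. ennreal (f t)) = distr P borel e"
    using distributed_distr_eq_density[OF e_distributed] by (metis distr_cong sets_lborel)
  show "sigma_finite_measure (distr P borel X)" "sigma_finite_measure (density lborel (\<lambda>t. ennreal (f t)))"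
    unfolding Le by (intro prob_space_imp_sigma_finite P.prob_space_distr; measurable)+
  show "sets (distr P borel X \<Otimes>\<^sub>M density lborel (\<lambda>t. ennreal (f t))) =
      sets (distr P (borel \<Otimes>\<^sub>M borel) (\<lambda>\<omega>. (X \<omega>, e \<omega>)))"
    unfolding Le sets_distr by (rule sets_pair_measure_cong) auto
  fix A A' assume "A \<in> sets (distr P borel X)" "A' \<in> sets (density lborel (\<lambda>t. ennreal (f t)))"
  then have A: "A \<in> sets borel" "A' \<in> sets borel" by auto
  have "(\<lambda>\<omega>. (X \<omega>, e \<omega>)) -` (A \<times> A') \<inter> space P = (X -` A \<inter> space P) \<inter> (e -` A' \<inter> space P)" by auto
  then show "emeasure (distr P borel X) A * emeasure (density lborel (\<lambda>t. ennreal (f t))) A' =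
      emeasure (distr P (borel \<Otimes>\<^sub>M borel) (\<lambda>\<omega>. (X \<omega>, e \<omega>))) (A \<times> A')"
    unfolding Le using A prob_X_e[OF A]
    by (simp add: emeasure_distr P.emeasure_eq_measure ennreal_mult[symmetric])
qed

text \<open>\<open>r\<close> is a likelihood ratio of mean 1, and \<open>ln r \<le> r - 1\<close>
  with equality only at \<open>r = 1\<close>. If strictness failed, \<open>r\<close> would be 1
  almost surely, which identifiability excludes.\<close>

lemma kl_strict:
  assumes b: "0 < b" and ne: "vec_snoc a b \<noteq> vec_snoc 0 1"
  shows "ln b + (\<integral>\<omega>. g (a \<bullet> X \<omega> + b * e \<omega>) \<partial>P) < (\<integral>\<omega>. g (e \<omega>) \<partial>P)"
proof (rule ccontr)
  assume neg: "\<not> ?thesis"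
  interpret LX: prob_space "distr P borel X" by (rule P.prob_space_distr) measurable
  have sf: "sigma_finite_measure (density lborel (\<lambda>t. ennreal (f t)))"
    unfolding distributed_distr_eq_density[OF e_distributed, symmetric]
    by (intro prob_space_imp_sigma_finite P.prob_space_distr) measurable
  interpret Le: sigma_finite_measure "density lborel (\<lambda>t. ennreal (f t))" by (rule sf)
  interpret XL: pair_sigma_finite "distr P borel X" "density lborel (\<lambda>t. ennreal (f t))" ..
  define r where "r x t = b * f (a \<bullet> x + b * t) / f t" for x t
  have rpos: "0 < r x t" for x t using b pos by (simp add: r_def)
  have [measurable]: "(\<lambda>p. r (fst p) (snd p)) \<in> borel_measurable (borel \<Otimes>\<^sub>M borel)"
    unfolding r_def by measurable
  have lnr: "ln (r x t) = ln b + g (a \<bullet> x + b * t) - g t" for x t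
    using b f_nz unfolding r_def g_def by (simp add: ln_mult ln_div pos)
  have gi: "integrable P (\<lambda>\<omega>. g (e \<omega>))" using g_residual_integrable[of 0 1] by simp
  have int_ln: "integrable P (\<lambda>\<omega>. ln (r (X \<omega>) (e \<omega>)))"
    unfolding lnr using g_residual_integrable[of a b] gi by simp
  have E_ln: "0 \<le> (\<integral>\<omega>. ln (r (X \<omega>) (e \<omega>)) \<partial>P)"
    unfolding lnr using g_residual_integrable[of a b] gi neg by (simp add: P.prob_space)
  have inner1: "(\<integral>\<^sup>+t. ennreal (r x t) \<partial>density lborel (\<lambda>t. ennreal (f t))) = 1" for x
  proof -
    have "(\<integral>\<^sup>+t. ennreal (r x t) \<partial>density lborel (\<lambda>t. ennreal (f t))) =
       (\<integral>\<^sup>+t. ennreal (f t) * ennreal (r x t) \<partial>lborel)"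
      unfolding r_def by (subst nn_integral_density) auto
    also have "\<dots> = (\<integral>\<^sup>+t. ennreal b * ennreal (f (a \<bullet> x + b * t)) \<partial>lborel)"
      using b less_imp_le[OF pos] f_nz by (intro nn_integral_cong) (simp add: r_def ennreal_mult[symmetric])
    also have "\<dots> = ennreal b * (\<integral>\<^sup>+t. ennreal (f (a \<bullet> x + b * t)) \<partial>lborel)"
      by (rule nn_integral_cmult) measurable
    also have "\<dots> = (\<integral>\<^sup>+t. ennreal (f t) \<partial>lborel)"
      using b by (subst nn_integral_real_affine[of "\<lambda>t. ennreal (f t)" b "a \<bullet> x"]) auto
    also have "\<dots> = ennreal (\<integral>t. f t \<partial>lborel)"
      using f_integrable less_imp_le[OF pos] by (intro nn_integral_eq_integral) auto
    finally show ?thesis by (simp add: f_integral)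
  qed
  have "(\<integral>\<^sup>+\<omega>. ennreal (r (X \<omega>) (e \<omega>)) \<partial>P) =
      (\<integral>\<^sup>+p. ennreal (r (fst p) (snd p)) \<partial>distr P (borel \<Otimes>\<^sub>M borel) (\<lambda>\<omega>. (X \<omega>, e \<omega>)))"
    by (subst nn_integral_distr) auto
  also have "\<dots> = (\<integral>\<^sup>+x. (\<integral>\<^sup>+t. ennreal (r x t) \<partial>density lborel (\<lambda>t. ennreal (f t))) \<partial>distr P borel X)"
    unfolding joint_distribution by (subst Le.nn_integral_fst[symmetric]) auto
  also have "\<dots> = 1" unfolding inner1 using LX.emeasure_space_1 by simp
  finally have nn1: "(\<integral>\<^sup>+\<omega>. ennreal (r (X \<omega>) (e \<omega>)) \<partial>P) = 1" .
  have [measurable]: "(\<lambda>\<omega>. r (X \<omega>) (e \<omega>)) \<in> borel_measurable P" unfolding r_def by measurable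
  have int_r: "integrable P (\<lambda>\<omega>. r (X \<omega>) (e \<omega>))"
    using nn1 rpos by (intro integrableI_bounded) (auto simp: less_imp_le)
  have E_r: "(\<integral>\<omega>. r (X \<omega>) (e \<omega>) \<partial>P) = 1"
    using nn1 rpos by (subst integral_eq_nn_integral) (auto simp: less_imp_le)
  have nonneg: "0 \<le> r x t - 1 - ln (r x t)" for x t using ln_le_minus_one[OF rpos[of x t]] by simp
  have "(\<integral>\<omega>. r (X \<omega>) (e \<omega>) - 1 - ln (r (X \<omega>) (e \<omega>)) \<partial>P) \<le> 0"
    using int_r int_ln E_r E_ln by (simp add: P.prob_space)
  moreover have "0 \<le> (\<integral>\<omega>. r (X \<omega>) (e \<omega>) - 1 - ln (r (X \<omega>) (e \<omega>)) \<partial>P)"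
    using nonneg by (intro integral_nonneg_AE) auto
  ultimately have "(\<integral>\<omega>. r (X \<omega>) (e \<omega>) - 1 - ln (r (X \<omega>) (e \<omega>)) \<partial>P) = 0" by simp
  then have "AE \<omega> in P. r (X \<omega>) (e \<omega>) - 1 - ln (r (X \<omega>) (e \<omega>)) = 0"
    using int_r int_ln nonneg by (subst (asm) integral_nonneg_eq_0_iff_AE) auto
  then have "AE \<omega> in P. r (fst (X \<omega>, e \<omega>)) (snd (X \<omega>, e \<omega>)) = 1"
  proof eventually_elim
    case (elim \<omega>)
    then show ?case using ln_eq_minus_one[OF rpos[of "X \<omega>" "e \<omega>"]] by simp
  qed
  then have "AE p in distr P (borel \<Otimes>\<^sub>M borel) (\<lambda>\<omega>. (X \<omega>, e \<omega>)). r (fst p) (snd p) = 1"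
    by (subst AE_distr_iff) auto
  then have "AE p in distr P borel X \<Otimes>\<^sub>M density lborel (\<lambda>t. ennreal (f t)). r (fst p) (snd p) = 1"
    unfolding joint_distribution .
  then have "AE x in distr P borel X. AE t in density lborel (\<lambda>t. ennreal (f t)). r x t = 1"
    using XL.AE_pair[of "\<lambda>p. r (fst p) (snd p) = 1"] by simp
  \<comment> \<open>With \<open>x\<close> frozen, positivity of \<open>f\<close> turns almost every
    \<open>t\<close> for the noise into Lebesgue-almost every \<open>t\<close>, and continuity turns
    that into every \<open>t\<close>.\<close>
  then have "AE x in distr P borel X. b = 1 \<and> a \<bullet> x = 0"
  proof eventually_elim
    case (elim x)
    then have "AE t in lborel. r x t = 1"
      by (subst (asm) AE_density) (auto simp: pos)
    then have "AE t in lborel. b * f (a \<bullet> x + b * t) - f t = 0"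
      by eventually_elim (use f_nz in \<open>auto simp: r_def field_simps\<close>)
    then have "b * f (a \<bullet> x + b * t) - f t = 0" for t
      by (intro continuous_AE_lborel_zero[of "\<lambda>t. b * f (a \<bullet> x + b * t) - f t"]
           continuous_intros continuous_on_compose2[OF f_cont[of UNIV]]) auto
    then show ?case using b by (intro shifted_density_eq) auto
  qed
  then have AE: "AE \<omega> in P. b = 1 \<and> a \<bullet> X \<omega> = 0"
    by (subst (asm) AE_distr_iff) auto
  then have "b = 1" using P.AE_contr by (metis (mono_tags, lifting) AE_cong P.AE_const)
  moreover have "AE \<omega> in P. a \<bullet> X \<omega> = 0" using AE by eventually_elim simp
  then have "a = 0" using not_AE_X_zero by blast
  ultimately show False using ne by simp
qed

end

section \<open>Limit in distribution and first-order conditions\<close>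

lemma abs_cos_diff_le: "\<bar>cos a - cos b\<bar> \<le> \<bar>a - b :: real\<bar>"
proof -
  have "\<bar>cos a - cos b\<bar> = 2 * \<bar>sin ((a + b) / 2)\<bar> * \<bar>sin ((b - a) / 2)\<bar>"
    by (simp add: cos_diff_cos abs_mult)
  also have "\<dots> \<le> 2 * 1 * \<bar>(b - a) / 2\<bar>"
    by (intro mult_mono abs_sin_x_le_abs_x) auto
  finally show ?thesis by simp
qed

context prob_space
begin

lemma integral_cos_eq:
  assumes [measurable]: "R \<in> borel_measurable M"
  shows "(\<integral>\<omega>. cos (R \<omega> + a) \<partial>M) = Re (iexp a * (\<integral>\<omega>. iexp (R \<omega>) \<partial>M))"
proof -
  have int: "complex_integrable M (\<lambda>\<omega>. iexp (R \<omega>))"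
    by (rule integrable_const_bound[of _ 1]) auto
  have "iexp a * (\<integral>\<omega>. iexp (R \<omega>) \<partial>M) = (\<integral>\<omega>. iexp a * iexp (R \<omega>) \<partial>M)" by simp
  also have "Re \<dots> = (\<integral>\<omega>. Re (iexp a * iexp (R \<omega>)) \<partial>M)"
    using int by (intro integral_Re[symmetric] integrable_mult_right)
  also have "\<dots> = (\<integral>\<omega>. cos (R \<omega> + a) \<partial>M)"
    by (intro Bochner_Integration.integral_cong refl)
       (simp add: cis_conv_exp[symmetric] cis_mult add.commute)
  finally show ?thesis ..
qed

text \<open>Slutsky's lemma for cosine integrals: on an event of probability close to 1 the cosines
  are close by the Lipschitz bound, and elsewhere they differ by at most 2.\<close>

lemma integral_cos_close:
  fixes R S :: "nat \<Rightarrow> 'a \<Rightarrow> real"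
  assumes [measurable]: "\<And>n. R n \<in> borel_measurable M" "\<And>n. S n \<in> borel_measurable M"
    and close: "\<And>\<tau>. 0 < \<tau> \<Longrightarrow> whp (\<lambda>n \<omega>. \<bar>R n \<omega> - S n \<omega>\<bar> < \<tau>)"
    and lim: "(\<lambda>n. \<integral>\<omega>. cos (S n \<omega>) \<partial>M) \<longlonglongrightarrow> l"
  shows "(\<lambda>n. \<integral>\<omega>. cos (R n \<omega>) \<partial>M) \<longlonglongrightarrow> l"
proof -
  have "(\<lambda>n. (\<integral>\<omega>. cos (R n \<omega>) \<partial>M) - (\<integral>\<omega>. cos (S n \<omega>) \<partial>M)) \<longlonglongrightarrow> 0"
  proof (rule tendstoI)
    fix \<epsilon> :: real assume \<epsilon>: "0 < \<epsilon>"
    have "hp (\<epsilon> / 4) (\<lambda>n \<omega>. \<bar>R n \<omega> - S n \<omega>\<bar> < \<epsilon> / 4)"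
      using close[of "\<epsilon> / 4"] \<epsilon> unfolding whp_def by simp
    then show "\<forall>\<^sub>F n in sequentially. dist ((\<integral>\<omega>. cos (R n \<omega>) \<partial>M) - (\<integral>\<omega>. cos (S n \<omega>) \<partial>M)) 0 < \<epsilon>"
      unfolding hp_def
    proof eventually_elim
      case (elim n)
      then obtain A where A[measurable]: "A \<in> events" and p: "1 - \<epsilon> / 4 \<le> prob A"
        and cl: "\<And>\<omega>. \<omega> \<in> A \<Longrightarrow> \<bar>R n \<omega> - S n \<omega>\<bar> < \<epsilon> / 4" by blast
      have ci: "integrable M (\<lambda>\<omega>. cos (R n \<omega>))" "integrable M (\<lambda>\<omega>. cos (S n \<omega>))"
        by (intro integrable_const_bound[of _ 1]; auto)+
      have ii: "integrable M (\<lambda>\<omega>. \<epsilon> / 4 + 2 * indicator (space M - A) \<omega>)"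
        by (intro Bochner_Integration.integrable_add integrable_const integrable_mult_right
             integrable_real_indicator) (auto simp: emeasure_eq_measure)
      have "\<bar>(\<integral>\<omega>. cos (R n \<omega>) \<partial>M) - (\<integral>\<omega>. cos (S n \<omega>) \<partial>M)\<bar> = \<bar>\<integral>\<omega>. cos (R n \<omega>) - cos (S n \<omega>) \<partial>M\<bar>"
        using ci by simp
      also have "\<dots> \<le> (\<integral>\<omega>. \<bar>cos (R n \<omega>) - cos (S n \<omega>)\<bar> \<partial>M)" by (rule integral_abs_bound)
      also have "\<dots> \<le> (\<integral>\<omega>. \<epsilon> / 4 + 2 * indicator (space M - A) \<omega> \<partial>M)"
      proof (intro integral_mono integrable_abs Bochner_Integration.integrable_diff ci ii)
        fix \<omega> assume w: "\<omega> \<in> space M"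
        show "\<bar>cos (R n \<omega>) - cos (S n \<omega>)\<bar> \<le> \<epsilon> / 4 + 2 * indicator (space M - A) \<omega>"
        proof (cases "\<omega> \<in> A")
          case True
          then show ?thesis using cl[OF True] abs_cos_diff_le[of "R n \<omega>" "S n \<omega>"] by simp
        next
          case False
          have "\<bar>cos (R n \<omega>) - cos (S n \<omega>)\<bar> \<le> 2"
            using cos_le_one[of "R n \<omega>"] cos_le_one[of "S n \<omega>"]
              cos_ge_minus_one[of "R n \<omega>"] cos_ge_minus_one[of "S n \<omega>"] by linarith
          then show ?thesis using False w \<epsilon> by simp
        qed
      qed
      also have "\<dots> = \<epsilon> / 4 + 2 * prob (space M - A)"
        by (subst Bochner_Integration.integral_add) (auto simp: prob_space emeasure_eq_measure)
      also have "\<dots> < \<epsilon>" using p \<epsilon> by (simp add: prob_compl)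
      finally show ?case by (simp add: dist_real_def)
    qed
  qed
  from tendsto_add[OF this lim] show ?thesis by simp
qed

lemma hp_imp_prob_le:
  assumes "hp \<epsilon> (\<lambda>n \<omega>. \<not> E n \<omega>)" and [measurable]: "\<And>n. {\<omega> \<in> space M. E n \<omega>} \<in> events"
  shows "\<forall>\<^sub>F n in sequentially. prob {\<omega> \<in> space M. E n \<omega>} \<le> \<epsilon>"
  using assms(1) unfolding hp_def
proof eventually_elim
  case (elim n)
  then obtain A where A: "A \<in> events" "1 - \<epsilon> \<le> prob A" "\<forall>\<omega>\<in>A. \<not> E n \<omega>" by blast
  have "prob {\<omega> \<in> space M. E n \<omega>} \<le> prob (space M - A)"
    using A by (intro finite_measure_mono) auto
  then show ?case using A by (simp add: prob_compl)
qed

end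

context location_scale_info
begin

text \<open>\<open>T\<close> carries the random factor \<open>s\<close>. Replacing it by
  \<open>s0\<close> costs \<open>s - s0\<close>, which tends to zero, times
  \<open>sqrt n * (J v \<bullet> \<delta>)\<close>, which stays bounded with high
  probability.\<close>

lemma scaled_expansion:
  assumes exp: "\<And>\<tau>. 0 < \<tau> \<Longrightarrow>
      whp (\<lambda>n \<omega>. \<forall>v. \<bar>v \<bullet> J (\<delta> n \<omega>) - avg (\<lambda>z. v \<bullet> \<psi> z) n \<omega>\<bar> \<le> \<tau> * norm v * norm (\<delta> n \<omega>))"
    and dec: "whp (\<lambda>n \<omega>. T n \<omega> = (sqrt n * s n \<omega>) *\<^sub>R \<delta> n \<omega>)"
    and s: "\<And>\<tau>. 0 < \<tau> \<Longrightarrow> whp (\<lambda>n \<omega>. \<bar>s n \<omega> - s0\<bar> < \<tau>)" and s0: "0 < s0"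
    and \<tau>: "0 < \<tau>"
  shows "whp (\<lambda>n \<omega>. \<bar>J v \<bullet> T n \<omega> - s0 * (sqrt n * avg (\<lambda>z. v \<bullet> \<psi> z) n \<omega>)\<bar> < \<tau>)"
  unfolding whp_def
proof (intro allI impI)
  fix \<epsilon> :: real assume \<epsilon>: "0 < \<epsilon>"
  obtain K where K: "0 < K" "hp (\<epsilon> / 2) (\<lambda>n \<omega>. sqrt n * norm (\<delta> n \<omega>) < K)"
    using root_n_bounded[OF exp, of "\<epsilon> / 2"] \<epsilon> by auto
  define \<tau>1 where "\<tau>1 = \<tau> / (2 * (K * (norm (J v) + 1)))"
  have p: "0 < K * (norm (J v) + 1)" using K(1) by (intro mult_pos_pos) (auto simp: add_nonneg_pos)
  have \<tau>1: "0 < \<tau>1" "\<tau>1 * (K * (norm (J v) + 1)) = \<tau> / 2"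
    using \<tau> p unfolding \<tau>1_def by (simp_all add: field_simps)
  have "whp (\<lambda>n \<omega>. (T n \<omega> = (sqrt n * s n \<omega>) *\<^sub>R \<delta> n \<omega> \<and> \<bar>s n \<omega> - s0\<bar> < \<tau>1) \<and>
      \<bar>sqrt n * (J v \<bullet> \<delta> n \<omega>) - sqrt n * avg (\<lambda>z. v \<bullet> \<psi> z) n \<omega>\<bar> < \<tau> / (2 * s0))"
    using \<tau> s0 \<tau>1(1) by (intro whp_conj dec s asymptotically_linear[OF exp]) auto
  then have "hp (\<epsilon> / 2) (\<lambda>n \<omega>. (T n \<omega> = (sqrt n * s n \<omega>) *\<^sub>R \<delta> n \<omega> \<and> \<bar>s n \<omega> - s0\<bar> < \<tau>1) \<and>
      \<bar>sqrt n * (J v \<bullet> \<delta> n \<omega>) - sqrt n * avg (\<lambda>z. v \<bullet> \<psi> z) n \<omega>\<bar> < \<tau> / (2 * s0))"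
    using \<epsilon> unfolding whp_def by simp
  from hp_conj[OF K(2) this]
  have "hp (\<epsilon> / 2 + \<epsilon> / 2) (\<lambda>n \<omega>. \<bar>J v \<bullet> T n \<omega> - s0 * (sqrt n * avg (\<lambda>z. v \<bullet> \<psi> z) n \<omega>)\<bar> < \<tau>)"
  proof (rule hp_mono, intro always_eventually allI ballI impI, elim conjE)
    fix n \<omega>
    let ?a = "sqrt n * (J v \<bullet> \<delta> n \<omega>)" and ?b = "sqrt n * avg (\<lambda>z. v \<bullet> \<psi> z) n \<omega>"
    assume k: "sqrt n * norm (\<delta> n \<omega>) < K" and T: "T n \<omega> = (sqrt n * s n \<omega>) *\<^sub>R \<delta> n \<omega>"
      and sc: "\<bar>s n \<omega> - s0\<bar> < \<tau>1" and ab: "\<bar>?a - ?b\<bar> < \<tau> / (2 * s0)"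
    have "J v \<bullet> T n \<omega> - s0 * ?b = (s n \<omega> - s0) * ?a + s0 * (?a - ?b)"
      unfolding T by (simp add: algebra_simps)
    then have tri: "\<bar>J v \<bullet> T n \<omega> - s0 * ?b\<bar> \<le> \<bar>s n \<omega> - s0\<bar> * \<bar>?a\<bar> + s0 * \<bar>?a - ?b\<bar>"
      using s0 abs_triangle_ineq[of "(s n \<omega> - s0) * ?a" "s0 * (?a - ?b)"] by (simp add: abs_mult)
    have "\<bar>?a\<bar> = sqrt n * \<bar>J v \<bullet> \<delta> n \<omega>\<bar>" by (simp add: abs_mult)
    also have "\<dots> \<le> sqrt n * (norm (J v) * norm (\<delta> n \<omega>))"
      by (intro mult_left_mono Cauchy_Schwarz_ineq2) auto
    also have "\<dots> = norm (J v) * (sqrt n * norm (\<delta> n \<omega>))" by simp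
    also have "\<dots> \<le> (norm (J v) + 1) * K" using k K(1) by (intro mult_mono) auto
    finally have "\<bar>s n \<omega> - s0\<bar> * \<bar>?a\<bar> \<le> \<tau>1 * ((norm (J v) + 1) * K)"
      using sc \<tau>1(1) by (intro mult_mono) auto
    also have "\<dots> = \<tau> / 2" using \<tau>1(2) by (simp only: mult.commute)
    finally have 1: "\<bar>s n \<omega> - s0\<bar> * \<bar>?a\<bar> \<le> \<tau> / 2" .
    have "s0 * \<bar>?a - ?b\<bar> < s0 * (\<tau> / (2 * s0))" using ab s0 by (rule mult_strict_left_mono)
    also have "\<dots> = \<tau> / 2" using s0 by simp
    finally show "\<bar>J v \<bullet> T n \<omega> - s0 * ?b\<bar> < \<tau>" using tri 1 by linarith
  qed
  then show "hp \<epsilon> (\<lambda>n \<omega>. \<bar>J v \<bullet> T n \<omega> - s0 * (sqrt n * avg (\<lambda>z. v \<bullet> \<psi> z) n \<omega>)\<bar> < \<tau>)" by simp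
qed

lemma scaled_tight:
  assumes exp: "\<And>\<tau>. 0 < \<tau> \<Longrightarrow>
      whp (\<lambda>n \<omega>. \<forall>v. \<bar>v \<bullet> J (\<delta> n \<omega>) - avg (\<lambda>z. v \<bullet> \<psi> z) n \<omega>\<bar> \<le> \<tau> * norm v * norm (\<delta> n \<omega>))"
    and dec: "whp (\<lambda>n \<omega>. T n \<omega> = (sqrt n * s n \<omega>) *\<^sub>R \<delta> n \<omega>)"
    and s: "\<And>\<tau>. 0 < \<tau> \<Longrightarrow> whp (\<lambda>n \<omega>. \<bar>s n \<omega> - s0\<bar> < \<tau>)" and s0: "0 < s0"
    and T[measurable]: "\<And>n. T n \<in> borel_measurable M" and \<epsilon>: "0 < \<epsilon>"
  shows "\<exists>L. \<forall>\<^sub>F n in sequentially. prob {\<omega> \<in> space M. L < norm (T n \<omega>)} \<le> \<epsilon>"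
proof -
  obtain K where K: "0 < K" "hp (\<epsilon> / 2) (\<lambda>n \<omega>. sqrt n * norm (\<delta> n \<omega>) < K)"
    using root_n_bounded[OF exp, of "\<epsilon> / 2"] \<epsilon> by auto
  have "hp (\<epsilon> / 2) (\<lambda>n \<omega>. T n \<omega> = (sqrt n * s n \<omega>) *\<^sub>R \<delta> n \<omega> \<and> \<bar>s n \<omega> - s0\<bar> < s0)"
    using whp_conj[OF dec s[OF s0]] \<epsilon> unfolding whp_def by simp
  from hp_conj[OF K(2) this]
  have "hp (\<epsilon> / 2 + \<epsilon> / 2) (\<lambda>n \<omega>. \<not> 2 * s0 * K < norm (T n \<omega>))"
  proof (rule hp_mono, intro always_eventually allI ballI impI, elim conjE)
    fix n \<omega>
    assume k: "sqrt n * norm (\<delta> n \<omega>) < K" and T: "T n \<omega> = (sqrt n * s n \<omega>) *\<^sub>R \<delta> n \<omega>"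
      and sc: "\<bar>s n \<omega> - s0\<bar> < s0"
    have "norm (T n \<omega>) = \<bar>s n \<omega>\<bar> * (sqrt n * norm (\<delta> n \<omega>))" unfolding T by (simp add: abs_mult)
    also have "\<dots> \<le> (2 * s0) * K"
    proof (rule mult_mono)
      show "\<bar>s n \<omega>\<bar> \<le> 2 * s0" using sc s0 by linarith
    qed (use k s0 in auto)
    finally show "\<not> 2 * s0 * K < norm (T n \<omega>)" by simp
  qed
  then have "hp \<epsilon> (\<lambda>n \<omega>. \<not> 2 * s0 * K < norm (T n \<omega>))" by simp
  from hp_imp_prob_le[OF this] show ?thesis by auto
qed

text \<open>In a direction \<open>J v\<close> the vector \<open>T\<close> is asymptotically a scaled
  sum of the i.i.d. scalars \<open>v \<bullet> \<psi> z\<close>, so the one-dimensional central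
  limit theorem applies; \<open>v \<noteq> 0\<close> makes the variance positive.\<close>

lemma cos_tendsto:
  assumes exp: "\<And>\<tau>. 0 < \<tau> \<Longrightarrow>
      whp (\<lambda>n \<omega>. \<forall>v. \<bar>v \<bullet> J (\<delta> n \<omega>) - avg (\<lambda>z. v \<bullet> \<psi> z) n \<omega>\<bar> \<le> \<tau> * norm v * norm (\<delta> n \<omega>))"
    and dec: "whp (\<lambda>n \<omega>. T n \<omega> = (sqrt n * s n \<omega>) *\<^sub>R \<delta> n \<omega>)"
    and s: "\<And>\<tau>. 0 < \<tau> \<Longrightarrow> whp (\<lambda>n \<omega>. \<bar>s n \<omega> - s0\<bar> < \<tau>)" and s0: "0 < s0"
    and T[measurable]: "\<And>n. T n \<in> borel_measurable M" and v: "v \<noteq> 0"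
  shows "(\<lambda>n. \<integral>\<omega>. cos (J v \<bullet> T n \<omega> + a) \<partial>M) \<longlonglongrightarrow>
    Re (iexp a * complex_of_real (exp (- (s0\<^sup>2 * (v \<bullet> J v)) / 2)))"
proof (rule integral_cos_close[where S="\<lambda>n \<omega>. s0 * (sqrt n * avg (\<lambda>z. v \<bullet> \<psi> z) n \<omega>) + a"])
  have am[measurable]: "avg (\<lambda>z. v \<bullet> \<psi> z) n \<in> borel_measurable M" for n
    by (rule avg_measurable[OF inner_psi_measurable])
  show "(\<lambda>\<omega>. J v \<bullet> T n \<omega> + a) \<in> borel_measurable M" for n by measurable
  show "(\<lambda>\<omega>. s0 * (sqrt n * avg (\<lambda>z. v \<bullet> \<psi> z) n \<omega>) + a) \<in> borel_measurable M" for n by measurable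
  show "whp (\<lambda>n \<omega>. \<bar>J v \<bullet> T n \<omega> + a - (s0 * (sqrt n * avg (\<lambda>z. v \<bullet> \<psi> z) n \<omega>) + a)\<bar> < \<tau>)" if "0 < \<tau>" for \<tau>
    using scaled_expansion[OF exp dec s s0 that, of v] by simp
  define \<phi> where "\<phi> z = s0 * (v \<bullet> \<psi> z)" for z
  have avg\<phi>: "avg \<phi> n \<omega> = s0 * avg (\<lambda>z. v \<bullet> \<psi> z) n \<omega>" for n \<omega> unfolding \<phi>_def by (rule avg_cmult)
  have sq: "(\<phi> z)\<^sup>2 = s0\<^sup>2 * (v \<bullet> \<psi> z)\<^sup>2" for z by (simp add: \<phi>_def power_mult_distrib)
  have var: "(\<integral>z. (\<phi> z)\<^sup>2 \<partial>D) = s0\<^sup>2 * (v \<bullet> J v)" unfolding sq by (simp add: score_variance)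
  have vpos: "0 < v \<bullet> J v"
    using J_coercive(1) J_coercive(2)[of v] v by (intro less_le_trans[OF _ J_coercive(2)]) simp
  have "(\<lambda>n. \<integral>\<omega>. iexp (sqrt n * avg \<phi> n \<omega>) \<partial>M) \<longlonglongrightarrow> complex_of_real (exp (- (\<integral>z. (\<phi> z)\<^sup>2 \<partial>D) / 2))"
  proof (rule iexp_avg_tendsto)
    show "\<phi> \<in> borel_measurable borel" unfolding \<phi>_def using inner_psi_measurable by measurable
    show "integrable D (\<lambda>z. (\<phi> z)\<^sup>2)" unfolding sq by (intro integrable_mult_right score_variance)
    show "(\<integral>z. \<phi> z \<partial>D) = 0" unfolding \<phi>_def by (simp add: score_mean)
    show "0 < (\<integral>z. (\<phi> z)\<^sup>2 \<partial>D)" unfolding var using s0 vpos by simp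
  qed
  then have "(\<lambda>n. Re (iexp a * (\<integral>\<omega>. iexp (sqrt n * avg \<phi> n \<omega>) \<partial>M))) \<longlonglongrightarrow>
      Re (iexp a * complex_of_real (exp (- (\<integral>z. (\<phi> z)\<^sup>2 \<partial>D) / 2)))"
    by (intro tendsto_Re tendsto_mult_left)
  moreover have "Re (iexp a * (\<integral>\<omega>. iexp (sqrt n * avg \<phi> n \<omega>) \<partial>M)) =
      (\<integral>\<omega>. cos (s0 * (sqrt n * avg (\<lambda>z. v \<bullet> \<psi> z) n \<omega>) + a) \<partial>M)" for n
  proof (subst integral_cos_eq[symmetric])
    show "(\<lambda>\<omega>. sqrt n * avg \<phi> n \<omega>) \<in> borel_measurable M" unfolding avg\<phi> by measurable
  qed (simp add: avg\<phi> mult_ac)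
  ultimately show "(\<lambda>n. \<integral>\<omega>. cos (s0 * (sqrt n * avg (\<lambda>z. v \<bullet> \<psi> z) n \<omega>) + a) \<partial>M) \<longlonglongrightarrow>
    Re (iexp a * complex_of_real (exp (- (s0\<^sup>2 * (v \<bullet> J v)) / 2)))"
    unfolding var by simp
qed

end

section \<open>Likelihood and score equation in the new coordinates\<close>

lemma loglik_eq:
  assumes "\<And>t. 0 < f t"
  shows "loglik f n x y \<beta> s = ereal (- real n * ln s + (\<Sum>i=1..n. ln (f ((y i - \<beta> \<bullet> x i) / s))))"
  using assms by (simp add: loglik_def elog_def)

text \<open>Written as the last unit vector minus the error divided by \<open>s\<close>, so that the
  estimation error can be read off; \<open>reparam_alt\<close> gives the two blocks.\<close>

definition reparam :: "real ^ 'd \<Rightarrow> real \<Rightarrow> real ^ 'd \<Rightarrow> real \<Rightarrow> real ^ ('d + unit)" where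
  "reparam \<beta>0 s0 \<beta> s = vec_snoc 0 1 - (1 / s) *\<^sub>R (vec_snoc \<beta> s - vec_snoc \<beta>0 s0)"

lemma reparam_alt:
  "s \<noteq> 0 \<Longrightarrow> reparam \<beta>0 s0 \<beta> s = vec_snoc ((- (1 / s)) *\<^sub>R (\<beta> - \<beta>0)) (s0 / s)"
  unfolding reparam_def vec_snoc_diff vec_snoc_scaleR by (simp add: vec_snoc_eq_iff field_simps)

lemma reparam_residual:
  assumes "s \<noteq> 0" "s0 \<noteq> 0"
  shows "reparam \<beta>0 s0 \<beta> s \<bullet> vec_snoc x ((y - \<beta>0 \<bullet> x) / s0) = (y - \<beta> \<bullet> x) / s"
  using assms unfolding reparam_alt[OF assms(1)] inner_vec_snoc
  by (simp add: inner_diff_left field_simps)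

text \<open>Because the parameters fill the whole open half-space, maximality over \<beta> and
  \<open>s\<close> becomes maximality over that half-space.\<close>

lemma reparam_onto:
  assumes "0 < \<eta> \<bullet> vec_snoc 0 1" "0 < s0"
  obtains \<beta> s where "0 < s" "\<eta> = reparam \<beta>0 s0 \<beta> s"
proof -
  obtain a b where ab: "\<eta> = vec_snoc a b" by (rule vec_snoc_cases)
  have b: "0 < b" using assms(1) unfolding ab inner_vec_snoc by simp
  have "\<eta> = reparam \<beta>0 s0 (\<beta>0 - (s0 / b) *\<^sub>R a) (s0 / b)"
    using b assms(2) by (subst reparam_alt) (auto simp: ab vec_snoc_eq_iff)
  then show ?thesis using that[of "s0 / b"] b assms(2) by simp
qed

lemma mle_maximizes:
  fixes x :: "nat \<Rightarrow> real ^ 'd" and y :: "nat \<Rightarrow> real" and \<beta>0 :: "real ^ 'd"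
  assumes pos: "\<And>t. 0 < f t" and s0: "0 < s0" and mle: "is_mle f n x y \<beta> s"
  defines "z i \<equiv> vec_snoc (x i) ((y i - \<beta>0 \<bullet> x i) / s0)" and "\<eta> \<equiv> reparam \<beta>0 s0 \<beta> s"
  shows "0 < \<eta> \<bullet> vec_snoc 0 1"
    and "0 < \<eta>' \<bullet> vec_snoc 0 1 \<Longrightarrow>
      n * ln (\<eta>' \<bullet> vec_snoc 0 1) + (\<Sum>i=1..n. ln (f (\<eta>' \<bullet> z i))) \<le>
      n * ln (\<eta> \<bullet> vec_snoc 0 1) + (\<Sum>i=1..n. ln (f (\<eta> \<bullet> z i)))"
proof -
  have s: "0 < s" using mle by (simp add: is_mle_def)
  have q: "reparam \<beta>0 s0 \<beta> s \<bullet> vec_snoc 0 1 = s0 / s" if "0 < s" for \<beta> s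
    using that by (simp add: reparam_alt inner_vec_snoc)
  show "0 < \<eta> \<bullet> vec_snoc 0 1" unfolding \<eta>_def q[OF s] using s s0 by simp
  have res: "reparam \<beta>0 s0 \<beta> s \<bullet> z i = (y i - \<beta> \<bullet> x i) / s" if "0 < s" for \<beta> s i
    unfolding z_def using that s0 by (intro reparam_residual) auto
  \<comment> \<open>The change of coordinates shifts the log-likelihood by \<open>n * ln s0\<close>,
    the same amount for all parameters.\<close>
  have ll: "loglik f n x y \<beta> s = ereal (n * ln (reparam \<beta>0 s0 \<beta> s \<bullet> vec_snoc 0 1) +
      (\<Sum>i=1..n. ln (f (reparam \<beta>0 s0 \<beta> s \<bullet> z i))) - n * ln s0)" if "0 < s" for \<beta> s
    unfolding loglik_eq[OF pos] q[OF that] res[OF that] using that s0 by (simp add: ln_div algebra_simps)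
  assume "0 < \<eta>' \<bullet> vec_snoc 0 1"
  then obtain \<beta>' s' where \<eta>': "0 < s'" "\<eta>' = reparam \<beta>0 s0 \<beta>' s'" using s0 by (rule reparam_onto)
  have "loglik f n x y \<beta>' s' \<le> loglik f n x y \<beta> s" using mle \<eta>'(1) by (simp add: is_mle_def)
  then show "n * ln (\<eta>' \<bullet> vec_snoc 0 1) + (\<Sum>i=1..n. ln (f (\<eta>' \<bullet> z i))) \<le>
      n * ln (\<eta> \<bullet> vec_snoc 0 1) + (\<Sum>i=1..n. ln (f (\<eta> \<bullet> z i)))"
    unfolding ll[OF \<eta>'(1)] ll[OF s] \<eta>'(2) \<eta>_def by simp
qed

text \<open>The half-space is open, so along every line through \<open>\<eta>\<close> the criterion
  has an interior local maximum at \<open>\<eta>\<close>.\<close>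

lemma score_zero_at_maximizer:
  fixes z :: "nat \<Rightarrow> 'a::real_inner"
  assumes der: "\<And>t. (g has_real_derivative g' t) (at t)" and pos: "0 < \<eta> \<bullet> q"
    and max: "\<And>\<eta>'. 0 < \<eta>' \<bullet> q \<Longrightarrow>
      n * ln (\<eta>' \<bullet> q) + (\<Sum>i=1..n. g (\<eta>' \<bullet> z i)) \<le> n * ln (\<eta> \<bullet> q) + (\<Sum>i=1..n. g (\<eta> \<bullet> z i))"
  shows "real n * ((v \<bullet> q) / (\<eta> \<bullet> q)) + (\<Sum>i=1..n. g' (\<eta> \<bullet> z i) * (v \<bullet> z i)) = 0"
proof -
  define L where "L r = n * ln ((\<eta> + r *\<^sub>R v) \<bullet> q) + (\<Sum>i=1..n. g ((\<eta> + r *\<^sub>R v) \<bullet> z i))" for r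
  have lin: "((\<lambda>r. (\<eta> + r *\<^sub>R v) \<bullet> w) has_real_derivative v \<bullet> w) (at r)" for w r
    unfolding inner_add_left inner_scaleR_left by (auto intro!: derivative_eq_intros)
  have lnd: "((\<lambda>r. ln ((\<eta> + r *\<^sub>R v) \<bullet> q)) has_real_derivative (v \<bullet> q) / ((\<eta> + 0 *\<^sub>R v) \<bullet> q)) (at 0)"
    using lin[of q 0] pos by (auto intro!: derivative_eq_intros)
  have "(L has_real_derivative n * ((v \<bullet> q) / ((\<eta> + 0 *\<^sub>R v) \<bullet> q)) +
      (\<Sum>i=1..n. g' ((\<eta> + 0 *\<^sub>R v) \<bullet> z i) * (v \<bullet> z i))) (at 0)"
    unfolding L_def
    by (intro DERIV_add DERIV_cmult DERIV_sum DERIV_chain2[OF der lin] lnd)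
  moreover have "\<exists>d>0. \<forall>r. \<bar>0 - r\<bar> < d \<longrightarrow> L r \<le> L 0"
  proof -
    \<comment> \<open>For \<open>\<bar>r\<bar> < d\<close> the line stays in the half-space; the
      summand 1 avoids division by zero when \<open>v\<close> is orthogonal to
      \<open>q\<close>.\<close>
    define d where "d = (\<eta> \<bullet> q) / (\<bar>v \<bullet> q\<bar> + 1)"
    have d: "0 < d" "d * (\<bar>v \<bullet> q\<bar> + 1) = \<eta> \<bullet> q"
    proof -
      have nz: "0 < \<bar>v \<bullet> q\<bar> + 1" by (rule add_nonneg_pos) auto
      show "0 < d" "d * (\<bar>v \<bullet> q\<bar> + 1) = \<eta> \<bullet> q" using nz pos by (simp_all add: d_def)
    qed
    have "L r \<le> L 0" if r: "\<bar>r\<bar> < d" for r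
    proof -
      have "\<bar>r * (v \<bullet> q)\<bar> \<le> \<bar>r\<bar> * (\<bar>v \<bullet> q\<bar> + 1)" by (simp add: abs_mult mult_left_mono)
      also have "\<dots> < d * (\<bar>v \<bullet> q\<bar> + 1)" using r by (intro mult_strict_right_mono) auto
      finally have "0 < (\<eta> + r *\<^sub>R v) \<bullet> q" unfolding d(2) by (simp add: inner_add_left)
      from max[OF this] show ?thesis by (simp add: L_def)
    qed
    then show ?thesis using d(1) by auto
  qed
  ultimately show ?thesis using DERIV_local_max[of L _ 0] by fastforce
qed

section \<open>Consequences of (A8) and (A10)\<close>

lemma AE_neq_zero_if_pos_definite:
  fixes X :: "'p \<Rightarrow> real ^ 'd"
  assumes "pos_definite (second_moment P X)"
  shows "\<not> (AE \<omega> in P. X \<omega> = 0)"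
proof
  assume *: "AE \<omega> in P. X \<omega> = 0"
  have "second_moment P X $ i $ j = 0" for i j
  proof -
    have "AE \<omega> in P. X \<omega> $ i * X \<omega> $ j = 0" using * by eventually_elim simp
    then show ?thesis unfolding second_moment_def by (simp add: integral_eq_zero_AE)
  qed
  then have "second_moment P X *v v = 0" for v by (simp add: vec_eq_iff matrix_vector_mult_def)
  then have "\<forall>v :: real ^ 'd. v = 0" using assms by (metis inner_zero_right less_irrefl pos_definite_def)
  then have "axis undefined (1 :: real) = (0 :: real ^ 'd)" by blast
  then show False by (simp add: axis_eq_0_iff)
qed

text \<open>Since \<open>log 0 = -\<infinity>\<close>, letting \<open>a\<close> tend to \<open>0\<close> in (A8) excludes a bounded support.\<close>

lemma density_positive:
  fixes f :: "real \<Rightarrow> real" and X :: "'p \<Rightarrow> real ^ 'd"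
  assumes nonneg: "\<And>t. 0 \<le> f t" and even: "\<And>t. f (- t) = f t" and mono: "antimono_on {0..} f"
    and X[measurable]: "X \<in> borel_measurable P" and Y[measurable]: "Y \<in> borel_measurable P"
    and finite: "\<And>a. 0 < a \<Longrightarrow> (\<integral>\<^sup>+\<omega>. e2ennreal ((elog (f ((\<bar>Y \<omega>\<bar> + norm (X \<omega>)) / a)))\<^sup>2) \<partial>P) < \<infinity>"
    and X_nz: "\<not> (AE \<omega> in P. X \<omega> = 0)"
  shows "0 < f t"
proof (rule ccontr)
  assume "\<not> 0 < f t"
  then have t0: "f \<bar>t\<bar> = 0" using nonneg[of t] even[of t] by (cases "0 \<le> t") auto
  have zero: "f u = 0" if "\<bar>t\<bar> \<le> u" for u
  proof -
    have "f u \<le> f \<bar>t\<bar>" using mono that by (auto simp: monotone_on_def)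
    then show ?thesis using t0 nonneg[of u] by simp
  qed
  \<comment> \<open>With \<open>a = 1 / real (Suc m)\<close> the integrand is infinite wherever the
    scaled argument reaches \<open>\<bar>t\<bar>\<close>; finiteness of the integral makes that set
    null.\<close>
  have ae: "AE \<omega> in P. \<not> \<bar>t\<bar> \<le> (\<bar>Y \<omega>\<bar> + norm (X \<omega>)) * real (Suc m)" for m
  proof -
    let ?A = "{\<omega> \<in> space P. \<bar>t\<bar> \<le> (\<bar>Y \<omega>\<bar> + norm (X \<omega>)) * real (Suc m)}"
    have "(\<integral>\<^sup>+\<omega>. \<infinity> * indicator ?A \<omega> \<partial>P) \<le>
      (\<integral>\<^sup>+\<omega>. e2ennreal ((elog (f ((\<bar>Y \<omega>\<bar> + norm (X \<omega>)) / (1 / real (Suc m)))))\<^sup>2) \<partial>P)"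
    proof (rule nn_integral_mono)
      fix \<omega> assume "\<omega> \<in> space P"
      show "\<infinity> * indicator ?A \<omega> \<le> e2ennreal ((elog (f ((\<bar>Y \<omega>\<bar> + norm (X \<omega>)) / (1 / real (Suc m)))))\<^sup>2)"
      proof (cases "\<omega> \<in> ?A")
        case True
        then have "elog (f ((\<bar>Y \<omega>\<bar> + norm (X \<omega>)) / (1 / real (Suc m)))) = - \<infinity>"
          by (simp add: zero elog_def)
        then show ?thesis by (simp only: power2_eq_square) (simp add: e2ennreal_infty)
      qed simp
    qed
    also have "\<dots> < \<infinity>" by (rule finite) simp
    finally have "\<infinity> * emeasure P ?A < \<infinity>" by (subst (asm) nn_integral_cmult_indicator) auto
    then have "emeasure P ?A = 0" by (auto simp: ennreal_top_mult split: if_splits)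
    then show ?thesis by (subst AE_iff_measurable[OF _ refl]) auto
  qed
  then have "AE \<omega> in P. \<forall>m. \<not> \<bar>t\<bar> \<le> (\<bar>Y \<omega>\<bar> + norm (X \<omega>)) * real (Suc m)"
    by (simp add: AE_all_countable)
  then have "AE \<omega> in P. X \<omega> = 0"
  proof eventually_elim
    case (elim \<omega>)
    show ?case
    proof (rule ccontr)
      assume "X \<omega> \<noteq> 0"
      then have p: "0 < \<bar>Y \<omega>\<bar> + norm (X \<omega>)" by (simp add: add_nonneg_pos)
      obtain m where "\<bar>t\<bar> < real m * (\<bar>Y \<omega>\<bar> + norm (X \<omega>))" using reals_Archimedean3[OF p] by blast
      also have "\<dots> \<le> (\<bar>Y \<omega>\<bar> + norm (X \<omega>)) * real (Suc m)" using p by (simp add: algebra_simps)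
      finally show False using elim by (meson less_imp_le)
    qed
  qed
  with X_nz show False by blast
qed

text \<open>Read outwards, the hypothesis gives \<open>\<bar>G (l * u)\<bar> \<le> (\<bar>G u\<bar>
  + c) / l\<^sup>2\<close>, a contraction since \<open>l > 1\<close>. A suitable bound on
  \<open>[-1, 1]\<close> therefore spreads to \<open>[- l ^ n, l ^ n]\<close> without
  growing.\<close>

lemma bounded_of_scaling:
  fixes G :: "real \<Rightarrow> real"
  assumes G: "continuous_on UNIV G" and l: "1 < l" and c: "\<And>u. \<bar>G u - l\<^sup>2 * G (l * u)\<bar> \<le> c"
  shows "\<exists>K. \<forall>u. \<bar>G u\<bar> \<le> K"
proof -
  have l2: "1 < l\<^sup>2" using l by (simp add: one_less_power)
  have "compact (G ` {-1..1})"
    by (intro compact_continuous_image continuous_on_subset[OF G]) auto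
  then have "bounded (G ` {-1..1})" by (rule compact_imp_bounded)
  then obtain K0 where "\<forall>y\<in>G ` {-1..1}. norm y \<le> K0" unfolding bounded_iff by blast
  then have K0: "\<bar>G u\<bar> \<le> K0" if "\<bar>u\<bar> \<le> 1" for u using that by (auto simp: abs_le_iff)
  \<comment> \<open>A bound \<open>K\<close> survives one step as soon as
    \<open>(K + c) / l\<^sup>2 \<le> K\<close>, that is
    \<open>K \<ge> c / (l\<^sup>2 - 1)\<close>.\<close>
  define K where "K = max K0 (c / (l\<^sup>2 - 1))"
  have K: "K + c \<le> l\<^sup>2 * K"
  proof -
    have "c / (l\<^sup>2 - 1) \<le> K" by (simp add: K_def)
    then show ?thesis using l2 by (simp add: field_simps)
  qed
  have step: "\<bar>G (l * u)\<bar> \<le> K" if "\<bar>G u\<bar> \<le> K" for u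
  proof -
    have "l\<^sup>2 * \<bar>G (l * u)\<bar> = \<bar>l\<^sup>2 * G (l * u)\<bar>" by (simp add: abs_mult)
    also have "\<dots> \<le> K + c" using c[of u] that by linarith
    also have "\<dots> \<le> l\<^sup>2 * K" by (rule K)
    finally show ?thesis by (rule mult_left_le_imp_le) (use l in simp)
  qed
  have "\<bar>u\<bar> \<le> l ^ n \<Longrightarrow> \<bar>G u\<bar> \<le> K" for n u
  proof (induction n arbitrary: u)
    case 0
    then show ?case using K0[of u] by (simp add: K_def)
  next
    case (Suc n)
    then have "\<bar>u / l\<bar> \<le> l ^ n" using l by (simp add: field_simps)
    from step[OF Suc.IH[OF this]] show ?case using l by simp
  qed
  moreover have "\<exists>n. \<bar>u\<bar> \<le> l ^ n" for u
    using real_arch_pow[OF l, of "\<bar>u\<bar>"] by (auto intro: less_imp_le)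
  ultimately show ?thesis by blast
qed

lemma partial_deriv_log_scaled:
  fixes f f1 f2 :: "real \<Rightarrow> real" and x :: "real ^ 'd" and y :: real
  assumes pos: "\<And>t. 0 < f t" and f: "\<And>t. (f has_real_derivative f1 t) (at t)"
    and f1: "\<And>t. (f1 has_real_derivative f2 t) (at t)" and s: "0 < s"
  defines "u b \<equiv> (y - b \<bullet> x) / s"
  shows "partial_deriv i (partial_deriv j (\<lambda>b. ln (scaled f s (y - b \<bullet> x)))) \<beta> =
    x $ i * x $ j / s\<^sup>2 * (f2 (u \<beta>) / f (u \<beta>) - (f1 (u \<beta>) / f (u \<beta>))\<^sup>2)"
proof -
  have ud: "((\<lambda>h. u (b + h *\<^sub>R axis k 1)) has_real_derivative - (x $ k) / s) (at 0)" for b k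
    unfolding u_def inner_add_left inner_scaleR_left using s
    by (auto intro!: derivative_eq_intros simp: inner_axis' inner_real_def)
  have fd: "((\<lambda>h. F (u (b + h *\<^sub>R axis k 1))) has_real_derivative F' (u b) * (- (x $ k) / s)) (at 0)"
    if "\<And>t. (F has_real_derivative F' t) (at t)" for F F' b k
    using DERIV_chain2[OF that ud] by simp
  have nz: "f t \<noteq> 0" for t using pos[of t] by simp
  have 1: "partial_deriv j (\<lambda>b. ln (scaled f s (y - b \<bullet> x))) = (\<lambda>b. f1 (u b) / f (u b) * (- (x $ j) / s))"
  proof
    fix b
    have "((\<lambda>h. ln (f (u (b + h *\<^sub>R axis j 1)) / s)) has_real_derivative f1 (u b) / f (u b) * (- (x $ j) / s)) (at 0)"
      using pos[of "u b"] s by (auto intro!: derivative_eq_intros fd[OF f] simp: field_simps)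
    then show "partial_deriv j (\<lambda>b. ln (scaled f s (y - b \<bullet> x))) b = f1 (u b) / f (u b) * (- (x $ j) / s)"
      unfolding partial_deriv_def scaled_def u_def by (rule DERIV_imp_deriv)
  qed
  have "((\<lambda>h. f1 (u (\<beta> + h *\<^sub>R axis i 1)) / f (u (\<beta> + h *\<^sub>R axis i 1)) * (- (x $ j) / s)) has_real_derivative
     x $ i * x $ j / s\<^sup>2 * (f2 (u \<beta>) / f (u \<beta>) - (f1 (u \<beta>) / f (u \<beta>))\<^sup>2)) (at 0)"
    using nz s by (auto intro!: derivative_eq_intros fd[OF f] fd[OF f1] simp: field_simps power2_eq_square)
  then show ?thesis unfolding 1 unfolding partial_deriv_def by (rule DERIV_imp_deriv)
qed

text \<open>Some nonzero \<open>x\<close> lies in the support of \<open>X\<close>: otherwise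
  countably many open sets of probability zero would cover everything except 0. Since the noise
  density is positive everywhere, independence puts the whole line above \<open>x\<close> into the
  joint support.\<close>

lemma support_point:
  fixes X :: "'p \<Rightarrow> real ^ 'd" and \<epsilon> Y :: "'p \<Rightarrow> real"
  assumes "prob_space P" and X[measurable]: "X \<in> borel_measurable P"
    and \<epsilon>: "distributed P lborel \<epsilon> (\<lambda>t. ennreal (k t))" and k: "\<And>t. 0 < k t"
    and indep: "prob_space.indep_set P {X -` A \<inter> space P | A. A \<in> sets borel} {\<epsilon> -` B \<inter> space P | B. B \<in> sets borel}"
    and model: "\<And>\<omega>. \<omega> \<in> space P \<Longrightarrow> Y \<omega> = \<beta>0 \<bullet> X \<omega> + \<epsilon> \<omega>" and Y[measurable]: "Y \<in> borel_measurable P"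
    and X_nz: "\<not> (AE \<omega> in P. X \<omega> = 0)"
  obtains x where "x \<noteq> 0" "\<And>y. (x, y) \<in> measure_support (distr P borel (\<lambda>\<omega>. (X \<omega>, Y \<omega>)))"
proof -
  interpret prob_space P by fact
  have [measurable]: "\<epsilon> \<in> borel_measurable P" using \<epsilon> by (auto simp: distributed_def)
  have "\<exists>x. x \<noteq> 0 \<and> (\<forall>U. open U \<longrightarrow> x \<in> U \<longrightarrow> prob (X -` U \<inter> space P) \<noteq> 0)"
  proof (rule ccontr)
    assume "\<not> ?thesis"
    then have *: "\<exists>U. open U \<and> x \<in> U \<and> prob (X -` U \<inter> space P) = 0" if "x \<noteq> 0" for x using that by blast
    define F where "F = {U. open U \<and> prob (X -` U \<inter> space P) = 0}"
    obtain F' where F': "F' \<subseteq> F" "countable F'" "\<Union>F' = \<Union>F"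
      using Lindelof[of F] by (auto simp: F_def)
    have "AE \<omega> in P. \<forall>U\<in>F'. X \<omega> \<notin> U"
      unfolding AE_ball_countable[OF F'(2)]
    proof
      fix U assume "U \<in> F'"
      then have U: "open U" "prob (X -` U \<inter> space P) = 0" using F'(1) by (auto simp: F_def)
      then have "X -` U \<inter> space P \<in> null_sets P"
        by (intro null_setsI) (auto simp: emeasure_eq_measure intro!: measurable_sets[OF X])
      then show "AE \<omega> in P. X \<omega> \<notin> U" by (rule AE_I') auto
    qed
    then have "AE \<omega> in P. X \<omega> = 0"
    proof eventually_elim
      case (elim \<omega>)
      then have "X \<omega> \<notin> \<Union>F" using F'(3) by blast
      then show ?case using *[of "X \<omega>"] unfolding F_def by blast
    qed
    with X_nz show False by blast
  qed
  then obtain x where x: "x \<noteq> 0" "\<And>U. open U \<Longrightarrow> x \<in> U \<Longrightarrow> prob (X -` U \<inter> space P) \<noteq> 0" by blast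
  have eps: "prob (\<epsilon> -` B \<inter> space P) \<noteq> 0" if B: "open B" "B \<noteq> {}" for B
  proof
    assume "prob (\<epsilon> -` B \<inter> space P) = 0"
    then have "(\<integral>\<^sup>+t. ennreal (k t) * indicator B t \<partial>lborel) = 0"
      using distributed_emeasure[OF \<epsilon>, of B] B by (simp add: emeasure_eq_measure)
    moreover have "(\<lambda>t. ennreal (k t)) \<in> borel_measurable lborel" using \<epsilon> by (auto simp: distributed_def)
    ultimately have "AE t in lborel. ennreal (k t) * indicator B t = 0"
      using B by (subst (asm) nn_integral_0_iff_AE) auto
    then have "AE t in lborel. t \<notin> B"
    proof eventually_elim
      case (elim t)
      then show ?case using k[of t] by (auto simp: indicator_def ennreal_eq_0_iff split: if_splits)
    qed
    then have "B \<in> null_sets lborel" using B by (subst null_sets_def) (auto simp: AE_iff_measurable[OF _ refl])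
    then have "negligible B" by (simp add: negligible_iff_null_sets null_sets_completionI)
    then show False using open_not_negligible B by blast
  qed
  have "(x, y) \<in> measure_support (distr P borel (\<lambda>\<omega>. (X \<omega>, Y \<omega>)))" for y
    unfolding measure_support_def
  proof (intro CollectI allI impI)
    fix U assume U: "open U" "(x, y) \<in> U"
    \<comment> \<open>The same event expressed through \<open>(X, \<epsilon>)\<close>, where a
      product neighbourhood has a product probability.\<close>
    define V where "V = (\<lambda>p. (fst p, \<beta>0 \<bullet> fst p + snd p)) -` U"
    have "open V" unfolding V_def by (intro open_vimage U continuous_intros)
    moreover have "(x, y - \<beta>0 \<bullet> x) \<in> V" using U by (simp add: V_def)
    ultimately obtain A B where AB: "open A" "open B" "(x, y - \<beta>0 \<bullet> x) \<in> A \<times> B" "A \<times> B \<subseteq> V"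
      by (rule open_prod_elim)
    have "prob ((X -` A \<inter> space P) \<inter> (\<epsilon> -` B \<inter> space P)) = prob (X -` A \<inter> space P) * prob (\<epsilon> -` B \<inter> space P)"
      using AB by (intro indep_setD[OF indep]) auto
    also have "\<dots> \<noteq> 0" using x(2)[of A] eps[of B] AB by auto
    finally have "0 < prob ((X -` A \<inter> space P) \<inter> (\<epsilon> -` B \<inter> space P))"
      using measure_nonneg[of P] by (simp add: less_le)
    also have "\<dots> \<le> prob ((\<lambda>\<omega>. (X \<omega>, Y \<omega>)) -` U \<inter> space P)"
    proof (rule finite_measure_mono)
      show "(X -` A \<inter> space P) \<inter> (\<epsilon> -` B \<inter> space P) \<subseteq> (\<lambda>\<omega>. (X \<omega>, Y \<omega>)) -` U \<inter> space P"
        using AB(4) model by (auto simp: V_def)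
      have m: "(\<lambda>\<omega>. (X \<omega>, Y \<omega>)) \<in> borel_measurable P" by measurable
      show "(\<lambda>\<omega>. (X \<omega>, Y \<omega>)) -` U \<inter> space P \<in> events" using measurable_sets[OF m, of U] U(1) by simp
    qed
    finally show "0 < emeasure (distr P borel (\<lambda>\<omega>. (X \<omega>, Y \<omega>))) U"
      using U(1) by (subst emeasure_distr) (auto simp: emeasure_eq_measure)
  qed
  with x(1) show ?thesis by (rule that)
qed

text \<open>Comparing the Hessians at \<open>(\<beta>\<^sub>0, s\<^sub>0)\<close> and \<open>(\<beta>\<^sub>0, s)\<close> over all \<open>y\<close> for one fixed \<open>x \<noteq> 0\<close> already
  turns (A10) into a bound for \<open>(log f)''\<close> on the whole line.\<close>

lemma log_hessian_bounded:
  fixes f f1 f2 :: "real \<Rightarrow> real" and x :: "real ^ 'd"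
  assumes pos: "\<And>t. 0 < f t" and f: "\<And>t. (f has_real_derivative f1 t) (at t)"
    and f1: "\<And>t. (f1 has_real_derivative f2 t) (at t)" and f2: "continuous_on UNIV f2"
    and s0: "0 < s0" and x: "x \<noteq> 0" and supp: "\<And>y. (x, y) \<in> S"
    and A10: "\<And>\<delta>. 0 < \<delta> \<Longrightarrow> \<exists>\<eta>>0. \<forall>\<beta> s. 0 < s \<longrightarrow> norm (\<beta> - \<beta>0) + \<bar>s - s0\<bar> \<le> \<eta> \<longrightarrow>
       (\<forall>i j. (SUP (x, y) \<in> S.
          ereal \<bar>partial_deriv i (partial_deriv j (\<lambda>b. ln (scaled f s0 (y - b \<bullet> x)))) \<beta>0
               - partial_deriv i (partial_deriv j (\<lambda>b. ln (scaled f s (y - b \<bullet> x)))) \<beta>\<bar>)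
          < ereal \<delta>)"
  shows "\<exists>K. \<forall>t. \<bar>f2 t / f t - (f1 t / f t)\<^sup>2\<bar> \<le> K"
proof -
  define G where "G t = f2 t / f t - (f1 t / f t)\<^sup>2" for t
  have nz: "f t \<noteq> 0" for t using pos[of t] by simp
  have "continuous_on UNIV f" "continuous_on UNIV f1"
    using f f1 by (auto intro!: DERIV_continuous_on intro: has_field_derivative_at_within)
  then have G: "continuous_on UNIV G" unfolding G_def using nz f2 by (intro continuous_intros) auto
  obtain i where i: "x $ i \<noteq> 0" using x by (auto simp: vec_eq_iff)
  obtain \<eta> where \<eta>: "0 < \<eta>" "\<And>\<beta> s. 0 < s \<Longrightarrow> norm (\<beta> - \<beta>0) + \<bar>s - s0\<bar> \<le> \<eta> \<Longrightarrow>
       (\<forall>i j. (SUP (x, y) \<in> S.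
          ereal \<bar>partial_deriv i (partial_deriv j (\<lambda>b. ln (scaled f s0 (y - b \<bullet> x)))) \<beta>0
               - partial_deriv i (partial_deriv j (\<lambda>b. ln (scaled f s (y - b \<bullet> x)))) \<beta>\<bar>)
          < ereal 1)"
    using A10[of 1] by auto
  \<comment> \<open>Strictly below \<open>s0\<close>, so that the scaling factor
    \<open>s0 / s\<close> exceeds 1, yet positive and within the distance \<open>\<eta>\<close>
    allowed by (A10).\<close>
  define s where "s = s0 - min \<eta> (s0 / 2)"
  have s: "0 < s" "s < s0" "\<bar>s - s0\<bar> \<le> \<eta>" using \<eta>(1) s0 by (auto simp: s_def min_def)
  have "\<bar>G u - (s0 / s)\<^sup>2 * G (s0 / s * u)\<bar> \<le> s0\<^sup>2 / (x $ i)\<^sup>2" for u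
  proof -
    \<comment> \<open>Every \<open>y\<close> above \<open>x\<close> is in the support; this one has
      standardised residual \<open>u\<close> at scale \<open>s0\<close> and
      \<open>s0 / s * u\<close> at scale \<open>s\<close>.\<close>
    define y where "y = \<beta>0 \<bullet> x + s0 * u"
    let ?h = "\<lambda>x y. \<bar>partial_deriv i (partial_deriv i (\<lambda>b. ln (scaled f s0 (y - b \<bullet> x)))) \<beta>0
               - partial_deriv i (partial_deriv i (\<lambda>b. ln (scaled f s (y - b \<bullet> x)))) \<beta>0\<bar>"
    have "(SUP (x, y) \<in> S. ereal (?h x y)) < ereal 1"
      using \<eta>(2)[OF s(1), of \<beta>0] s(3) by simp
    moreover have "ereal (?h x y) \<le> (SUP (x, y) \<in> S. ereal (?h x y))"
      using SUP_upper[OF supp[of y], of "\<lambda>(x, y). ereal (?h x y)"] by simp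
    ultimately have "ereal (?h x y) < ereal 1" by (rule order.strict_trans1[rotated])
    then have h: "?h x y < 1" by simp
    have u0: "(y - \<beta>0 \<bullet> x) / s0 = u" "(y - \<beta>0 \<bullet> x) / s = s0 / s * u"
      using s0 by (simp_all add: y_def)
    have "?h x y = \<bar>x $ i * x $ i / s0\<^sup>2 * G u - x $ i * x $ i / s\<^sup>2 * G (s0 / s * u)\<bar>"
      unfolding partial_deriv_log_scaled[OF pos f f1 s0] partial_deriv_log_scaled[OF pos f f1 s(1)] u0 G_def ..
    also have "x $ i * x $ i / s0\<^sup>2 * G u - x $ i * x $ i / s\<^sup>2 * G (s0 / s * u) =
        (x $ i)\<^sup>2 / s0\<^sup>2 * (G u - (s0 / s)\<^sup>2 * G (s0 / s * u))"
      using s0 s(1) by (simp add: field_simps power2_eq_square)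
    finally have "(x $ i)\<^sup>2 / s0\<^sup>2 * \<bar>G u - (s0 / s)\<^sup>2 * G (s0 / s * u)\<bar> < 1"
      using h by (simp add: abs_mult)
    then show ?thesis using i s0 by (simp add: field_simps)
  qed
  from bounded_of_scaling[OF G _ this] show ?thesis using s by (simp add: G_def)
qed

section \<open>Asymptotic normality\<close>

context regression_noise
begin

definition law :: "(real ^ ('d + unit)) measure" where
  "law = distr P borel (\<lambda>\<omega>. vec_snoc (X \<omega>) (e \<omega>))"

lemma integral_law:
  fixes \<phi> :: "real ^ ('d + unit) \<Rightarrow> real"
  assumes "\<phi> \<in> borel_measurable borel"
  shows "(\<integral>z. \<phi> z \<partial>law) = (\<integral>\<omega>. \<phi> (vec_snoc (X \<omega>) (e \<omega>)) \<partial>P)"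
    and "integrable law \<phi> \<longleftrightarrow> integrable P (\<lambda>\<omega>. \<phi> (vec_snoc (X \<omega>) (e \<omega>)))"
proof -
  have m: "(\<lambda>\<omega>. vec_snoc (X \<omega>) (e \<omega>)) \<in> borel_measurable P" by measurable
  show "(\<integral>z. \<phi> z \<partial>law) = (\<integral>\<omega>. \<phi> (vec_snoc (X \<omega>) (e \<omega>)) \<partial>P)"
    unfolding law_def by (rule integral_distr[OF m assms])
  show "integrable law \<phi> \<longleftrightarrow> integrable P (\<lambda>\<omega>. \<phi> (vec_snoc (X \<omega>) (e \<omega>)))"
    unfolding law_def by (rule integrable_distr_eq[OF m assms])
qed

lemma law_sq_integrable: "integrable law (\<lambda>z. (norm z)\<^sup>2)"
proof -
  have "has_bochner_integral P (\<lambda>\<omega>. (e \<omega>)\<^sup>2 * 1) ((\<integral>t. t\<^sup>2 * f t \<partial>lborel) * (\<integral>\<omega>. 1 \<partial>P))"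
    by (rule expectation_product[of "\<lambda>x. 1" "\<lambda>t. t\<^sup>2"]) (use f_sq in auto)
  then have e2: "integrable P (\<lambda>\<omega>. (e \<omega>)\<^sup>2)" by (simp add: has_bochner_integral_iff)
  have "(norm (vec_snoc (X \<omega>) (e \<omega>)))\<^sup>2 = (norm (X \<omega>))\<^sup>2 + (e \<omega>)\<^sup>2" for \<omega>
    unfolding power2_norm_eq_inner inner_vec_snoc by (simp add: power2_eq_square)
  then have "integrable P (\<lambda>\<omega>. (norm (vec_snoc (X \<omega>) (e \<omega>)))\<^sup>2)" using X_sq e2 by simp
  then show ?thesis by (subst integral_law(2)) simp_all
qed

text \<open>The covariance of the score in standardised coordinates, equal to
  \<open>s0\<^sup>2\<close> times the matrix \<open>I0\<close> of the theorem.\<close>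

definition information :: "real ^ ('d + unit) ^ ('d + unit)" where
  "information = block_diag (k1 *\<^sub>R second_moment P X) (k2 - 1)"

lemma information_inner:
  "vec_snoc a b \<bullet> (information *v vec_snoc a' b') = k1 * (a \<bullet> (second_moment P X *v a')) + (k2 - 1) * (b * b')"
  unfolding information_def block_diag_mult_vec_snoc inner_vec_snoc
  by (simp add: scaleR_matrix_vector_assoc[symmetric])

lemma second_moment_sym: "a \<bullet> (second_moment P X *v b) = b \<bullet> (second_moment P X *v a)"
  unfolding second_moment_inner[symmetric] by (simp add: mult.commute)

lemma information_pos_definite: "pos_definite information"
  unfolding information_def using k1_pos k2_gt_1 posdef
  by (intro pos_definite_block_diag pos_definite_scaleR) auto

text \<open>The information equality is checked blockwise: odd integrals remove the mixed blocks,
  the location block is \<open>k1\<close> times the second moment matrix on both sides, and the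
  scale entry is \<open>1 - (2 - k2)\<close> from the Hessian and \<open>1 - 2 + k2\<close> from the
  variance.\<close>

lemma location_scale_info_law:
  assumes sample: "iid_sample M Z law" and A: "\<And>t. g t \<le> A - \<bar>t\<bar> powr (min \<alpha> 1)"
    and l: "0 < l" "\<And>v. l * (norm v)\<^sup>2 \<le> v \<bullet> (information *v v)"
  shows "location_scale_info M Z law g g' g'' (vec_snoc 0 1) A B (min \<alpha> 1) ((*v) information) l"
proof -
  interpret iid_sample M Z law by (rule sample)
  have q: "vec_snoc 0 1 \<bullet> vec_snoc x t = t" "vec_snoc x t \<bullet> vec_snoc 0 1 = t" for x :: "real ^ 'd" and t
    by (simp_all add: inner_vec_snoc)
  have "location_scale_sample M Z law g g' g'' (vec_snoc 0 1) A B (min \<alpha> 1)"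
  proof
    show "(g has_real_derivative g' t) (at t)" "(g' has_real_derivative g'' t) (at t)"
      "\<bar>g'' t\<bar> \<le> B" "\<bar>g' t\<bar> \<le> B * \<bar>t\<bar>" for t
      by (fact g_deriv g'_deriv g''_bound g'_bound)+
    show "continuous_on UNIV g''" by (fact g''_cont)
    show "g t \<le> A - \<bar>t\<bar> powr (min \<alpha> 1)" for t by (fact A)
    show "0 < min \<alpha> 1" "min \<alpha> 1 \<le> 1" using alpha by auto
    show "norm (vec_snoc (0 :: real ^ 'd) 1) = 1" by (simp add: norm_eq_sqrt_inner inner_vec_snoc)
    show "integrable law (\<lambda>z. (norm z)\<^sup>2)" by (fact law_sq_integrable)
    show "\<not> (AE z in law. \<eta> \<bullet> z = 0)" if "\<eta> \<noteq> 0" for \<eta>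
    proof -
      obtain a b where \<eta>: "\<eta> = vec_snoc a b" by (rule vec_snoc_cases)
      show ?thesis
        using nondegenerate[of a b] that unfolding \<eta> law_def by (subst AE_distr_iff) (auto simp: inner_vec_snoc)
    qed
    show "ln (\<eta> \<bullet> vec_snoc 0 1) + (\<integral>z. g (\<eta> \<bullet> z) \<partial>law) < (\<integral>z. g (vec_snoc 0 1 \<bullet> z) \<partial>law)"
      if "0 < \<eta> \<bullet> vec_snoc 0 1" "\<eta> \<noteq> vec_snoc 0 1" for \<eta>
    proof -
      obtain a b where \<eta>: "\<eta> = vec_snoc a b" by (rule vec_snoc_cases)
      show ?thesis using kl_strict[of b a] that
        by (subst (1 2) integral_law; simp add: \<eta> inner_vec_snoc)
    qed
  qed
  then interpret S: location_scale_sample M Z law g g' g'' "vec_snoc 0 1" A B "min \<alpha> 1" .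
  show ?thesis
  proof

    show "0 < l" by (fact l)
    show "l * (norm v)\<^sup>2 \<le> v \<bullet> (information *v v)" for v by (fact l)
    show "v \<bullet> (information *v u) = (u \<bullet> vec_snoc 0 1) * (v \<bullet> vec_snoc 0 1) -
        (\<integral>z. g'' (vec_snoc 0 1 \<bullet> z) * (u \<bullet> z) * (v \<bullet> z) \<partial>law)" for u v
    proof -
      obtain a b where u: "u = vec_snoc a b" by (rule vec_snoc_cases)
      obtain a' b' where v: "v = vec_snoc a' b'" by (rule vec_snoc_cases)
      have "(\<integral>z. g'' (vec_snoc 0 1 \<bullet> z) * (u \<bullet> z) * (v \<bullet> z) \<partial>law) =
          (\<integral>\<omega>. g'' (e \<omega>) * (a \<bullet> X \<omega> + b * e \<omega>) * (a' \<bullet> X \<omega> + b' * e \<omega>) \<partial>P)"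
        by (subst integral_law) (simp_all add: u v inner_vec_snoc)
      also have "\<dots> = (- k1) * (a \<bullet> (second_moment P X *v a')) + b * b' * (2 - k2)"
        using expectation_quadratic[of g'' a b a' b'] integrable_f_moments
        by (simp add: has_bochner_integral_iff integral_odd_moments integral_hessian_location
            integral_hessian_scale k1_def k2_def)
      finally show ?thesis
        unfolding u v information_inner q by (simp add: second_moment_sym[of a' a] algebra_simps)
    qed
    have psi: "v \<bullet> (S.\<psi> (vec_snoc (X \<omega>) (e \<omega>))) =
        - b - g' (e \<omega>) * (a \<bullet> X \<omega> + b * e \<omega>)" if "v = vec_snoc a b" for v a b \<omega>
      unfolding that S.\<psi>_def by (simp add: inner_diff_right inner_vec_snoc)
    have lin: "has_bochner_integral P (\<lambda>\<omega>. g' (e \<omega>) * (a \<bullet> X \<omega> + b * e \<omega>)) (- b)" for a b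
      using expectation_linear[of g' a b] integrable_f_moments
      by (simp add: integral_odd_moments integral_score_scale)
    have m1: "(\<lambda>z. v \<bullet> S.\<psi> z) \<in> borel_measurable borel" for v :: "real ^ ('d + unit)"
      unfolding S.\<psi>_def by measurable
    have const: "has_bochner_integral P (\<lambda>\<omega>. c) c" for c :: real
      by (simp add: has_bochner_integral_iff P.prob_space)
    show "(\<integral>z. v \<bullet> S.\<psi> z \<partial>law) = 0" for v
    proof -
      obtain a b where v: "v = vec_snoc a b" by (rule vec_snoc_cases)
      have "has_bochner_integral P (\<lambda>\<omega>. - b - g' (e \<omega>) * (a \<bullet> X \<omega> + b * e \<omega>)) (- b - (- b))"
        by (intro has_bochner_integral_diff const lin)
      then show ?thesis
        using m1[of v] by (subst integral_law) (simp_all add: psi[OF v] has_bochner_integral_iff)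
    qed
    have sq: "has_bochner_integral P
        (\<lambda>\<omega>. (v \<bullet> (S.\<psi> (vec_snoc (X \<omega>) (e \<omega>))))\<^sup>2)
        (v \<bullet> (information *v v))" for v
    proof -
      obtain a b where v: "v = vec_snoc a b" by (rule vec_snoc_cases)
      have quad: "has_bochner_integral P (\<lambda>\<omega>. (g' (e \<omega>))\<^sup>2 * (a \<bullet> X \<omega> + b * e \<omega>) * (a \<bullet> X \<omega> + b * e \<omega>))
          (k1 * (a \<bullet> (second_moment P X *v a)) + b * b * k2)"
        using expectation_quadratic[of "\<lambda>t. (g' t)\<^sup>2" a b a b] integrable_f_moments
        by (simp add: integral_odd_moments k1_def k2_def)
      have "has_bochner_integral P (\<lambda>\<omega>. b\<^sup>2 + 2 * b * (g' (e \<omega>) * (a \<bullet> X \<omega> + b * e \<omega>)) +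
          (g' (e \<omega>))\<^sup>2 * (a \<bullet> X \<omega> + b * e \<omega>) * (a \<bullet> X \<omega> + b * e \<omega>))
          (b\<^sup>2 + 2 * b * (- b) + (k1 * (a \<bullet> (second_moment P X *v a)) + b * b * k2))"
        by (intro has_bochner_integral_add has_bochner_integral_mult_right const lin quad)
      moreover have "b\<^sup>2 + 2 * b * (g' (e \<omega>) * (a \<bullet> X \<omega> + b * e \<omega>)) +
          (g' (e \<omega>))\<^sup>2 * (a \<bullet> X \<omega> + b * e \<omega>) * (a \<bullet> X \<omega> + b * e \<omega>) =
          (- b - g' (e \<omega>) * (a \<bullet> X \<omega> + b * e \<omega>))\<^sup>2" for \<omega>
        by (simp add: power2_eq_square algebra_simps)
      moreover have "b\<^sup>2 + 2 * b * (- b) + (k1 * (a \<bullet> (second_moment P X *v a)) + b * b * k2) =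
          v \<bullet> (information *v v)"
        unfolding v information_inner by (simp add: power2_eq_square algebra_simps)
      ultimately show ?thesis unfolding psi[OF v] by simp
    qed
    have m: "(\<lambda>z. (v \<bullet> S.\<psi> z)\<^sup>2) \<in> borel_measurable borel"
      for v :: "real ^ ('d + unit)" unfolding S.\<psi>_def by measurable
    show "integrable law (\<lambda>z. (v \<bullet> S.\<psi> z)\<^sup>2)" for v
      unfolding integral_law(2)[OF m] using sq[of v] by (simp only: has_bochner_integral_iff)
    show "(\<integral>z. (v \<bullet> S.\<psi> z)\<^sup>2 \<partial>law) = v \<bullet> (information *v v)" for v
      unfolding integral_law(1)[OF m] using sq[of v] by (simp only: has_bochner_integral_iff)
  qed
qed

text \<open>The formula for \<open>T\<close> is asked for only where
  \<open>\<eta> \<bullet> vec_snoc 0 1\<close> is positive; there \<open>s0\<close> divided by this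
  inner product is the estimated scale.\<close>

lemma mle_limit:
  fixes M :: "'w measure" and Z :: "nat \<Rightarrow> 'w \<Rightarrow> real ^ ('d + unit)"
    and \<eta> T :: "nat \<Rightarrow> 'w \<Rightarrow> real ^ ('d + unit)" and s :: "nat \<Rightarrow> 'w \<Rightarrow> real"
  assumes sample: "iid_sample M Z law" and s0: "0 < s0"
    and \<eta>_meas[measurable]: "\<And>n. \<eta> n \<in> borel_measurable M" and T_meas[measurable]: "\<And>n. T n \<in> borel_measurable M"
    and max: "AE \<omega> in M. \<forall>\<^sub>F n in sequentially. 0 < \<eta> n \<omega> \<bullet> vec_snoc 0 1 \<and>
      (\<forall>\<eta>'. 0 < \<eta>' \<bullet> vec_snoc 0 1 \<longrightarrow>
        n * ln (\<eta>' \<bullet> vec_snoc 0 1) + (\<Sum>i=1..n. g (\<eta>' \<bullet> Z i \<omega>)) \<le>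
        n * ln (\<eta> n \<omega> \<bullet> vec_snoc 0 1) + (\<Sum>i=1..n. g (\<eta> n \<omega> \<bullet> Z i \<omega>)))"
    and T: "\<And>n \<omega>. 0 < \<eta> n \<omega> \<bullet> vec_snoc 0 1 \<Longrightarrow>
      T n \<omega> = (sqrt n * (s0 / (\<eta> n \<omega> \<bullet> vec_snoc 0 1))) *\<^sub>R (vec_snoc 0 1 - \<eta> n \<omega>)"
  shows "converges_in_distribution M T (multivariate_normal 0 (matrix_inv ((1 / s0\<^sup>2) *\<^sub>R information)))"
proof -
  obtain A where A: "\<And>t. g t \<le> A - \<bar>t\<bar> powr (min \<alpha> 1)" using g_upper by blast
  obtain l where l: "0 < l" "\<And>v. l * (norm v)\<^sup>2 \<le> v \<bullet> (information *v v)"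
    using pos_definite_coercive[OF information_pos_definite] by blast
  let ?q = "vec_snoc (0 :: real ^ 'd) 1"
  interpret L: location_scale_info M Z law g g' g'' ?q A B "min \<alpha> 1" "(*v) information" l
    by (rule location_scale_info_law[OF sample A l])
  define \<delta> where "\<delta> n \<omega> = ?q - \<eta> n \<omega>" for n \<omega>
  have qq: "?q \<bullet> ?q = 1" by (simp add: inner_vec_snoc)
  have \<eta>\<delta>: "\<eta> n \<omega> = ?q - \<delta> n \<omega>" "\<eta> n \<omega> \<bullet> ?q = 1 - \<delta> n \<omega> \<bullet> ?q" for n \<omega>
    by (simp_all add: \<delta>_def inner_diff_left qq)
  have inner_meas: "(\<lambda>\<omega>. \<eta> n \<omega> \<bullet> Z i \<omega>) \<in> borel_measurable M" "(\<lambda>\<omega>. b \<bullet> Z i \<omega>) \<in> borel_measurable M"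
    if "i \<in> {1..n}" for i n b
    using L.Z_measurable[of i] that by (auto intro!: borel_measurable_inner)
  have sum_g[measurable]: "(\<lambda>\<omega>. \<Sum>i=1..n. g (\<eta> n \<omega> \<bullet> Z i \<omega>)) \<in> borel_measurable M" for n
    by (intro borel_measurable_sum measurable_compose[OF inner_meas(1)] measurable_f) auto
  have sum_g'[measurable]: "(\<lambda>\<omega>. \<Sum>i=1..n. g' (\<eta> n \<omega> \<bullet> Z i \<omega>) * (b \<bullet> Z i \<omega>)) \<in> borel_measurable M" for n b
    by (intro borel_measurable_sum borel_measurable_times measurable_compose[OF inner_meas(1)] inner_meas(2) measurable_f) auto
  \<comment> \<open>Finitely many comparisons of measurable functions, with the truth as the only
    competitor and score equations only in basis directions; this makes the event measurable. The
    score equation for arbitrary \<open>v\<close> follows by linearity.\<close>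
  define E where "E n \<omega> \<longleftrightarrow> 0 < \<eta> n \<omega> \<bullet> ?q \<and>
      L.avg (\<lambda>z. g (?q \<bullet> z)) n \<omega> \<le> ln (\<eta> n \<omega> \<bullet> ?q) + (\<Sum>i=1..n. g (\<eta> n \<omega> \<bullet> Z i \<omega>)) / n \<and>
      (\<forall>b\<in>Basis. (b \<bullet> ?q) / (\<eta> n \<omega> \<bullet> ?q) + (\<Sum>i=1..n. g' (\<eta> n \<omega> \<bullet> Z i \<omega>) * (b \<bullet> Z i \<omega>)) / n = 0)" for n \<omega>
  have E: "L.whp E"
  proof (rule L.whp_AE_eventually)
    show "AE \<omega> in M. \<forall>\<^sub>F n in sequentially. E n \<omega>"
      using max
    proof eventually_elim
      case (elim \<omega>)
      then show ?case using eventually_gt_at_top[of 0]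
      proof eventually_elim
        case (elim n)
        then have pos: "0 < \<eta> n \<omega> \<bullet> ?q" and n: "0 < real n"
          and mx: "\<And>\<eta>'. 0 < \<eta>' \<bullet> ?q \<Longrightarrow> n * ln (\<eta>' \<bullet> ?q) + (\<Sum>i=1..n. g (\<eta>' \<bullet> Z i \<omega>)) \<le>
            n * ln (\<eta> n \<omega> \<bullet> ?q) + (\<Sum>i=1..n. g (\<eta> n \<omega> \<bullet> Z i \<omega>))" by auto
        have "(\<Sum>i=1..n. g (?q \<bullet> Z i \<omega>)) \<le> n * ln (\<eta> n \<omega> \<bullet> ?q) + (\<Sum>i=1..n. g (\<eta> n \<omega> \<bullet> Z i \<omega>))"
          using mx[of ?q] by (simp add: qq)
        then have "L.avg (\<lambda>z. g (?q \<bullet> z)) n \<omega> \<le> (n * ln (\<eta> n \<omega> \<bullet> ?q) + (\<Sum>i=1..n. g (\<eta> n \<omega> \<bullet> Z i \<omega>))) / n"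
          unfolding L.avg_def using n by (intro divide_right_mono) auto
        also have "\<dots> = ln (\<eta> n \<omega> \<bullet> ?q) + (\<Sum>i=1..n. g (\<eta> n \<omega> \<bullet> Z i \<omega>)) / n"
          using n by (simp add: add_divide_distrib)
        finally have 1: "L.avg (\<lambda>z. g (?q \<bullet> z)) n \<omega> \<le> ln (\<eta> n \<omega> \<bullet> ?q) + (\<Sum>i=1..n. g (\<eta> n \<omega> \<bullet> Z i \<omega>)) / n" .
        have 2: "(b \<bullet> ?q) / (\<eta> n \<omega> \<bullet> ?q) + (\<Sum>i=1..n. g' (\<eta> n \<omega> \<bullet> Z i \<omega>) * (b \<bullet> Z i \<omega>)) / n = 0" for b
        proof -
          have "(real n * ((b \<bullet> ?q) / (\<eta> n \<omega> \<bullet> ?q)) + (\<Sum>i=1..n. g' (\<eta> n \<omega> \<bullet> Z i \<omega>) * (b \<bullet> Z i \<omega>))) / n = 0"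
            using score_zero_at_maximizer[of g g' "\<eta> n \<omega>" ?q n "\<lambda>i. Z i \<omega>" b, OF g_deriv pos mx] by simp
          then show ?thesis using n by (simp add: add_divide_distrib)
        qed
        show ?case unfolding E_def using pos 1 2 by blast
      qed
    qed
    have am[measurable]: "L.avg (\<lambda>z. g (?q \<bullet> z)) n \<in> borel_measurable M" for n
      by (rule L.avg_measurable) measurable
    have q_meas: "(\<lambda>\<omega>. \<eta> n \<omega> \<bullet> ?q) \<in> borel_measurable M" for n
      by (intro borel_measurable_inner \<eta>_meas borel_measurable_const)
    have f_meas: "(\<lambda>\<omega>. ln (\<eta> n \<omega> \<bullet> ?q) + (\<Sum>i=1..n. g (\<eta> n \<omega> \<bullet> Z i \<omega>)) / n) \<in> borel_measurable M" for n
      by (intro borel_measurable_add borel_measurable_divide borel_measurable_ln q_meas sum_g borel_measurable_const)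
    have s_meas: "(\<lambda>\<omega>. (b \<bullet> ?q) / (\<eta> n \<omega> \<bullet> ?q) + (\<Sum>i=1..n. g' (\<eta> n \<omega> \<bullet> Z i \<omega>) * (b \<bullet> Z i \<omega>)) / n) \<in> borel_measurable M" for n b
      by (intro borel_measurable_add borel_measurable_divide q_meas sum_g' borel_measurable_const)
    have p: "Measurable.pred M (\<lambda>\<omega>. 0 < \<eta> n \<omega> \<bullet> ?q)"
      "Measurable.pred M (\<lambda>\<omega>. L.avg (\<lambda>z. g (?q \<bullet> z)) n \<omega> \<le> ln (\<eta> n \<omega> \<bullet> ?q) + (\<Sum>i=1..n. g (\<eta> n \<omega> \<bullet> Z i \<omega>)) / n)"
      "Measurable.pred M (\<lambda>\<omega>. (b \<bullet> ?q) / (\<eta> n \<omega> \<bullet> ?q) + (\<Sum>i=1..n. g' (\<eta> n \<omega> \<bullet> Z i \<omega>) * (b \<bullet> Z i \<omega>)) / n = 0)" for n b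
      unfolding pred_def
      by (rule borel_measurable_less[OF borel_measurable_const q_meas] borel_measurable_le[OF am f_meas]
          borel_measurable_eq[OF s_meas borel_measurable_const])+
    show "{\<omega> \<in> space M. E n \<omega>} \<in> sets M" for n
      unfolding E_def pred_def[symmetric]
      by (intro pred_intros_logic pred_intros_finite finite_Basis p)
  qed
  have max': "L.whp (\<lambda>n \<omega>. 0 < \<eta> n \<omega> \<bullet> ?q \<and>
      L.avg (\<lambda>z. g (?q \<bullet> z)) n \<omega> \<le> ln (\<eta> n \<omega> \<bullet> ?q) + L.avg (\<lambda>z. g (\<eta> n \<omega> \<bullet> z)) n \<omega>)"
    by (rule L.whp_mono[OF E]) (auto simp: E_def L.avg_def intro!: always_eventually)
  have small: "L.whp (\<lambda>n \<omega>. norm (\<delta> n \<omega>) < r)" if "0 < r" for r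
    using L.consistent[OF max' that] unfolding \<delta>_def by (simp add: norm_minus_commute)
  have score: "L.whp (\<lambda>n \<omega>. \<forall>v. (v \<bullet> ?q) / (1 - \<delta> n \<omega> \<bullet> ?q) +
      L.avg (\<lambda>z. g' ((?q - \<delta> n \<omega>) \<bullet> z) * (v \<bullet> z)) n \<omega> = 0)"
  proof (rule L.whp_mono[OF E], intro always_eventually allI ballI impI)
    fix n \<omega> v assume "E n \<omega>"
    then have b: "(b \<bullet> ?q) / (\<eta> n \<omega> \<bullet> ?q) + L.avg (\<lambda>z. g' (\<eta> n \<omega> \<bullet> z) * (b \<bullet> z)) n \<omega> = 0" if "b \<in> Basis" for b
      using that by (simp add: E_def L.avg_def)
    have "(v \<bullet> ?q) / (\<eta> n \<omega> \<bullet> ?q) = (\<Sum>b\<in>Basis. (v \<bullet> b) * ((b \<bullet> ?q) / (\<eta> n \<omega> \<bullet> ?q)))"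
      by (subst euclidean_inner) (simp add: sum_divide_distrib inner_commute)
    moreover have "L.avg (\<lambda>z. g' (\<eta> n \<omega> \<bullet> z) * (v \<bullet> z)) n \<omega> =
        (\<Sum>b\<in>Basis. (v \<bullet> b) * L.avg (\<lambda>z. g' (\<eta> n \<omega> \<bullet> z) * (b \<bullet> z)) n \<omega>)"
    proof -
      have "g' (\<eta> n \<omega> \<bullet> z) * (v \<bullet> z) = (\<Sum>b\<in>Basis. (v \<bullet> b) * (g' (\<eta> n \<omega> \<bullet> z) * (b \<bullet> z)))" for z
        by (subst euclidean_inner[of v z]) (simp add: sum_distrib_left inner_commute mult_ac)
      then show ?thesis by (simp only: L.avg_sum L.avg_cmult)
    qed
    ultimately have "(v \<bullet> ?q) / (\<eta> n \<omega> \<bullet> ?q) + L.avg (\<lambda>z. g' (\<eta> n \<omega> \<bullet> z) * (v \<bullet> z)) n \<omega> =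
        (\<Sum>b\<in>Basis. (v \<bullet> b) * ((b \<bullet> ?q) / (\<eta> n \<omega> \<bullet> ?q) + L.avg (\<lambda>z. g' (\<eta> n \<omega> \<bullet> z) * (b \<bullet> z)) n \<omega>))"
      by (simp add: sum.distrib[symmetric] distrib_left)
    also have "\<dots> = 0" using b by (intro sum.neutral) auto
    finally show "(v \<bullet> ?q) / (1 - \<delta> n \<omega> \<bullet> ?q) + L.avg (\<lambda>z. g' ((?q - \<delta> n \<omega>) \<bullet> z) * (v \<bullet> z)) n \<omega> = 0"
      unfolding \<eta>\<delta>(2) unfolding \<eta>\<delta>(1) .
  qed
  have exp: "L.whp (\<lambda>n \<omega>. \<forall>v. \<bar>v \<bullet> (information *v \<delta> n \<omega>) - L.avg (\<lambda>z. v \<bullet> L.\<psi> z) n \<omega>\<bar>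
      \<le> \<tau> * norm v * norm (\<delta> n \<omega>))" if "0 < \<tau>" for \<tau>
    by (rule L.score_expansion[OF score _ that]) (rule small)
  define sh where "sh n \<omega> = s0 / (\<eta> n \<omega> \<bullet> ?q)" for n \<omega>
  have dec: "L.whp (\<lambda>n \<omega>. T n \<omega> = (sqrt n * sh n \<omega>) *\<^sub>R \<delta> n \<omega>)"
    by (rule L.whp_mono[OF E]) (auto simp: E_def T \<delta>_def sh_def intro!: always_eventually)
  have sh: "L.whp (\<lambda>n \<omega>. \<bar>sh n \<omega> - s0\<bar> < \<tau>)" if \<tau>: "0 < \<tau>" for \<tau>
  proof -
    \<comment> \<open>The entry \<open>1 / 2\<close> keeps the denominator
      \<open>1 - \<delta> \<bullet> ?q\<close> above \<open>1 / 2\<close>, so the error of the scale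
      is at most \<open>2 * s0 * r\<close>; the other entry makes this less than
      \<open>\<tau>\<close>.\<close>
    define r where "r = min (1 / 2) (\<tau> / (2 * s0 + 1))"
    have r: "0 < r" "r \<le> 1 / 2" "2 * s0 * r < \<tau>"
    proof -
      show "0 < r" using \<tau> s0 by (simp add: r_def)
      show "r \<le> 1 / 2" unfolding r_def by (rule min.cobounded1)
      have "2 * s0 * r \<le> 2 * s0 * (\<tau> / (2 * s0 + 1))" using s0 by (intro mult_left_mono) (auto simp: r_def)
      also have "\<dots> < \<tau>"
        unfolding times_divide_eq_right using s0 \<tau> by (subst pos_divide_less_eq) (auto simp: algebra_simps)
      finally show "2 * s0 * r < \<tau>" .
    qed
    show ?thesis
    proof (rule L.whp_mono[OF small[OF r(1)]], intro always_eventually allI ballI impI)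
      fix n \<omega> assume d: "norm (\<delta> n \<omega>) < r"
      let ?k = "\<delta> n \<omega> \<bullet> ?q"
      have k: "\<bar>?k\<bar> < r" using d Cauchy_Schwarz_ineq2[of "\<delta> n \<omega>" ?q] L.norm_q by simp
      then have h: "1 / 2 < 1 - ?k" using r(2) by linarith
      have "sh n \<omega> - s0 = s0 * ?k / (1 - ?k)" unfolding sh_def \<eta>\<delta>(2) using h by (simp add: field_simps)
      then have "\<bar>sh n \<omega> - s0\<bar> = s0 * \<bar>?k\<bar> / (1 - ?k)" using h s0 by (simp add: abs_mult)
      also have "\<dots> \<le> s0 * \<bar>?k\<bar> / (1 / 2)" using h s0 by (intro divide_left_mono) auto
      also have "\<dots> \<le> 2 * s0 * r" using k s0 by (simp add: mult_left_mono)
      finally show "\<bar>sh n \<omega> - s0\<bar> < \<tau>" using r(3) by simp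
    qed
  qed
  define S where "S = (1 / s0\<^sup>2) *\<^sub>R information"
  have S: "pos_definite S" unfolding S_def using s0 by (intro pos_definite_scaleR information_pos_definite) simp
  obtain B' where B': "det B' \<noteq> 0" "matrix_inv S = B' ** transpose B'" "transpose B' ** S ** B' = mat 1"
    using pos_definite_factor[OF S] by metis
  have SS: "S ** matrix_inv S = mat 1"
  proof -
    have "B' ** (transpose B' ** S) = mat 1" using B'(3) matrix_left_right_inverse by blast
    then have "matrix_inv S ** S = mat 1" unfolding B'(2) by (simp add: matrix_mul_assoc)
    then show ?thesis using matrix_left_right_inverse by blast
  qed
  have "converges_weakly (\<lambda>n. distr M borel (T n)) (multivariate_normal 0 (matrix_inv S))"
  proof (rule converges_weakly_cos)
    show "prob_space (distr M borel (T n))" for n by (rule L.prob_space_distr) measurable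
    show "prob_space (multivariate_normal 0 (matrix_inv S))" by (rule prob_space_multivariate_normal[OF S])
    show "sets (multivariate_normal 0 (matrix_inv S)) = sets borel" by (rule sets_multivariate_normal)
    show "\<exists>L. \<forall>\<^sub>F n in sequentially. measure (distr M borel (T n)) {x. L < norm x} \<le> \<epsilon>" if "0 < \<epsilon>" for \<epsilon>
    proof -
      have "\<exists>K. \<forall>\<^sub>F n in sequentially. L.prob {\<omega> \<in> space M. K < norm (T n \<omega>)} \<le> \<epsilon>"
        by (rule L.scaled_tight[OF _ dec _ s0 T_meas that]) (erule exp, erule sh)
      then obtain K where K: "\<forall>\<^sub>F n in sequentially. L.prob {\<omega> \<in> space M. K < norm (T n \<omega>)} \<le> \<epsilon>" ..
      have "measure (distr M borel (T n)) {x. K < norm x} = L.prob {\<omega> \<in> space M. K < norm (T n \<omega>)}" for n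
        by (subst measure_distr) (auto intro!: arg_cong[of _ _ L.prob])
      with K show ?thesis by (intro exI[of _ K]) simp
    qed
    fix t :: "real ^ ('d + unit)" and a :: real
    interpret N: prob_space "multivariate_normal 0 (matrix_inv S)" by (rule prob_space_multivariate_normal[OF S])
    have tm: "(\<lambda>x. t \<bullet> x) \<in> borel_measurable (multivariate_normal 0 (matrix_inv S))"
      unfolding measurable_cong_sets[OF sets_multivariate_normal refl] by measurable
    have lim: "(\<integral>x. cos (t \<bullet> x + a) \<partial>multivariate_normal 0 (matrix_inv S)) =
        Re (iexp a * complex_of_real (exp (- (t \<bullet> (matrix_inv S *v t)) / 2)))"
      unfolding N.integral_cos_eq[OF tm] iexp_multivariate_normal[OF S] ..
    have emp: "(\<integral>x. cos (t \<bullet> x + a) \<partial>distr M borel (T n)) = (\<integral>\<omega>. cos (t \<bullet> T n \<omega> + a) \<partial>M)" for n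
      by (rule integral_distr) measurable
    show "(\<lambda>n. \<integral>x. cos (t \<bullet> x + a) \<partial>distr M borel (T n)) \<longlonglongrightarrow>
        (\<integral>x. cos (t \<bullet> x + a) \<partial>multivariate_normal 0 (matrix_inv S))"
    \<comment> \<open>The zero direction is treated apart because the central limit theorem is
      applied with positive variance.\<close>
    proof (cases "t = 0")
      case True
      then show ?thesis unfolding emp by (simp add: L.prob_space N.prob_space)
    next
      case False
      \<comment> \<open>The solution of \<open>information *v v = t\<close>, so every direction is
        covered; \<open>s0\<^sup>2 * (v \<bullet> t)\<close> is then the variance of the limit in
        direction \<open>t\<close>.\<close>
      define v where "v = (1 / s0\<^sup>2) *\<^sub>R (matrix_inv S *v t)"
      have Jv: "information *v v = t"
      proof -
        have "information = s0\<^sup>2 *\<^sub>R S" using s0 by (simp add: S_def)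
        then have "information *v v = s0\<^sup>2 *\<^sub>R (S *v ((1 / s0\<^sup>2) *\<^sub>R (matrix_inv S *v t)))"
          unfolding v_def by (simp only: scaleR_matrix_vector_assoc)
        also have "\<dots> = (s0\<^sup>2 * (1 / s0\<^sup>2)) *\<^sub>R (S *v (matrix_inv S *v t))"
          by (simp only: linear_cmul[OF matrix_vector_mul_linear] scaleR_scaleR)
        also have "\<dots> = t" using s0 SS by (simp add: matrix_vector_mul_assoc)
        finally show ?thesis .
      qed
      have v: "v \<noteq> 0" using Jv False by auto
      have "(\<lambda>n. \<integral>\<omega>. cos ((information *v v) \<bullet> T n \<omega> + a) \<partial>M) \<longlonglongrightarrow>
          Re (iexp a * complex_of_real (exp (- (s0\<^sup>2 * (v \<bullet> (information *v v))) / 2)))"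
        by (rule L.cos_tendsto[OF _ dec _ s0 T_meas v]) (erule exp, erule sh)
      then have "(\<lambda>n. \<integral>\<omega>. cos (t \<bullet> T n \<omega> + a) \<partial>M) \<longlonglongrightarrow>
          Re (iexp a * complex_of_real (exp (- (s0\<^sup>2 * (v \<bullet> t)) / 2)))" unfolding Jv .
      moreover have "s0\<^sup>2 * (v \<bullet> t) = t \<bullet> (matrix_inv S *v t)"
        using s0 by (simp add: v_def inner_commute)
      ultimately show ?thesis unfolding emp lim by simp
    qed
  qed simp
  then show ?thesis unfolding converges_in_distribution_def S_def using T_meas by blast
qed

end

theorem theorem3:
  fixes P :: "'p measure" and M :: "'w measure"
    and X :: "'p \<Rightarrow> real ^ 'd" and Y \<epsilon> :: "'p \<Rightarrow> real"
    and Xs :: "nat \<Rightarrow> 'w \<Rightarrow> real ^ 'd" and Ys :: "nat \<Rightarrow> 'w \<Rightarrow> real"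
    and f :: "real \<Rightarrow> real" and fX :: "real ^ 'd \<Rightarrow> ennreal"
    and \<beta>0 :: "real ^ 'd" and s0 \<alpha> C c1 c2 :: real
    and \<beta>hat :: "nat \<Rightarrow> 'w \<Rightarrow> real ^ 'd" and shat :: "nat \<Rightarrow> 'w \<Rightarrow> real"
    and I0 :: "real ^ ('d + unit) ^ ('d + unit)"
  assumes "prob_space P" and "prob_space M"
    and s0: "0 < s0"
    and model: "\<And>\<omega>. \<omega> \<in> space P \<Longrightarrow> Y \<omega> = \<beta>0 \<bullet> X \<omega> + \<epsilon> \<omega>"
    and iid_indep: "prob_space.indep_vars M (\<lambda>_. borel) (\<lambda>i \<omega>. (Xs i \<omega>, Ys i \<omega>)) {1..}"
    and iid_copies: "\<And>i. 1 \<le> i \<Longrightarrow>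
       distr M borel (\<lambda>\<omega>. (Xs i \<omega>, Ys i \<omega>)) = distr P borel (\<lambda>\<omega>. (X \<omega>, Y \<omega>))"
    and A1: "prob_space.indep_set P {X -` A \<inter> space P | A. A \<in> sets borel}
       {\<epsilon> -` B \<inter> space P | B. B \<in> sets borel}"
    and A2: "distributed P lborel X fX"
    and A3_density: "distributed P lborel \<epsilon> (\<lambda>t. ennreal (scaled f s0 t))"
    and A3_even: "\<And>t. f (- t) = f t"
    and A3_bounded: "bounded (range f)"
    and A3_continuous: "continuous_on UNIV f"
    and A3_nonneg: "\<And>t. 0 \<le> f t"
    and A3_prob: "integrable lborel f" "(\<integral>t. f t \<partial>lborel) = 1"
    and A3_moment: "integrable lborel (\<lambda>t. t\<^sup>2 * f t)"
    and A4: "0 < \<alpha>" "0 < C" "\<And>t. f t \<le> C * exp (- (\<bar>t\<bar> powr \<alpha>))"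
    and A5: "(\<integral>\<^sup>+\<omega>. e2ennreal \<bar>elog (f ((Y \<omega> - \<beta>0 \<bullet> X \<omega>) / s0))\<bar> \<partial>P) < \<infinity>"
    and A6: "integrable P (\<lambda>\<omega>. norm (X \<omega>) powr (max (2 * \<alpha>) 2))"
    and A7: "antimono_on {0..} f"
    and A8: "\<And>R a. 0 < R \<Longrightarrow> 0 < a \<Longrightarrow>
       (\<integral>\<^sup>+\<omega>. e2ennreal ((elog (f ((\<bar>Y \<omega>\<bar> + R * norm (X \<omega>)) / a)))\<^sup>2) \<partial>P) < \<infinity>"
    and A9: "C2_on (interior (closure {t. f t \<noteq> 0})) f"
    and A10: "\<And>\<delta>. 0 < \<delta> \<Longrightarrow> \<exists>\<eta>>0. \<forall>\<beta> s. 0 < s \<longrightarrow> norm (\<beta> - \<beta>0) + \<bar>s - s0\<bar> \<le> \<eta> \<longrightarrow>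
       (\<forall>i j. (SUP (x, y) \<in> measure_support (distr P borel (\<lambda>\<omega>. (X \<omega>, Y \<omega>))).
          ereal \<bar>partial_deriv i (partial_deriv j (\<lambda>b. ln (scaled f s0 (y - b \<bullet> x)))) \<beta>0
               - partial_deriv i (partial_deriv j (\<lambda>b. ln (scaled f s (y - b \<bullet> x)))) \<beta>\<bar>)
          < ereal \<delta>)"
    and A11_posdef: "pos_definite (second_moment P X)"
    and A11_integral: "integrable lborel (\<lambda>t. t\<^sup>2 * ((deriv f t)\<^sup>2 / f t))"
      "0 < (\<integral>t. t\<^sup>2 * ((deriv f t)\<^sup>2 / f t) \<partial>lborel)"
    and \<beta>hat_measurable: "\<And>n. \<beta>hat n \<in> borel_measurable M"
    and shat_measurable: "\<And>n. shat n \<in> borel_measurable M"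
    and mle: "AE \<omega> in M. \<forall>\<^sub>F n in sequentially.
       is_mle f n (\<lambda>i. Xs i \<omega>) (\<lambda>i. Ys i \<omega>) (\<beta>hat n \<omega>) (shat n \<omega>)"
    and c1: "c1 = 1 / s0\<^sup>2 * (\<integral>t. (deriv f t)\<^sup>2 / f t \<partial>lborel)"
    and c2: "c2 = 1 / s0\<^sup>2 * ((\<integral>t. (deriv f t)\<^sup>2 / f t * t\<^sup>2 \<partial>lborel) - 1)"
    and I0: "I0 = block_diag (c1 *\<^sub>R second_moment P X) c2"
  shows "converges_in_distribution M
    (\<lambda>n \<omega>. sqrt (real n) *\<^sub>R (vec_snoc (\<beta>hat n \<omega>) (shat n \<omega>) - vec_snoc \<beta>0 s0))
    (multivariate_normal 0 (matrix_inv I0))"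
proof -
  interpret P: prob_space P by fact
  interpret M: prob_space M by fact
  have X[measurable]: "X \<in> borel_measurable P" using A2 by (auto simp: distributed_def)
  have \<epsilon>[measurable]: "\<epsilon> \<in> borel_measurable P" using A3_density by (auto simp: distributed_def)
  have Y[measurable]: "Y \<in> borel_measurable P"
    using model by (subst measurable_cong[of P Y "\<lambda>\<omega>. \<beta>0 \<bullet> X \<omega> + \<epsilon> \<omega>"]) auto
  have X_nz: "\<not> (AE \<omega> in P. X \<omega> = 0)" by (rule AE_neq_zero_if_pos_definite[OF A11_posdef])
  have pos: "0 < f t" for t
    by (rule density_positive[OF A3_nonneg A3_even A7 X Y _ X_nz]) (use A8[of 1] in simp)
  \<comment> \<open>With \<open>f\<close> positive everywhere the interior of its support is the
    whole line, so the smoothness in (A9) becomes global.\<close>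
  have "{t. f t \<noteq> 0} = UNIV" using pos by (auto simp: less_le)
  then have C2: "f C1_differentiable_on UNIV" "deriv f C1_differentiable_on UNIV"
    using A9 by (simp_all add: C2_on_def)
  have f1: "(f has_real_derivative deriv f t) (at t)" for t
  proof -
    obtain D1 where "(f has_vector_derivative D1 t) (at t)"
      using C2(1) unfolding C1_differentiable_on_def by blast
    then have "(f has_real_derivative D1 t) (at t)" by (simp add: has_real_derivative_iff_has_vector_derivative)
    then show ?thesis by (simp add: DERIV_imp_deriv)
  qed
  obtain f2 where f2: "\<And>t. (deriv f has_real_derivative f2 t) (at t)" and f2_cont: "continuous_on UNIV f2"
    using C2(2) unfolding C1_differentiable_on_def
    by (auto simp: has_real_derivative_iff_has_vector_derivative)
  have scaled_pos: "0 < scaled f s0 t" for t using pos s0 by (simp add: scaled_def)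
  obtain x where x: "x \<noteq> 0" "\<And>y. (x, y) \<in> measure_support (distr P borel (\<lambda>\<omega>. (X \<omega>, Y \<omega>)))"
    by (rule support_point[OF P.prob_space_axioms X A3_density scaled_pos A1 model Y X_nz]) (assumption, erule that, simp)
  obtain K where K: "\<And>t. \<bar>f2 t / f t - (deriv f t / f t)\<^sup>2\<bar> \<le> K"
    using log_hessian_bounded[OF pos f1 f2 f2_cont s0 x A10] by blast
  define e where "e \<omega> = \<epsilon> \<omega> / s0" for \<omega>
  have e[measurable]: "e \<in> borel_measurable P" unfolding e_def by measurable
  have f_meas[measurable]: "f \<in> borel_measurable borel" by (rule borel_measurable_continuous_onI[OF A3_continuous])
  have e_dist: "distributed P lborel e (\<lambda>t. ennreal (f t))"
    unfolding distributed_def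
  proof (intro conjI)
    show "distr P lborel e = density lborel (\<lambda>t. ennreal (f t))"
    proof (rule measure_eqI)
      fix A assume "A \<in> sets (distr P lborel e)"
      then have A[measurable]: "A \<in> sets borel" by simp
      have pre: "(\<lambda>t. t / s0) -` A \<in> sets borel"
        using measurable_sets[of "\<lambda>t. t / s0" borel borel A] A by simp
      have "emeasure (distr P lborel e) A = emeasure P (\<epsilon> -` ((\<lambda>t. t / s0) -` A) \<inter> space P)"
        by (subst emeasure_distr) (auto simp: e_def vimage_def)
      also have "\<dots> = (\<integral>\<^sup>+t. ennreal (scaled f s0 t) * indicator ((\<lambda>t. t / s0) -` A) t \<partial>lborel)"
        using distributed_emeasure[OF A3_density, of "(\<lambda>t. t / s0) -` A"] pre by simp
      also have "\<dots> = ennreal (1 / s0) * (\<integral>\<^sup>+t. ennreal (f (t / s0)) * indicator A (t / s0) \<partial>lborel)"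
      proof (subst nn_integral_cmult[symmetric])
        show "(\<integral>\<^sup>+t. ennreal (scaled f s0 t) * indicator ((\<lambda>t. t / s0) -` A) t \<partial>lborel) =
            (\<integral>\<^sup>+t. ennreal (1 / s0) * (ennreal (f (t / s0)) * indicator A (t / s0)) \<partial>lborel)"
          using s0 less_imp_le[OF pos]
          by (intro nn_integral_cong) (auto simp: scaled_def ennreal_mult[symmetric] split: split_indicator)
      qed measurable
      also have "\<dots> = (\<integral>\<^sup>+t. ennreal (f t) * indicator A t \<partial>lborel)"
        using s0 by (subst nn_integral_real_affine[of "\<lambda>t. ennreal (f t) * indicator A t" "1 / s0" 0]) auto
      finally show "emeasure (distr P lborel e) A = emeasure (density lborel (\<lambda>t. ennreal (f t))) A"
        by (simp add: emeasure_density)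
    qed simp
  qed measurable
  have e_indep: "P.indep_set {X -` A \<inter> space P | A. A \<in> sets borel} {e -` A \<inter> space P | A. A \<in> sets borel}"
  proof (rule P.indep_setI)
    show "{X -` A \<inter> space P |A. A \<in> sets borel} \<subseteq> P.events" "{e -` A \<inter> space P |A. A \<in> sets borel} \<subseteq> P.events"
      by (auto intro: measurable_sets[OF X] measurable_sets[OF e])
    fix U V assume "U \<in> {X -` A \<inter> space P |A. A \<in> sets borel}" "V \<in> {e -` A \<inter> space P |A. A \<in> sets borel}"
    then obtain A where U: "U \<in> {X -` A \<inter> space P |A. A \<in> sets borel}" and A: "A \<in> sets borel" "V = e -` A \<inter> space P"
      by blast
    have "(\<lambda>t. t / s0) -` A \<in> sets borel" using measurable_sets[of "\<lambda>t. t / s0" borel borel A] A by simp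
    moreover have "V = \<epsilon> -` ((\<lambda>t. t / s0) -` A) \<inter> space P" unfolding A e_def by auto
    ultimately have "V \<in> {\<epsilon> -` B \<inter> space P | B. B \<in> sets borel}" by blast
    then show "P.prob (U \<inter> V) = P.prob U * P.prob V" by (rule P.indep_setD[OF A1 U])
  qed
  have X_sq: "integrable P (\<lambda>\<omega>. (norm (X \<omega>))\<^sup>2)"
  proof (rule Bochner_Integration.integrable_bound)
    show "integrable P (\<lambda>\<omega>. 1 + norm (X \<omega>) powr (max (2 * \<alpha>) 2))" using A6 by simp
    show "AE \<omega> in P. norm ((norm (X \<omega>))\<^sup>2) \<le> norm (1 + norm (X \<omega>) powr (max (2 * \<alpha>) 2))"
    proof (rule AE_I2)
      fix \<omega>
      \<comment> \<open>The summand 1 covers \<open>norm (X \<omega>) \<le> 1\<close>, where a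
        larger exponent gives a smaller power.\<close>
      have "(norm (X \<omega>))\<^sup>2 \<le> 1 + norm (X \<omega>) powr (max (2 * \<alpha>) 2)"
      proof (cases "norm (X \<omega>) \<le> 1")
        case True
        then have "(norm (X \<omega>))\<^sup>2 \<le> 1" by (simp add: power_le_one)
        then show ?thesis by (simp add: add_increasing2)
      next
        case False
        then have "norm (X \<omega>) powr 2 \<le> norm (X \<omega>) powr (max (2 * \<alpha>) 2)" by (intro powr_mono) auto
        then show ?thesis using False by simp
      qed
      then show "norm ((norm (X \<omega>))\<^sup>2) \<le> norm (1 + norm (X \<omega>) powr (max (2 * \<alpha>) 2))" by simp
    qed
  qed measurable
  interpret R: regression_noise f "deriv f" f2 \<alpha> C K P X e
    by unfold_locales
       (fact pos A3_even f1 f2 f2_cont A3_prob A3_moment A4 A11_integral K X A11_posdef A7 e_dist e_indep X_sq)+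
  \<comment> \<open>Sends an observation \<open>(x, y)\<close> to \<open>z\<close>. Under the model
    its last coordinate is the standardised noise, so the image of the common law is
    \<open>R.law\<close>.\<close>
  define \<Phi> where "\<Phi> p = vec_snoc (fst p) ((snd p - \<beta>0 \<bullet> fst p) / s0)" for p :: "(real ^ 'd) \<times> real"
  have \<Phi>[measurable]: "\<Phi> \<in> borel_measurable borel" unfolding \<Phi>_def using s0
    by (intro vec_snoc_measurable borel_measurable_continuous_onI continuous_intros) auto
  define Z where "Z i \<omega> = \<Phi> (Xs i \<omega>, Ys i \<omega>)" for i \<omega>
  have XY[measurable]: "(\<lambda>\<omega>. (Xs i \<omega>, Ys i \<omega>)) \<in> borel_measurable M" if "1 \<le> i" for i
    using iid_indep that by (auto simp: M.indep_vars_def2)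
  have sample: "iid_sample M Z R.law"
  proof
    show "M.indep_vars (\<lambda>_. borel) Z {1..}"
      unfolding Z_def by (rule M.indep_vars_compose2[OF iid_indep]) (rule \<Phi>)
    fix i :: nat assume i: "1 \<le> i"
    have "distr M borel (Z i) = distr (distr M borel (\<lambda>\<omega>. (Xs i \<omega>, Ys i \<omega>))) borel \<Phi>"
      unfolding Z_def[abs_def] using XY[OF i] by (subst distr_distr) (auto simp: comp_def)
    also have "\<dots> = distr (distr P borel (\<lambda>\<omega>. (X \<omega>, Y \<omega>))) borel \<Phi>" unfolding iid_copies[OF i] ..
    also have "\<dots> = distr P borel (\<lambda>\<omega>. \<Phi> (X \<omega>, Y \<omega>))" by (subst distr_distr) (auto simp: comp_def)
    also have "\<dots> = R.law"
      unfolding R.law_def by (rule distr_cong) (auto simp: \<Phi>_def model e_def)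
    finally show "distr M borel (Z i) = R.law" .
  qed
  let ?q = "vec_snoc (0 :: real ^ 'd) 1"
  define \<eta> where "\<eta> n \<omega> = (if 0 < shat n \<omega> then reparam \<beta>0 s0 (\<beta>hat n \<omega>) (shat n \<omega>) else 0)" for n \<omega>
    \<comment> \<open>At \<open>shat n \<omega> = 0\<close> the convention \<open>1 / 0 = 0\<close> would make \<open>reparam\<close> equal to \<open>?q\<close>.\<close>
  define T where "T n \<omega> = sqrt (real n) *\<^sub>R (vec_snoc (\<beta>hat n \<omega>) (shat n \<omega>) - vec_snoc \<beta>0 s0)" for n \<omega>
  note [measurable] = \<beta>hat_measurable shat_measurable
  have "converges_in_distribution M T (multivariate_normal 0 (matrix_inv ((1 / s0\<^sup>2) *\<^sub>R R.information)))"
  proof (rule R.mle_limit[OF sample s0])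
    show "\<eta> n \<in> borel_measurable M" for n unfolding \<eta>_def reparam_def by measurable
    show "T n \<in> borel_measurable M" for n unfolding T_def by measurable
    show "AE \<omega> in M. \<forall>\<^sub>F n in sequentially. 0 < \<eta> n \<omega> \<bullet> ?q \<and> (\<forall>\<eta>'. 0 < \<eta>' \<bullet> ?q \<longrightarrow>
        n * ln (\<eta>' \<bullet> ?q) + (\<Sum>i=1..n. R.g (\<eta>' \<bullet> Z i \<omega>)) \<le>
        n * ln (\<eta> n \<omega> \<bullet> ?q) + (\<Sum>i=1..n. R.g (\<eta> n \<omega> \<bullet> Z i \<omega>)))"
      using mle
    proof eventually_elim
      case (elim \<omega>)
      then show ?case
      proof eventually_elim
        case (elim n)
        then have "0 < shat n \<omega>" by (simp add: is_mle_def)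
        then have "\<eta> n \<omega> = reparam \<beta>0 s0 (\<beta>hat n \<omega>) (shat n \<omega>)" by (simp add: \<eta>_def)
        then show ?case
          using mle_maximizes[OF pos s0 elim, where ?\<beta>0.0 = \<beta>0] by (simp add: R.g_def Z_def \<Phi>_def)
      qed
    qed
    fix n \<omega> assume q: "0 < \<eta> n \<omega> \<bullet> ?q"
    then have s: "0 < shat n \<omega>" by (auto simp: \<eta>_def split: if_splits)
    then have \<eta>: "\<eta> n \<omega> = reparam \<beta>0 s0 (\<beta>hat n \<omega>) (shat n \<omega>)" by (simp add: \<eta>_def)
    have "s0 / (\<eta> n \<omega> \<bullet> ?q) = shat n \<omega>"
      unfolding \<eta> using s s0 by (simp add: reparam_alt inner_vec_snoc)
    moreover have "?q - \<eta> n \<omega> = (1 / shat n \<omega>) *\<^sub>R (vec_snoc (\<beta>hat n \<omega>) (shat n \<omega>) - vec_snoc \<beta>0 s0)"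
      unfolding \<eta> reparam_def by simp
    ultimately show "T n \<omega> = (sqrt n * (s0 / (\<eta> n \<omega> \<bullet> ?q))) *\<^sub>R (?q - \<eta> n \<omega>)"
      using s by (simp add: T_def)
  qed
  moreover have "(1 / s0\<^sup>2) *\<^sub>R R.information = I0"
  proof -
    have "c1 = R.k1 / s0\<^sup>2" unfolding c1 R.k1_def R.fisher_eq by simp
    moreover have "c2 = (R.k2 - 1) / s0\<^sup>2" unfolding c2 R.k2_def R.fisher_eq by (simp add: mult_ac)
    ultimately show ?thesis
      unfolding I0 R.information_def by (auto simp: vec_eq_iff block_diag_def split: sum.split)
  qed
  ultimately show ?thesis by (simp add: T_def[abs_def])
qed

end
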